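(* For a Tychonoff $\mu$-complete $k_{\mathbb R}$-space $X$ the following conditions are equivalent: (1) $X$ is a topological sum $D\oplus K$ of a discrete space $D$ and a cosmic $k_\omega$-space $K$. (2) The free topological Abelian group $\mathsf{AG}(X)$ of $X$ is (homeomorphic to) the product $D\times K$ of a discrete space $D$ and a cosmic $k_\omega$-space $K$. (3) $X$ is an $\aleph_k$-space and $\mathsf{AG}(X)$ is a $k$-space. (4) $X$ is a $\bar\aleph_k$-space and $\mathsf{AG}(X)$ is Ascoli. (5) $X$ is a $\bar\aleph_k$-space and $\mathsf{AG}(X)$ contains no strict $\mathrm{Fin}^{\omega_1}$-fans. (6) $X$ is an $\aleph_k$-space and $\mathsf{AG}(X)$ contains no strict $\mathrm{Fin}^\omega$-fan and no $\mathrm{Fin}^{\omega_1}$-fan.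
   Context: The free topological Abelian group of $X$ is a topological Abelian group $\mathsf{AG}(X)$ with a continuous map $\delta_X:X\to\mathsf{AG}(X)$ such that for every continuous map $f:X\to Y$ to a topological Abelian group $Y$ there is a unique continuous homomorphism $\bar f:\mathsf{AG}(X)\to Y$ with $f=\bar f\circ\delta_X$. A topological sum is a disjoint topological union. "Regular" includes $T_1$. A family $\mathcal N$ of subsets of a space $Y$ is a network if for each $y\in Y$ and neighborhood $O_y$ of $y$ there is $N\in\mathcal N$ with $y\in N\subset O_y$; it is a $k$-network if for each open $U\subset Y$ and compact $K\subset U$ there is a finite $\mathcal F\subset\mathcal N$ with $K\subset\bigcup\mathcal F\subset U$; it is compact-countable if each compact subset of $Y$ meets at most countably many members of $\mathcal N$. A regular space is cosmic if it has a countable network, an $\aleph_k$-space if it has a compact-countable $k$-network, and a $\bar\aleph_k$-space if it has a compact-countable $k$-network consisting of closed sets. $Y$ is a $k$-space if $A\subset Y$ is closed whenever $A\cap K$ is closed in $K$ for every compact $K\subset Y$. $Y$ is a $k_\omega$-space if it has a countable cover $\mathcal K$ by compact subsets such that $F\subset Y$ is closed iff $F\cap K$ is closed in $K$ for all $K\in\mathcal K$. $Y$ is a $k_{\mathbb R}$-space if every function $f:Y\to\mathbb R$ whose restriction to each compact subset of $Y$ is continuous is continuous. A Tychonoff space $Y$ is Ascoli if for each compact subset $K$ of the space $C_k(Y)$ of continuous real-valued functions on $Y$ with the compact-open topology, the evaluation map $K\times Y\to\mathbb R$ is continuous. A subset $B\subset Y$ is bounded if every locally finite family of open subsets of $Y$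 each meeting $B$ is finite; $Y$ is $\mu$-complete if each closed bounded subset of $Y$ is compact. For a cardinal $\lambda$, a family $(F_\alpha)_{\alpha\in\lambda}$ of subsets of $Y$ is locally finite if each point of $Y$ has a neighborhood meeting $F_\alpha$ for only finitely many $\alpha$; it is compact-finite if each compact subset of $Y$ meets $F_\alpha$ for only finitely many $\alpha$. A set $U\subset Y$ is a functional neighborhood of $A\subset Y$ if there is a continuous $f:Y\to[0,1]$ with $f(A)\subset\{0\}$ and $f(Y\setminus U)\subset\{1\}$. A $\mathrm{Fin}^\lambda$-fan in $Y$ is a family $(F_\alpha)_{\alpha\in\lambda}$ of finite (possibly empty) subsets of $Y$ that is compact-finite but not locally finite; it is strict if each $F_\alpha$ has a functional neighborhood $U_\alpha\subset Y$ such that $(U_\alpha)_{\alpha\in\lambda}$ is compact-finite. *)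

theory Defs
  imports "HOL-Analysis.Analysis" "HOL-Algebra.Free_Abelian_Groups"
begin

definition Tychonoff_space :: "'a topology \<Rightarrow> bool" where
  "Tychonoff_space Y \<longleftrightarrow> completely_regular_space Y \<and> t1_space Y"

text \<open>The library's \<^const>\<open>regular_space\<close> does not include the axiom \<open>T\<^sub>1\<close>.\<close>

definition regular_t1_space :: "'a topology \<Rightarrow> bool" where
  "regular_t1_space Y \<longleftrightarrow> regular_space Y \<and> t1_space Y"

definition network_in :: "'a topology \<Rightarrow> 'a set set \<Rightarrow> bool" where
  "network_in Y \<N> \<longleftrightarrow> \<N> \<subseteq> Pow (topspace Y) \<and>
     (\<forall>y U. openin Y U \<and> y \<in> U \<longrightarrow> (\<exists>N\<in>\<N>. y \<in> N \<and> N \<subseteq> U))"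

definition k_network_in :: "'a topology \<Rightarrow> 'a set set \<Rightarrow> bool" where
  "k_network_in Y \<N> \<longleftrightarrow> \<N> \<subseteq> Pow (topspace Y) \<and>
     (\<forall>U K. openin Y U \<and> compactin Y K \<and> K \<subseteq> U \<longrightarrow>
        (\<exists>\<F>. finite \<F> \<and> \<F> \<subseteq> \<N> \<and> K \<subseteq> \<Union>\<F> \<and> \<Union>\<F> \<subseteq> U))"

definition compact_countable_in :: "'a topology \<Rightarrow> 'a set set \<Rightarrow> bool" where
  "compact_countable_in Y \<N> \<longleftrightarrow> (\<forall>K. compactin Y K \<longrightarrow> countable {N\<in>\<N>. N \<inter> K \<noteq> {}})"

definition cosmic_space :: "'a topology \<Rightarrow> bool" where
  "cosmic_space Y \<longleftrightarrow> regular_t1_space Y \<and> (\<exists>\<N>. countable \<N> \<and> network_in Y \<N>)"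

definition aleph_k_space :: "'a topology \<Rightarrow> bool" where
  "aleph_k_space Y \<longleftrightarrow> regular_t1_space Y \<and>
     (\<exists>\<N>. k_network_in Y \<N> \<and> compact_countable_in Y \<N>)"

definition closed_aleph_k_space :: "'a topology \<Rightarrow> bool" where
  "closed_aleph_k_space Y \<longleftrightarrow> regular_t1_space Y \<and>
     (\<exists>\<N>. k_network_in Y \<N> \<and> compact_countable_in Y \<N> \<and> (\<forall>N\<in>\<N>. closedin Y N))"

definition k_omega_space :: "'a topology \<Rightarrow> bool" where
  "k_omega_space Y \<longleftrightarrow>
     (\<exists>\<K>. countable \<K> \<and> (\<forall>K\<in>\<K>. compactin Y K) \<and> \<Union>\<K> = topspace Y \<and>
        (\<forall>F. F \<subseteq> topspace Y \<longrightarrow>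
           (closedin Y F \<longleftrightarrow> (\<forall>K\<in>\<K>. closedin (subtopology Y K) (F \<inter> K)))))"

definition k_real_space :: "'a topology \<Rightarrow> bool" where
  "k_real_space Y \<longleftrightarrow>
     (\<forall>f::'a \<Rightarrow> real.
        (\<forall>K. compactin Y K \<longrightarrow> continuous_map (subtopology Y K) euclideanreal f) \<longrightarrow>
        continuous_map Y euclideanreal f)"

text \<open>Continuous functions are represented by their extensional versions, so that two functions
  that agree on \<^term>\<open>topspace Y\<close> are the same point of the function space.\<close>

definition continuous_real_functions :: "'a topology \<Rightarrow> ('a \<Rightarrow> real) set" where
  "continuous_real_functions Y =
     {f. f \<in> extensional (topspace Y) \<and> continuous_map Y euclideanreal f}"

definition Ck_topology :: "'a topology \<Rightarrow> ('a \<Rightarrow> real) topology" where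
  "Ck_topology Y = topology_generated_by
     {{f \<in> continuous_real_functions Y. f ` K \<subseteq> U} | K U. compactin Y K \<and> open U}"

lemma topspace_Ck_topology: "topspace (Ck_topology Y) = continuous_real_functions Y"
proof -
  have "\<exists>K U. continuous_real_functions Y = {f \<in> continuous_real_functions Y. f ` K \<subseteq> U}
      \<and> compactin Y K \<and> open (U :: real set)"
    by (rule exI[of _ "{}"], rule exI[of _ UNIV]) auto
  then show ?thesis
    unfolding Ck_topology_def topology_generated_by_topspace by blast
qed

definition Ascoli_space :: "'a topology \<Rightarrow> bool" where
  "Ascoli_space Y \<longleftrightarrow> Tychonoff_space Y \<and>
     (\<forall>\<K>. compactin (Ck_topology Y) \<K> \<longrightarrow>
        continuous_map (prod_topology (subtopology (Ck_topology Y) \<K>) Y) euclideanreal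
          (\<lambda>(f, y). f y))"

definition bounded_in :: "'a topology \<Rightarrow> 'a set \<Rightarrow> bool" where
  "bounded_in Y B \<longleftrightarrow> B \<subseteq> topspace Y \<and>
     (\<forall>\<U>. locally_finite_in Y \<U> \<and> (\<forall>U\<in>\<U>. openin Y U \<and> U \<inter> B \<noteq> {}) \<longrightarrow> finite \<U>)"

definition mu_complete_space :: "'a topology \<Rightarrow> bool" where
  "mu_complete_space Y \<longleftrightarrow> (\<forall>B. closedin Y B \<and> bounded_in Y B \<longrightarrow> compactin Y B)"

text \<open>Families are indexed by a set \<open>I\<close>, and repetitions among the members count
  (unlike in the library's \<^const>\<open>locally_finite_in\<close>, which concerns sets of sets).\<close>

definition locally_finite_family :: "'a topology \<Rightarrow> 'i set \<Rightarrow> ('i \<Rightarrow> 'a set) \<Rightarrow> bool" where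
  "locally_finite_family Y I F \<longleftrightarrow>
     (\<forall>y\<in>topspace Y. \<exists>U. openin Y U \<and> y \<in> U \<and> finite {\<alpha>\<in>I. F \<alpha> \<inter> U \<noteq> {}})"

definition compact_finite_family :: "'a topology \<Rightarrow> 'i set \<Rightarrow> ('i \<Rightarrow> 'a set) \<Rightarrow> bool" where
  "compact_finite_family Y I F \<longleftrightarrow> (\<forall>K. compactin Y K \<longrightarrow> finite {\<alpha>\<in>I. F \<alpha> \<inter> K \<noteq> {}})"

definition functional_neighborhood :: "'a topology \<Rightarrow> 'a set \<Rightarrow> 'a set \<Rightarrow> bool" where
  "functional_neighborhood Y A U \<longleftrightarrow> A \<subseteq> topspace Y \<and> U \<subseteq> topspace Y \<and>
     (\<exists>f. continuous_map Y (top_of_set {0..1::real}) f \<and>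
        f ` A \<subseteq> {0} \<and> f ` (topspace Y - U) \<subseteq> {1})"

definition Fin_fan :: "'a topology \<Rightarrow> 'i set \<Rightarrow> ('i \<Rightarrow> 'a set) \<Rightarrow> bool" where
  "Fin_fan Y I F \<longleftrightarrow> (\<forall>\<alpha>\<in>I. finite (F \<alpha>) \<and> F \<alpha> \<subseteq> topspace Y) \<and>
     compact_finite_family Y I F \<and> \<not> locally_finite_family Y I F"

definition strict_Fin_fan :: "'a topology \<Rightarrow> 'i set \<Rightarrow> ('i \<Rightarrow> 'a set) \<Rightarrow> bool" where
  "strict_Fin_fan Y I F \<longleftrightarrow> Fin_fan Y I F \<and>
     (\<exists>U. (\<forall>\<alpha>\<in>I. functional_neighborhood Y (F \<alpha>) (U \<alpha>)) \<and> compact_finite_family Y I U)"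

text \<open>Index sets of cardinalities \<open>\<omega>\<close> and \<open>\<omega>\<^sub>1\<close>; whether a space contains a (strict) fan over \<open>I\<close>
  depends only on the cardinality of \<open>I\<close>.\<close>

definition omega :: "nat set" where
  "omega = Field natLeq"

definition omega_1 :: "nat set set" where
  "omega_1 = Field (cardSuc natLeq)"

definition topological_abelian_group :: "'g monoid \<Rightarrow> 'g topology \<Rightarrow> bool" where
  "topological_abelian_group G T \<longleftrightarrow> comm_group G \<and> topspace T = carrier G \<and>
     continuous_map (prod_topology T T) T (\<lambda>(x, y). x \<otimes>\<^bsub>G\<^esub> y) \<and>
     continuous_map T T (\<lambda>x. inv\<^bsub>G\<^esub> x)"

text \<open>The universal property with respect to all topological Abelian groups whose elements have
  type \<open>'c\<close>. Homomorphisms are taken extensional, to make uniqueness meaningful.\<close>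

definition universal_for ::
    "'c itself \<Rightarrow> 'a topology \<Rightarrow> 'g monoid \<Rightarrow> 'g topology \<Rightarrow> ('a \<Rightarrow> 'g) \<Rightarrow> bool" where
  "universal_for (t :: 'c itself) X G T \<delta> \<longleftrightarrow>
     (\<forall>(H :: 'c monoid) S f. topological_abelian_group H S \<and> continuous_map X S f \<longrightarrow>
        (\<exists>!h. h \<in> extensional (carrier G) \<and> h \<in> hom G H \<and> continuous_map T S h \<and>
              (\<forall>x\<in>topspace X. f x = h (\<delta> x))))"

text \<open>One cannot quantify over types inside a definition, so universality is required for groups
  on two types only: that of the formal integer combinations of points of \<open>X\<close>, and that of the
  group itself. This already gives universality for topological Abelian groups on every type: see
  \<open>free_topological_abelian_group_universal\<close> below. By
  \<open>free_topological_abelian_group_exists\<close> there always is such a group.\<close>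

definition free_topological_abelian_group ::
    "'a topology \<Rightarrow> 'g monoid \<Rightarrow> 'g topology \<Rightarrow> ('a \<Rightarrow> 'g) \<Rightarrow> bool" where
  "free_topological_abelian_group X G T \<delta> \<longleftrightarrow>
     topological_abelian_group G T \<and> continuous_map X T \<delta> \<and>
     universal_for TYPE('a \<Rightarrow>\<^sub>0 int) X G T \<delta> \<and> universal_for TYPE('g) X G T \<delta>"

definition free_group_topology :: "'a topology \<Rightarrow> ('a \<Rightarrow>\<^sub>0 int) topology" where
  "free_group_topology X = topology_generated_by
     (insert (carrier (free_Abelian_group (topspace X)))
       {U. \<exists>S. topological_abelian_group (free_Abelian_group (topspace X)) S \<and>
               continuous_map X S frag_of \<and> openin S U})"

lemma topspace_free_group_topology:
  "topspace (free_group_topology X) = carrier (free_Abelian_group (topspace X))"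
  unfolding free_group_topology_def topology_generated_by_topspace
  by (auto simp: topological_abelian_group_def simp del: carrier_free_Abelian_group_iff
      dest: openin_subset)

lemma continuous_map_from_free_group_topology:
  assumes "topological_abelian_group (free_Abelian_group (topspace X)) S" "continuous_map X S frag_of"
  shows "continuous_map (free_group_topology X) S id"
proof -
  have "openin (free_group_topology X) U" if "openin S U" for U
    unfolding free_group_topology_def
    by (rule topology_generated_by_Basis) (use assms that in blast)
  moreover have "topspace S = carrier (free_Abelian_group (topspace X))"
    using assms(1) by (simp add: topological_abelian_group_def)
  ultimately show ?thesis
    by (auto simp: continuous_map_alt topspace_free_group_topology openin_Int vimage_def Int_absorb2
        openin_topspace dest: openin_subset simp del: carrier_free_Abelian_group_iff)
      (metis Collect_mem_eq Int_absorb2 openin_subset)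
qed

lemma continuous_map_into_free_group_topology:
  assumes "g \<in> topspace Z \<rightarrow> carrier (free_Abelian_group (topspace X))"
    and "\<And>S. \<lbrakk>topological_abelian_group (free_Abelian_group (topspace X)) S;
            continuous_map X S frag_of\<rbrakk> \<Longrightarrow> continuous_map Z S g"
  shows "continuous_map Z (free_group_topology X) g"
  unfolding free_group_topology_def
proof (rule continuous_on_generated_topo)
  fix U
  assume "U \<in> insert (carrier (free_Abelian_group (topspace X)))
       {U. \<exists>S. topological_abelian_group (free_Abelian_group (topspace X)) S \<and>
               continuous_map X S frag_of \<and> openin S U}"
  then consider "U = carrier (free_Abelian_group (topspace X))"
    | S where "topological_abelian_group (free_Abelian_group (topspace X)) S"
        "continuous_map X S frag_of" "openin S U"
    by blast
  then show "openin Z (g -` U \<inter> topspace Z)"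
  proof cases
    case 1
    then have "g -` U \<inter> topspace Z = topspace Z" using assms(1) by blast
    then show ?thesis by simp
  next
    case 2
    then show ?thesis using assms(2) by (meson continuous_map_alt)
  qed
qed (use assms(1) in blast)

lemma free_group_topology_group:
  "topological_abelian_group (free_Abelian_group (topspace X)) (free_group_topology X)"
proof -
  let ?A = "free_Abelian_group (topspace X)" and ?T = "free_group_topology X"
  interpret A: comm_group ?A by (rule abelian_free_Abelian_group)
  have "continuous_map (prod_topology ?T ?T) ?T (\<lambda>(x, y). x \<otimes>\<^bsub>?A\<^esub> y)"
  proof (rule continuous_map_into_free_group_topology)
    show "(\<lambda>(x, y). x \<otimes>\<^bsub>?A\<^esub> y) \<in> topspace (prod_topology ?T ?T) \<rightarrow> carrier ?A"
      using A.m_closed by (auto simp: topspace_free_group_topology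
          simp del: carrier_free_Abelian_group_iff mult_free_Abelian_group)
  next
    fix S assume S: "topological_abelian_group ?A S" "continuous_map X S frag_of"
    have "continuous_map (prod_topology ?T ?T) (prod_topology S S) (\<lambda>(x, y). (id x, id y))"
      by (rule continuous_map_prod_top[THEN iffD2])
        (use continuous_map_from_free_group_topology[OF S] in blast)
    moreover have "continuous_map (prod_topology S S) S (\<lambda>(x, y). x \<otimes>\<^bsub>?A\<^esub> y)"
      using S by (simp add: topological_abelian_group_def)
    ultimately have "continuous_map (prod_topology ?T ?T) S
        ((\<lambda>(x, y). x \<otimes>\<^bsub>?A\<^esub> y) \<circ> (\<lambda>(x, y). (id x, id y)))"
      by (rule continuous_map_compose)
    then show "continuous_map (prod_topology ?T ?T) S (\<lambda>(x, y). x \<otimes>\<^bsub>?A\<^esub> y)"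
      by (simp add: o_def case_prod_unfold)
  qed
  moreover have "continuous_map ?T ?T (\<lambda>x. inv\<^bsub>?A\<^esub> x)"
  proof (rule continuous_map_into_free_group_topology)
    show "(\<lambda>x. inv\<^bsub>?A\<^esub> x) \<in> topspace ?T \<rightarrow> carrier ?A"
      using A.inv_closed by (simp add: topspace_free_group_topology Pi_iff)
  next
    fix S assume S: "topological_abelian_group ?A S" "continuous_map X S frag_of"
    have "continuous_map S S (\<lambda>x. inv\<^bsub>?A\<^esub> x)"
      using S by (simp add: topological_abelian_group_def)
    from continuous_map_compose[OF continuous_map_from_free_group_topology[OF S] this]
    show "continuous_map ?T S (\<lambda>x. inv\<^bsub>?A\<^esub> x)" by (simp add: o_def)
  qed
  ultimately show ?thesis
    by (simp add: topological_abelian_group_def A.comm_group_axioms topspace_free_group_topology)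
qed

lemma frag_of_continuous: "continuous_map X (free_group_topology X) frag_of"
  by (rule continuous_map_into_free_group_topology) auto

lemma pullback_topological_abelian_group:
  assumes A: "comm_group A" and H: "topological_abelian_group H S" and h: "h \<in> hom A H"
  shows "topological_abelian_group A (pullback_topology (carrier A) h S)"
proof -
  let ?P = "pullback_topology (carrier A) h S"
  interpret A: comm_group A by fact
  interpret H: comm_group H using H by (simp add: topological_abelian_group_def)
  have top: "topspace ?P = carrier A"
    using H h by (auto simp: topspace_pullback_topology topological_abelian_group_def hom_def)
  have hc: "continuous_map ?P S h"
    using continuous_map_pullback[OF continuous_map_id, of "carrier A" h S] by simp
  have m: "continuous_map (prod_topology S S) S (\<lambda>(x, y). x \<otimes>\<^bsub>H\<^esub> y)"
    and i: "continuous_map S S (\<lambda>x. inv\<^bsub>H\<^esub> x)"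
    using H by (simp_all add: topological_abelian_group_def)
  have "continuous_map (prod_topology ?P ?P) ?P (\<lambda>(x, y). x \<otimes>\<^bsub>A\<^esub> y)"
  proof (rule continuous_map_pullback')
    have "continuous_map (prod_topology ?P ?P) (prod_topology S S) (\<lambda>(x, y). (h x, h y))"
      using hc by (simp add: continuous_map_prod_top)
    from continuous_map_compose[OF this m]
    show "continuous_map (prod_topology ?P ?P) S (h \<circ> (\<lambda>(x, y). x \<otimes>\<^bsub>A\<^esub> y))"
      by (rule continuous_map_eq) (use h in \<open>auto simp: top hom_mult\<close>)
  qed (auto simp: top)
  moreover have "continuous_map ?P ?P (\<lambda>x. inv\<^bsub>A\<^esub> x)"
  proof (rule continuous_map_pullback')
    have "group_hom A H h"
      using h by (simp add: group_hom_def group_hom_axioms_def A.is_group H.is_group)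
    then have "h (inv\<^bsub>A\<^esub> x) = inv\<^bsub>H\<^esub> (h x)" if "x \<in> carrier A" for x
      using that by (rule group_hom.hom_inv)
    with continuous_map_compose[OF hc i]
    show "continuous_map ?P S (h \<circ> (\<lambda>x. inv\<^bsub>A\<^esub> x))"
      by (auto simp: top intro: continuous_map_eq)
  qed (auto simp: top)
  ultimately show ?thesis
    by (simp add: topological_abelian_group_def A.comm_group_axioms top)
qed

lemma hom_free_Abelian_group_eqI:
  assumes H: "group H"
    and h: "h \<in> hom (free_Abelian_group S) H" and k: "k \<in> hom (free_Abelian_group S) H"
    and eq: "\<And>x. x \<in> S \<Longrightarrow> h (frag_of x) = k (frag_of x)" and c: "Poly_Mapping.keys c \<subseteq> S"
  shows "h c = k c"
proof (rule free_Abelian_group_induct[OF c])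
  show "h 0 = k 0" using hom_one[OF h _ H] hom_one[OF k _ H] by simp
next
  fix x y
  assume 2: "Poly_Mapping.keys x \<subseteq> S" "Poly_Mapping.keys y \<subseteq> S" "h x = k x" "h y = k y"
  interpret h: group_hom "free_Abelian_group S" H h
    using h H by (simp add: group_hom_def group_hom_axioms_def)
  interpret k: group_hom "free_Abelian_group S" H k
    using k H by (simp add: group_hom_def group_hom_axioms_def)
  have "x - y = x \<otimes>\<^bsub>free_Abelian_group S\<^esub> inv\<^bsub>free_Abelian_group S\<^esub> y"
    using 2 by simp
  moreover have "x \<in> carrier (free_Abelian_group S)" "y \<in> carrier (free_Abelian_group S)"
    using 2 by simp_all
  ultimately show "h (x - y) = k (x - y)"
    using 2(3,4) by (simp only: h.hom_mult h.hom_inv k.hom_mult k.hom_inv h.G.inv_closed)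
qed (rule eq)

lemma restrict_carrier_hom:
  assumes "h \<in> hom G H" "group G"
  shows "restrict h (carrier G) \<in> hom G H"
proof -
  interpret group G by fact
  show ?thesis using assms(1) by (auto simp: hom_def)
qed

lemma free_group_universal:
  "universal_for TYPE('c) X (free_Abelian_group (topspace X)) (free_group_topology X) frag_of"
  unfolding universal_for_def
proof (intro allI impI, elim conjE)
  fix H :: "'c monoid" and S f
  assume H: "topological_abelian_group H S" and f: "continuous_map X S f"
  let ?A = "free_Abelian_group (topspace X)"
  interpret H: comm_group H using H by (simp add: topological_abelian_group_def)
  have "f ` topspace X \<subseteq> carrier H"
    using f H by (auto simp: topological_abelian_group_def dest: continuous_map_image_subset_topspace)
  then obtain h where h: "h \<in> hom ?A H" "\<And>x. x \<in> topspace X \<Longrightarrow> h (frag_of x) = f x"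
    using H.free_Abelian_group_universal[of f "topspace X"] by blast
  let ?P = "pullback_topology (carrier ?A) h S"
  have "continuous_map X ?P frag_of"
  proof (rule continuous_map_pullback')
    show "continuous_map X S (h \<circ> frag_of)"
      using f by (rule continuous_map_eq) (simp add: h)
  qed auto
  then have "continuous_map (free_group_topology X) ?P id"
    using pullback_topological_abelian_group[OF abelian_free_Abelian_group H h(1)]
    by (intro continuous_map_from_free_group_topology)
  moreover have "continuous_map ?P S h"
    using continuous_map_pullback[OF continuous_map_id, of "carrier ?A" h S] by simp
  ultimately have "continuous_map (free_group_topology X) S h"
    using continuous_map_compose by fastforce
  then have c: "continuous_map (free_group_topology X) S (restrict h (carrier ?A))"
    by (rule continuous_map_eq) (simp add: topspace_free_group_topology)
  have r: "restrict h (carrier ?A) \<in> hom ?A H"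
    by (rule restrict_carrier_hom) (simp_all add: h(1))
  show "\<exists>!h. h \<in> extensional (carrier ?A) \<and> h \<in> hom ?A H \<and>
      continuous_map (free_group_topology X) S h \<and> (\<forall>x\<in>topspace X. f x = h (frag_of x))"
  proof (rule ex1I[of _ "restrict h (carrier ?A)"])
    show "restrict h (carrier ?A) \<in> extensional (carrier ?A) \<and> restrict h (carrier ?A) \<in> hom ?A H \<and>
      continuous_map (free_group_topology X) S (restrict h (carrier ?A)) \<and>
      (\<forall>x\<in>topspace X. f x = restrict h (carrier ?A) (frag_of x))"
      using c r h(2) by (simp del: carrier_free_Abelian_group_iff)
  next
    fix k assume k: "k \<in> extensional (carrier ?A) \<and> k \<in> hom ?A H \<and>
      continuous_map (free_group_topology X) S k \<and> (\<forall>x\<in>topspace X. f x = k (frag_of x))"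
    show "k = restrict h (carrier ?A)"
    proof (rule extensionalityI)
      show "k \<in> extensional (carrier ?A)" using k by blast
      fix x assume "x \<in> carrier ?A"
      then show "k x = restrict h (carrier ?A) x"
        using hom_free_Abelian_group_eqI[OF H.is_group, of k "topspace X" h x] k h by simp
    qed simp
  qed
qed

theorem free_topological_abelian_group_exists:
  "free_topological_abelian_group X (free_Abelian_group (topspace X)) (free_group_topology X) frag_of"
  by (simp add: free_topological_abelian_group_def free_group_topology_group frag_of_continuous
      free_group_universal)

lemma universal_for_obtain:
  assumes "universal_for TYPE('c) X G T \<delta>" "topological_abelian_group (H :: 'c monoid) S"
    "continuous_map X S f"
  obtains h where "h \<in> hom G H" "continuous_map T S h" "\<And>x. x \<in> topspace X \<Longrightarrow> h (\<delta> x) = f x"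
  using assms unfolding universal_for_def by metis

lemma universal_for_unique:
  assumes U: "universal_for TYPE('c) X G T \<delta>" and H: "topological_abelian_group (H :: 'c monoid) S"
    and G: "topological_abelian_group G T" "continuous_map X T \<delta>"
    and h: "h \<in> hom G H" "continuous_map T S h" and k: "k \<in> hom G H" "continuous_map T S k"
    and eq: "\<And>x. x \<in> topspace X \<Longrightarrow> h (\<delta> x) = k (\<delta> x)" and z: "z \<in> carrier G"
  shows "h z = k z"
proof -
  interpret G: comm_group G using G by (simp add: topological_abelian_group_def)
  have top: "topspace T = carrier G" using G by (simp add: topological_abelian_group_def)
  have dc: "\<delta> x \<in> carrier G" if "x \<in> topspace X" for x
    using continuous_map_image_subset_topspace[OF G(2)] that top by blast
  have *: "restrict g (carrier G) \<in> extensional (carrier G) \<and> restrict g (carrier G) \<in> hom G H \<and>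
      continuous_map T S (restrict g (carrier G)) \<and>
      (\<forall>x\<in>topspace X. h (\<delta> x) = restrict g (carrier G) (\<delta> x))"
    if g: "g \<in> hom G H" "continuous_map T S g" "\<And>x. x \<in> topspace X \<Longrightarrow> h (\<delta> x) = g (\<delta> x)" for g
  proof (intro conjI ballI)
    show "restrict g (carrier G) \<in> hom G H"
      using g(1) by (rule restrict_carrier_hom) (rule G.is_group)
    show "continuous_map T S (restrict g (carrier G))"
      using g(2) by (rule continuous_map_eq) (simp add: top)
  qed (use g(3) dc in auto)
  have "continuous_map X S (\<lambda>x. h (\<delta> x))"
    using continuous_map_compose[OF G(2) h(2)] by (simp add: o_def)
  then have "\<exists>!g. g \<in> extensional (carrier G) \<and> g \<in> hom G H \<and> continuous_map T S g \<and>
      (\<forall>x\<in>topspace X. h (\<delta> x) = g (\<delta> x))"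
    using U H unfolding universal_for_def by blast
  then have "restrict h (carrier G) = restrict k (carrier G)"
    using *[OF h] *[OF k eq] by blast
  then show ?thesis using z by (metis restrict_apply')
qed

theorem free_topological_abelian_group_universal:
  fixes G :: "'g monoid"
  assumes free: "free_topological_abelian_group X G T \<delta>"
  shows "universal_for TYPE('c) X G T \<delta>"
  unfolding universal_for_def
proof (intro allI impI, elim conjE)
  fix H :: "'c monoid" and S f
  assume H: "topological_abelian_group H S" and f: "continuous_map X S f"
  let ?A = "free_Abelian_group (topspace X)" and ?TA = "free_group_topology X"
  have G: "topological_abelian_group G T" and d: "continuous_map X T \<delta>"
    and U1: "universal_for TYPE('a \<Rightarrow>\<^sub>0 int) X G T \<delta>" and U2: "universal_for TYPE('g) X G T \<delta>"
    using free by (simp_all add: free_topological_abelian_group_def)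
  interpret G: comm_group G using G by (simp add: topological_abelian_group_def)
  interpret H: comm_group H using H by (simp add: topological_abelian_group_def)
  have top: "topspace T = carrier G" using G by (simp add: topological_abelian_group_def)
  have dc: "\<delta> x \<in> carrier G" if "x \<in> topspace X" for x
    using continuous_map_image_subset_topspace[OF d] that top by blast
  obtain \<phi> where \<phi>: "\<phi> \<in> hom G ?A" "continuous_map T ?TA \<phi>"
      "\<And>x. x \<in> topspace X \<Longrightarrow> \<phi> (\<delta> x) = frag_of x"
    using universal_for_obtain[OF U1 free_group_topology_group frag_of_continuous] by blast
  obtain \<psi> where \<psi>: "\<psi> \<in> hom ?A G" "continuous_map ?TA T \<psi>"
      "\<And>x. x \<in> topspace X \<Longrightarrow> \<psi> (frag_of x) = \<delta> x"
    using universal_for_obtain[OF free_group_universal G d] by blast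
  obtain k where k: "k \<in> hom ?A H" "continuous_map ?TA S k"
      "\<And>x. x \<in> topspace X \<Longrightarrow> k (frag_of x) = f x"
    using universal_for_obtain[OF free_group_universal H f] by blast
  have inv: "(\<psi> \<circ> \<phi>) z = id z" if "z \<in> carrier G" for z
  proof (rule universal_for_unique[OF U2 G G d, where h = "\<psi> \<circ> \<phi>" and k = id and z = z])
    show "\<psi> \<circ> \<phi> \<in> hom G G" using \<phi>(1) \<psi>(1) by (rule hom_compose)
    show "continuous_map T T (\<psi> \<circ> \<phi>)" using \<phi>(2) \<psi>(2) by (rule continuous_map_compose)
    show "id \<in> hom G G" by (simp add: hom_def)
  qed (use that \<phi>(3) \<psi>(3) in auto)
  let ?h = "restrict (k \<circ> \<phi>) (carrier G)"
  have kp: "k \<circ> \<phi> \<in> hom G H" using \<phi>(1) k(1) by (rule hom_compose)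
  have "?h \<in> hom G H" using kp by (rule restrict_carrier_hom) (rule G.is_group)
  moreover have "continuous_map T S ?h"
    using continuous_map_compose[OF \<phi>(2) k(2)] by (rule continuous_map_eq) (simp add: top)
  moreover have "f x = ?h (\<delta> x)" if "x \<in> topspace X" for x
    using that dc \<phi>(3) k(3) by simp
  moreover have "g = ?h" if g: "g \<in> extensional (carrier G)" "g \<in> hom G H"
      "\<forall>x\<in>topspace X. f x = g (\<delta> x)" for g
  proof (rule extensionalityI[OF g(1)])
    fix z assume z: "z \<in> carrier G"
    have "\<phi> z \<in> carrier ?A" using \<phi>(1) z by (rule hom_carrier[THEN subsetD, OF _ imageI])
    then have "(g \<circ> \<psi>) (\<phi> z) = k (\<phi> z)"
      using hom_free_Abelian_group_eqI[OF H.is_group hom_compose[OF \<psi>(1) g(2)] k(1)] g(3) \<psi>(3) k(3)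
      by simp
    then show "g z = ?h z" using inv[OF z] z by simp
  qed simp
  ultimately show "\<exists>!h. h \<in> extensional (carrier G) \<and> h \<in> hom G H \<and> continuous_map T S h \<and>
      (\<forall>x\<in>topspace X. f x = h (\<delta> x))"
    by (intro ex1I[of _ ?h]) auto
qed

definition all_equivalent :: "bool list \<Rightarrow> bool" where
  "all_equivalent Ps \<longleftrightarrow> (\<forall>P\<in>set Ps. \<forall>Q\<in>set Ps. P \<longleftrightarrow> Q)"

end

theory Submission
  imports Defs "HOL-Library.Countable_Set_Type"
begin

text \<open>A pointwise bounded equicontinuous sequence of functions on \<open>X\<close> extends to functionals that are
  uniformly bounded on each compact subset of \<open>AG(X)\<close>. Hence the elements of a compact set have bounded
  length and supports in a common compact set, and a family in \<open>AG(X)\<close> is compact-finite as soon as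
  its lengths or its supports escape. Two fans at \<open>0\<close> arise in this way.

  If \<open>s\<^sub>m \<rightarrow> s\<close> is a nontrivial sequence and every neighborhood of \<open>x\<close> contains one of countably many sets
  \<open>p\<close> with noncompact closure, choose a discrete sequence \<open>d\<^sub>p\<^sub>,\<^sub>m\<close> in \<open>p\<close> and distinct integers \<open>n\<^sub>p\<close>: the elements
  \<open>d\<^sub>p\<^sub>,\<^sub>m - x + n\<^sub>p (s\<^sub>m - s)\<close> form a strict fan. Without such fans the relatively compact members of a
  compact-countable \<open>k\<close>-network are again a \<open>k\<close>-network, in which the closure of each member
  meets only countably many others.

  If \<open>x\<^sub>\<alpha>(n) \<rightarrow> x\<^sub>\<alpha>\<close> (\<open>\<alpha> < \<omega>\<^sub>1\<close>) is a compact-finite family of nontrivial sequences and \<open>e\<^sub>\<beta> : \<beta> \<rightarrow> \<omega>\<close> are injections,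
  the elements \<open>2 (x\<^sub>\<alpha>(n) - x\<^sub>\<alpha>) + 3 (x\<^sub>\<beta>(n) - x\<^sub>\<beta>)\<close> with \<open>\<alpha> < \<beta>\<close> and \<open>n = e\<^sub>\<beta>(\<alpha>)\<close> form a fan. Without it, a maximal
  separated family of sequences is countable. The members that meet it, closed off under touching
  closures, form a countable family; by the \<open>k\<^sub>\<real>\<close>-property its union is clopen, cosmic and \<open>k\<^sub>\<omega>\<close>, and the
  complement is discrete.

  Members of a fan may be empty, so a fan with countably many members is also one indexed by \<open>\<omega>\<^sub>1\<close>.

  Conversely, \<open>AG(D \<oplus> K)\<close> is \<open>AG(D) \<times> AG(K)\<close>, and \<open>AG(K)\<close> is \<open>k\<^sub>\<omega>\<close> because the finer topology determined by the
  compact sets of words of bounded length is still a group topology: the square of a \<open>k\<^sub>\<omega>\<close>-space is \<open>k\<^sub>\<omega>\<close>.\<close>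

section \<open>Compact sets and sequences\<close>

text \<open>The obstacle is that the zero neighborhoods of AG(X) are never described. Accumulation
  of a fan at zero rests only on continuity of the group operations, and compact-finiteness only on
  continuous homomorphisms into normed spaces. This explains the integers \<open>n\<^sub>p\<close>:
  bounded supports leave finitely many \<open>m\<close> for each \<open>p\<close>, but perhaps for
  infinitely many \<open>p\<close>. Growing multiples of \<open>s\<^sub>m - s\<close> let bounded
  length dispose of all but finitely many \<open>p\<close>, and as they tend to zero for fixed
  \<open>p\<close>, accumulation at zero survives. Conditions (5) and (6) call for different fans. A
  strict fan needs compact-finite neighborhoods, hence sequences in disjoint open sets; closed
  network members provide these, since the classes of members linked by touching have clopen unions.
  In (6) only the sequences themselves are separated, and the fan is an ordinary one. The
  \<open>k\<^sub>\<real>\<close>-property speaks of functions continuous on compact sets. These sets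
  are second countable, so convergent sequences decide which sets are clopen. The
  \<open>k\<^sub>\<omega>\<close>-property concerns closed sets, so there a separating function must
  be built along an exhaustion.\<close>

lemma regular_t1_space_imp_Hausdorff: "regular_t1_space X \<Longrightarrow> Hausdorff_space X"
  by (simp add: regular_t1_space_def regular_t1_imp_Hausdorff_space)

lemma Tychonoff_imp_regular_t1: "Tychonoff_space X \<Longrightarrow> regular_t1_space X"
  by (simp add: Tychonoff_space_def regular_t1_space_def completely_regular_imp_regular_space)

lemma Tychonoff_imp_Hausdorff: "Tychonoff_space X \<Longrightarrow> Hausdorff_space X"
  by (simp add: Tychonoff_imp_regular_t1 regular_t1_space_imp_Hausdorff)

lemma Tychonoff_separation:
  assumes "Tychonoff_space X" "openin X W" "p \<in> W"
  obtains f where "continuous_map X euclideanreal f" "f p = 1"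
    "\<And>x. x \<in> topspace X \<Longrightarrow> 0 \<le> f x \<and> f x \<le> 1" "\<And>x. x \<in> topspace X - W \<Longrightarrow> f x = 0"
proof -
  have "closedin X (topspace X - W)" "p \<in> topspace X - (topspace X - W)"
    using assms openin_subset by blast+
  then obtain g :: "'a \<Rightarrow> real" where g: "continuous_map X (top_of_set {0..1}) g" "g p = 0" "g ` (topspace X - W) \<subseteq> {1}"
    using assms(1) unfolding Tychonoff_space_def completely_regular_space_def by meson
  have g': "continuous_map X euclideanreal g" "\<And>x. x \<in> topspace X \<Longrightarrow> 0 \<le> g x \<and> g x \<le> 1"
    using g(1) by (auto simp: continuous_map_in_subtopology)
  show thesis
  proof
    show "continuous_map X euclideanreal (\<lambda>x. 1 - g x)"
      using g'(1) by (intro continuous_intros) auto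
  qed (use g g' in auto)
qed

text \<open>Only countably many pairs of network members can be separated by disjoint open sets, and
  one separation per pair suffices: the compact complement of a neighborhood of \<open>x\<close> is
  covered by finitely many of the second sets, and the intersection of the matching first sets is
  the required basic neighborhood.\<close>

lemma compact_network_imp_second_countable:
  assumes "compact_space X" "Hausdorff_space X" "countable \<N>" "network_in X \<N>"
  shows "second_countable X"
proof -
  define P where "P = {(A,B). A \<in> \<N> \<and> B \<in> \<N> \<and> (\<exists>U V. openin X U \<and> openin X V \<and> A \<subseteq> U \<and> B \<subseteq> V \<and> disjnt U V)}"
  have "\<forall>p\<in>P. \<exists>U V. openin X U \<and> openin X V \<and> fst p \<subseteq> U \<and> snd p \<subseteq> V \<and> disjnt U V"
    by (auto simp: P_def)
  then obtain U V where UV: "\<And>p. p \<in> P \<Longrightarrow> openin X (U p) \<and> openin X (V p) \<and> fst p \<subseteq> U p \<and> snd p \<subseteq> V p \<and> disjnt (U p) (V p)"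
    by metis
  have "P \<subseteq> \<N> \<times> \<N>" by (auto simp: P_def)
  then have cP: "countable P" using assms(3) by (meson countable_SIGMA countable_subset)
  define \<B> where "\<B> = (\<lambda>F. topspace X \<inter> \<Inter>(U ` F)) ` {F. finite F \<and> F \<subseteq> P}"
  have "countable \<B>" unfolding \<B>_def using cP by (intro countable_image countable_Collect_finite_subset)
  moreover have "openin X W" if W: "W \<in> \<B>" for W
  proof -
    obtain F where F: "finite F" "F \<subseteq> P" "W = topspace X \<inter> \<Inter>(U ` F)" using W by (auto simp: \<B>_def)
    have "openin X (topspace X \<inter> \<Inter>(U ` F))"
      using F(1,2)
    proof (induction F)
      case (insert p F)
      then have "openin X (U p \<inter> (topspace X \<inter> \<Inter>(U ` F)))" using UV by blast
      then show ?case by (simp add: Int_left_commute)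
    qed simp
    then show ?thesis by (simp add: F)
  qed
  moreover have "\<exists>W\<in>\<B>. x \<in> W \<and> W \<subseteq> O'" if O': "openin X O'" "x \<in> O'" for O' x
  proof -
    have xX: "x \<in> topspace X" using O' openin_subset by blast
    let ?C = "topspace X - O'"
    have cC: "compactin X ?C" using assms(1) O'(1) by (simp add: closedin_compact_space closedin_diff)
    have "\<exists>p\<in>P. x \<in> U p \<and> y \<in> V p" if y: "y \<in> ?C" for y
    proof -
      have "x \<noteq> y" using O' y by blast
      then obtain U0 V0 where 0: "openin X U0" "openin X V0" "x \<in> U0" "y \<in> V0" "disjnt U0 V0"
        using assms(2) xX y unfolding Hausdorff_space_def by (metis DiffD1)
      obtain A where A: "A \<in> \<N>" "x \<in> A" "A \<subseteq> U0" using assms(4) 0 unfolding network_in_def by meson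
      obtain B where B: "B \<in> \<N>" "y \<in> B" "B \<subseteq> V0" using assms(4) 0 unfolding network_in_def by meson
      have "(A,B) \<in> P" unfolding P_def using A B 0 by blast
      with UV[OF this] A B show ?thesis by auto
    qed
    then have "?C \<subseteq> \<Union>(V ` {p\<in>P. x \<in> U p})" by blast
    moreover have "\<And>W. W \<in> V ` {p\<in>P. x \<in> U p} \<Longrightarrow> openin X W" using UV by auto
    ultimately obtain \<F> where \<F>: "finite \<F>" "\<F> \<subseteq> V ` {p\<in>P. x \<in> U p}" "?C \<subseteq> \<Union>\<F>"
      using cC by (meson compactinD)
    then obtain F where F: "finite F" "F \<subseteq> {p\<in>P. x \<in> U p}" "\<F> = V ` F" by (meson finite_subset_image)
    let ?W = "topspace X \<inter> \<Inter>(U ` F)"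
    have "?W \<in> \<B>" using F by (auto simp: \<B>_def)
    moreover have "x \<in> ?W" using F xX by auto
    moreover have "?W \<subseteq> O'"
    proof
      fix z assume z: "z \<in> ?W"
      show "z \<in> O'"
      proof (rule ccontr)
        assume "z \<notin> O'"
        then obtain p where p: "p \<in> F" "z \<in> V p" using z \<F>(3) F(3) by blast
        then have "z \<in> U p" using z by blast
        then show False using p UV[of p] F(2) by (auto simp: disjnt_iff)
      qed
    qed
    ultimately show ?thesis by blast
  qed
  ultimately show ?thesis unfolding second_countable_def by blast
qed

lemma first_countable_closure_of_sequence:
  assumes "first_countable X" "x \<in> X closure_of A"
  obtains s where "range s \<subseteq> A" "limitin X s x sequentially"
proof -
  have xX: "x \<in> topspace X" using assms(2) by (simp add: in_closure_of)
  obtain \<B> where \<B>: "countable \<B>" "\<And>V. V \<in> \<B> \<Longrightarrow> openin X V"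
    "\<And>U. openin X U \<Longrightarrow> x \<in> U \<Longrightarrow> \<exists>V\<in>\<B>. x \<in> V \<and> V \<subseteq> U"
    using assms(1) xX unfolding first_countable_def by meson
  define \<C> where "\<C> = {V\<in>\<B>. x \<in> V}"
  have "countable \<C>" "\<C> \<noteq> {}" using \<B>(1) \<B>(3)[OF openin_topspace xX] by (auto simp: \<C>_def)
  define B where "B n = (\<Inter>i\<le>n. from_nat_into \<C> i)" for n :: nat
  have in\<C>: "from_nat_into \<C> i \<in> \<C>" for i using \<open>\<C> \<noteq> {}\<close> by (rule from_nat_into)
  have "openin X (B n)" for n unfolding B_def using in\<C> \<B>(2) by (intro openin_INT2) (auto simp: \<C>_def)
  moreover have "x \<in> B n" for n unfolding B_def using in\<C> by (auto simp: \<C>_def)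
  ultimately have "\<exists>y. y \<in> A \<and> y \<in> B n" for n using assms(2) by (auto simp: in_closure_of)
  then obtain s where s: "\<And>n. s n \<in> A" "\<And>n. s n \<in> B n" by metis
  have "limitin X s x sequentially" unfolding limitin_sequentially
  proof (intro conjI allI impI)
    fix U assume "openin X U \<and> x \<in> U"
    then obtain V where V: "V \<in> \<C>" "V \<subseteq> U" using \<B>(3) by (auto simp: \<C>_def)
    then obtain i where "V = from_nat_into \<C> i" using \<open>countable \<C>\<close> from_nat_into_surj by metis
    then have "\<forall>n\<ge>i. s n \<in> U" using s(2) V unfolding B_def by blast
    then show "\<exists>N. \<forall>n\<ge>N. s n \<in> U" by blast
  qed (fact xX)
  with s(1) show thesis using that by blast
qed

lemma k_network_inE:
  assumes "k_network_in X \<N>" "openin X U" "compactin X K" "K \<subseteq> U"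
  obtains \<F> where "finite \<F>" "\<F> \<subseteq> \<N>" "K \<subseteq> \<Union>\<F>" "\<Union>\<F> \<subseteq> U"
proof -
  have "openin X U \<and> compactin X K \<and> K \<subseteq> U \<longrightarrow>
      (\<exists>\<F>. finite \<F> \<and> \<F> \<subseteq> \<N> \<and> K \<subseteq> \<Union>\<F> \<and> \<Union>\<F> \<subseteq> U)"
    using assms(1) unfolding k_network_in_def by (elim conjE allE)
  then show thesis using assms(2-4) that by (elim impE exE conjE) (intro conjI, assumption+)
qed

lemma k_network_in_point:
  assumes "k_network_in X \<N>" "openin X U" "y \<in> U"
  obtains N where "N \<in> \<N>" "y \<in> N" "N \<subseteq> U"
proof -
  have "compactin X {y}" using assms(2,3) openin_subset by auto
  moreover have "{y} \<subseteq> U" using assms(3) by simp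
  ultimately obtain \<F> where "finite \<F>" "\<F> \<subseteq> \<N>" "{y} \<subseteq> \<Union>\<F>" "\<Union>\<F> \<subseteq> U"
    by (rule k_network_inE[OF assms(1,2)])
  moreover from this obtain N where "N \<in> \<F>" "y \<in> N" by auto
  ultimately show thesis by (intro that[of N]) auto
qed

text \<open>Only countably many members meet \<open>L\<close>, and their traces form a network of
  \<open>L\<close>; so compact subspaces are metrizable.\<close>

lemma compact_k_network_second_countable:
  assumes X: "Hausdorff_space X" "k_network_in X \<N>" "compact_countable_in X \<N>" and L: "compactin X L"
  shows "second_countable (subtopology X L)"
proof (rule compact_network_imp_second_countable)
  show "compact_space (subtopology X L)" using L by (simp add: compact_space_subtopology)
  show "Hausdorff_space (subtopology X L)" using X by (simp add: Hausdorff_space_subtopology)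
  let ?\<M> = "(\<lambda>N. N \<inter> L) ` {N\<in>\<N>. N \<inter> L \<noteq> {}}"
  show "countable ?\<M>" using X(3) L unfolding compact_countable_in_def by blast
  show "network_in (subtopology X L) ?\<M>" unfolding network_in_def
  proof (intro conjI allI impI)
    show "?\<M> \<subseteq> Pow (topspace (subtopology X L))"
      using X(2) by (auto simp: k_network_in_def)
    fix y U assume "openin (subtopology X L) U \<and> y \<in> U"
    then obtain V where V: "openin X V" "U = V \<inter> L" "y \<in> U" by (auto simp: openin_subtopology)
    then obtain N where "N \<in> \<N>" "y \<in> N" "N \<subseteq> V" using k_network_in_point[OF X(2)] by blast
    then show "\<exists>M\<in>?\<M>. y \<in> M \<and> M \<subseteq> U" using V by (intro bexI[of _ "N \<inter> L"]) auto
  qed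
qed

text \<open>Second countability turns a failure of closedness inside a compact set into a convergent
  sequence. This is the bridge from the compact sets of the \<open>k\<^sub>\<real>\<close>-property
  to the sequences used for the fans.\<close>

lemma not_closedin_compact_sequence:
  assumes X: "Hausdorff_space X" "k_network_in X \<N>" "compact_countable_in X \<N>" and L: "compactin X L"
    and A: "A \<subseteq> L" "\<not> closedin (subtopology X L) A"
  obtains s l where "range s \<subseteq> A" "l \<in> L - A" "limitin X s l sequentially"
proof -
  let ?L = "subtopology X L"
  have "topspace ?L = L" using compactin_subset_topspace[OF L] by auto
  then obtain l where l: "l \<in> ?L closure_of A" "l \<notin> A"
    using A by (metis closure_of_subset_eq subsetI)
  have lL: "l \<in> L" using l(1) \<open>topspace ?L = L\<close> by (metis in_closure_of)
  have "first_countable ?L"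
    by (rule second_countable_imp_first_countable[OF compact_k_network_second_countable[OF X L]])
  then obtain s where "range s \<subseteq> A" "limitin ?L s l sequentially"
    using l(1) first_countable_closure_of_sequence by metis
  then show thesis using that l lL by (auto simp: limitin_subtopology)
qed

section \<open>Increasing compact exhaustions of \<open>k\<^sub>\<omega>\<close>-spaces\<close>

definition k_omega_chain :: "'a topology \<Rightarrow> (nat \<Rightarrow> 'a set) \<Rightarrow> bool" where
  "k_omega_chain Y C \<longleftrightarrow> (\<forall>n. compactin Y (C n)) \<and> incseq C \<and> (\<Union>n. C n) = topspace Y \<and>
     (\<forall>U. U \<subseteq> topspace Y \<and> (\<forall>n. openin (subtopology Y (C n)) (U \<inter> C n)) \<longrightarrow> openin Y U)"

lemma k_omega_chainD:
  assumes "k_omega_chain Y C"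
  shows "compactin Y (C n)" "m \<le> n \<Longrightarrow> C m \<subseteq> C n" "y \<in> topspace Y \<Longrightarrow> \<exists>n. y \<in> C n"
    "C n \<subseteq> topspace Y"
    "\<lbrakk>U \<subseteq> topspace Y; \<And>n. openin (subtopology Y (C n)) (U \<inter> C n)\<rbrakk> \<Longrightarrow> openin Y U"
  using assms unfolding k_omega_chain_def by (auto dest: compactin_subset_topspace monoD)

lemma k_omega_chain_closedI:
  assumes "k_omega_chain Y C" "F \<subseteq> topspace Y" "\<And>n. closedin (subtopology Y (C n)) (F \<inter> C n)"
  shows "closedin Y F"
proof -
  have "openin (subtopology Y (C n)) ((topspace Y - F) \<inter> C n)" for n
  proof -
    have "(topspace Y - F) \<inter> C n = topspace (subtopology Y (C n)) - F \<inter> C n"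
      using k_omega_chainD(4)[OF assms(1)] by auto
    then show ?thesis using assms(3) by (metis openin_diff openin_topspace)
  qed
  then have "openin Y (topspace Y - F)" by (intro k_omega_chainD(5)[OF assms(1)]) auto
  then show ?thesis using assms(2) by (simp add: closedin_def)
qed

text \<open>The chain consists of the finite unions of an enumeration of the cover. Increasing
  stages and a test on open sets make it possible to enlarge compact sets step by step.\<close>

lemma k_omega_space_imp_chain:
  assumes "k_omega_space Y"
  obtains C where "k_omega_chain Y C"
proof -
  obtain \<K> where K: "countable \<K>" "\<And>K. K \<in> \<K> \<Longrightarrow> compactin Y K" "\<Union>\<K> = topspace Y"
    "\<And>F. F \<subseteq> topspace Y \<Longrightarrow> (\<forall>K\<in>\<K>. closedin (subtopology Y K) (F \<inter> K)) \<Longrightarrow> closedin Y F"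
    using assms unfolding k_omega_space_def by metis
  \<comment> \<open>The empty set keeps the family nonempty, so that \<open>from_nat_into\<close>
    enumerates it.\<close>
  define \<K>' where "\<K>' = insert {} \<K>"
  have K': "countable \<K>'" "\<K>' \<noteq> {}" "\<And>K. K \<in> \<K>' \<Longrightarrow> compactin Y K" "\<Union>\<K>' = topspace Y"
    using K by (auto simp: \<K>'_def)
  define C where "C n = (\<Union>i\<le>n. from_nat_into \<K>' i)" for n :: nat
  have sub: "from_nat_into \<K>' i \<in> \<K>'" for i using K'(2) by (rule from_nat_into)
  have "k_omega_chain Y C" unfolding k_omega_chain_def
  proof (intro conjI allI impI)
    show "compactin Y (C n)" for n unfolding C_def using K'(3)[OF sub]
      by (intro compactin_Union) auto
    show "incseq C" unfolding C_def by (rule monoI) (meson UN_mono atMost_subset_iff order_refl)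
    have "(\<Union>n. C n) = (\<Union>i. from_nat_into \<K>' i)" unfolding C_def by auto
    also have "\<dots> = \<Union>\<K>'" using K' by (simp add: range_from_nat_into)
    finally show "(\<Union>n. C n) = topspace Y" using K' by simp
    fix U assume U: "U \<subseteq> topspace Y \<and> (\<forall>n. openin (subtopology Y (C n)) (U \<inter> C n))"
    have "closedin Y (topspace Y - U)"
    proof (rule K(4))
      show "\<forall>K\<in>\<K>. closedin (subtopology Y K) ((topspace Y - U) \<inter> K)"
      proof
        fix K assume "K \<in> \<K>"
        then obtain n where n: "K = from_nat_into \<K>' n" using K'(1) from_nat_into_surj unfolding \<K>'_def by (metis insertCI)
        then have KC: "K \<subseteq> C n" unfolding C_def by auto
        obtain V where V: "openin Y V" "U \<inter> C n = V \<inter> C n" using U by (metis openin_subtopology)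
        then have "U \<inter> K = V \<inter> K" using KC by blast
        then have "openin (subtopology Y K) (U \<inter> K)" using V(1) by (auto simp: openin_subtopology)
        moreover have "(topspace Y - U) \<inter> K = topspace (subtopology Y K) - U \<inter> K"
          by auto
        ultimately show "closedin (subtopology Y K) ((topspace Y - U) \<inter> K)"
          by (metis closedin_diff closedin_topspace)
      qed
    qed auto
    then show "openin Y U" using U by (simp add: closedin_def double_diff)
  qed
  then show thesis using that by blast
qed

lemma k_omega_chain_imp_space:
  assumes "k_omega_chain Y C"
  shows "k_omega_space Y"
  unfolding k_omega_space_def
proof (intro exI[of _ "range C"] conjI allI impI)
  show "\<Union>(range C) = topspace Y" using assms by (simp add: k_omega_chain_def)
  fix F assume F: "F \<subseteq> topspace Y"
  show "closedin Y F = (\<forall>K\<in>range C. closedin (subtopology Y K) (F \<inter> K))"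
    using k_omega_chain_closedI[OF assms F] by (auto simp: closedin_subtopology)
qed (use k_omega_chainD(1)[OF assms] in auto)

text \<open>Otherwise choose \<open>y n\<close> in \<open>L\<close> outside \<open>C n\<close>. Each
  tail of this sequence meets each stage in a finite set and is therefore closed; the complements of
  the tails then form an open cover of \<open>L\<close> without finite subcover.\<close>

lemma k_omega_chain_compact_subset:
  assumes C: "k_omega_chain Y C" and "t1_space Y" and L: "compactin Y L"
  obtains n where "L \<subseteq> C n"
proof (rule ccontr)
  assume "\<not> thesis"
  then have "\<forall>n. \<exists>y. y \<in> L \<and> y \<notin> C n" using that by blast
  then obtain y where y: "\<And>n. y n \<in> L" "\<And>n. y n \<notin> C n" by metis
  have yY: "y n \<in> topspace Y" for n using y(1) compactin_subset_topspace[OF L] by blast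
  have cl: "closedin Y (y ` {n..})" for n
  proof (rule k_omega_chain_closedI[OF C])
    fix m
    have "y ` {n..} \<inter> C m \<subseteq> y ` {..<m}"
    proof
      fix z assume "z \<in> y ` {n..} \<inter> C m"
      then obtain k where "z = y k" "y k \<in> C m" by auto
      moreover have "k < m" using calculation y(2)[of k] k_omega_chainD(2)[OF C, of m k] by (meson not_le subsetD)
      ultimately show "z \<in> y ` {..<m}" by auto
    qed
    then have "finite (y ` {n..} \<inter> C m)" by (meson finite_imageI finite_lessThan finite_subset)
    moreover have "t1_space (subtopology Y (C m))" using assms(2) by (rule t1_space_subtopology)
    ultimately show "closedin (subtopology Y (C m)) (y ` {n..} \<inter> C m)"
      using yY unfolding t1_space_closedin_finite by (auto simp: image_subset_iff)
  qed (use yY in auto)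
  define V where "V n = topspace Y - y ` {n..}" for n
  have "openin Y (V n)" for n using cl by (simp add: V_def openin_diff)
  moreover have "L \<subseteq> \<Union>(range V)"
  proof
    fix x assume "x \<in> L"
    then have xY: "x \<in> topspace Y" using compactin_subset_topspace[OF L] by blast
    then obtain m where m: "x \<in> C m" using k_omega_chainD(3)[OF C] by blast
    have "x \<notin> y ` {m..}" using m y(2) k_omega_chainD(2)[OF C] by (metis atLeast_iff imageE subsetD)
    then show "x \<in> \<Union>(range V)" using xY by (auto simp: V_def)
  qed
  ultimately obtain \<F> where \<F>: "finite \<F>" "\<F> \<subseteq> range V" "L \<subseteq> \<Union>\<F>" using L
    by (metis (no_types, lifting) compactinD rangeE)
  then obtain I where I: "finite I" "\<F> = V ` I" by (meson finite_subset_image)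
  obtain N where N: "\<forall>i\<in>I. i \<le> N" using I(1) by (meson finite_nat_set_iff_bounded_le)
  have "y N \<notin> V i" if "i \<in> I" for i using N that by (auto simp: V_def)
  then show False using y(1)[of N] \<F>(3) I(2) by blast
qed

text \<open>Normality leaves room for an open set and a compact set between \<open>P\<close> and
  \<open>U0\<close>. This room is what allows compact sets to grow inductively.\<close>

lemma compact_Hausdorff_shrink:
  assumes "compact_space Z" "Hausdorff_space Z" "compactin Z P" "openin Z U0" "P \<subseteq> U0"
  obtains U P' where "openin Z U" "P \<subseteq> U" "U \<subseteq> P'" "compactin Z P'" "P' \<subseteq> U0"
proof -
  have "normal_space Z" using assms compact_Hausdorff_or_regular_imp_normal_space by blast
  moreover have "closedin Z P" using assms compactin_imp_closedin by blast
  ultimately obtain U where U: "openin Z U" "P \<subseteq> U" "Z closure_of U \<subseteq> U0"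
    using assms(4,5) unfolding normal_space_alt by metis
  moreover have "compactin Z (Z closure_of U)" by (simp add: assms(1) closedin_compact_space)
  moreover have "U \<subseteq> Z closure_of U" by (simp add: U(1) closure_of_subset openin_subset)
  ultimately show thesis using that by blast
qed

section \<open>Products of \<open>k\<^sub>\<omega>\<close>-spaces and \<open>k\<close>-networks\<close>

text \<open>At a point of \<open>P n\<close> in \<open>C m\<close> the set
  \<open>U (max n m)\<close> is relatively open in a stage containing \<open>C m\<close>, so its
  trace on \<open>C m\<close> is a neighborhood inside the union.\<close>

lemma k_omega_chain_union_open:
  assumes C: "k_omega_chain Y C"
    and U: "\<And>n. openin (subtopology Y (C (n0 + Suc n))) (U n)" "\<And>n. P n \<subseteq> U n" "\<And>n. U n \<subseteq> P (Suc n)"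
  shows "openin Y (\<Union>n. P n)"
proof (rule k_omega_chainD(5)[OF C])
  have inc: "incseq P" using U(2,3) by (intro incseq_SucI) blast
  have UY: "U n \<subseteq> topspace Y" for n using openin_subset[OF U(1)] by auto
  then show "(\<Union>n. P n) \<subseteq> topspace Y" using U(2) by blast
  fix m
  show "openin (subtopology Y (C m)) ((\<Union>n. P n) \<inter> C m)"
  proof (subst openin_subopen, intro ballI)
    fix x assume "x \<in> (\<Union>n. P n) \<inter> C m"
    then obtain n where n: "x \<in> P n" "x \<in> C m" by blast
    let ?n = "max n m"
    have "P n \<subseteq> P ?n" using inc by (meson max.cobounded1 monoD)
    then have xU: "x \<in> U ?n" using n U(2) by blast
    obtain O' where O': "openin Y O'" "U ?n = O' \<inter> C (n0 + Suc ?n)"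
      using U(1)[of ?n] by (metis openin_subtopology)
    have "C m \<subseteq> C (n0 + Suc ?n)" by (rule k_omega_chainD(2)[OF C]) simp
    then have "U ?n \<inter> C m = O' \<inter> C m" using O' by blast
    then have "openin (subtopology Y (C m)) (U ?n \<inter> C m)" using O'(1) by (auto simp: openin_subtopology)
    then show "\<exists>T. openin (subtopology Y (C m)) T \<and> x \<in> T \<and> T \<subseteq> (\<Union>n. P n) \<inter> C m"
      using xU n U(3) by blast
  qed
qed

text \<open>An open rectangle around \<open>(a, b)\<close> is grown from singletons. By Wallace's
  theorem in the next stage, a product of compact sets inside \<open>W\<close> can be thickened to a
  compact rectangle that surrounds it there and still lies in \<open>W\<close>. The unions of the
  two sides are open, although the single steps are open only relative to a stage.\<close>

lemma k_omega_chain_prod_openI: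
  assumes C: "k_omega_chain Y C" and H: "Hausdorff_space Y" and W: "W \<subseteq> topspace Y \<times> topspace Y"
    and open_n: "\<And>n. openin (subtopology (prod_topology Y Y) (C n \<times> C n)) (W \<inter> C n \<times> C n)"
  shows "openin (prod_topology Y Y) W"
  unfolding openin_prod_topology_alt
proof (intro allI impI)
  fix a b assume ab: "(a, b) \<in> W"
  then obtain na nb where "a \<in> C na" "b \<in> C nb" using W k_omega_chainD(3)[OF C] by blast
  then obtain n0 where n0: "a \<in> C n0" "b \<in> C n0"
    using k_omega_chainD(2)[OF C, of na "max na nb"] k_omega_chainD(2)[OF C, of nb "max na nb"] by auto
  \<comment> \<open>\<open>\<Phi>\<close> is the invariant of the induction at stage
    \<open>n0 + n\<close>; \<open>\<Psi>\<close> is the room between consecutive rectangles that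
    later makes the unions open.\<close>
  define \<Phi> where "\<Phi> n PQ \<longleftrightarrow> compactin Y (fst PQ) \<and> compactin Y (snd PQ) \<and> fst PQ \<subseteq> C (n0 + n) \<and>
     snd PQ \<subseteq> C (n0 + n) \<and> fst PQ \<times> snd PQ \<subseteq> W \<and> a \<in> fst PQ \<and> b \<in> snd PQ" for n and PQ :: "'a set \<times> 'a set"
  define \<Psi> where "\<Psi> n PQ PQ' \<longleftrightarrow> (\<exists>U V. openin (subtopology Y (C (n0 + Suc n))) U \<and> openin (subtopology Y (C (n0 + Suc n))) V \<and>
     fst PQ \<subseteq> U \<and> U \<subseteq> fst PQ' \<and> snd PQ \<subseteq> V \<and> V \<subseteq> snd PQ')" for n and PQ PQ' :: "'a set \<times> 'a set"
  have "\<exists>PQ'. \<Phi> (Suc n) PQ' \<and> \<Psi> n PQ PQ'" if \<Phi>: "\<Phi> n PQ" for n PQ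
  proof -
    define Z where "Z = subtopology Y (C (n0 + Suc n))"
    have sub: "C (n0 + n) \<subseteq> C (n0 + Suc n)" by (rule k_omega_chainD(2)[OF C]) simp
    have Z: "compact_space Z" "Hausdorff_space Z"
      unfolding Z_def using k_omega_chainD(1)[OF C] H by (simp_all add: compact_space_subtopology Hausdorff_space_subtopology)
    have tZ: "topspace Z = C (n0 + Suc n)" unfolding Z_def using k_omega_chainD(4)[OF C] by (simp add: Int_absorb1)
    have cP: "compactin Z (fst PQ)" "compactin Z (snd PQ)"
      using \<Phi> sub unfolding \<Phi>_def Z_def by (auto simp: compactin_subtopology)
    have "openin (prod_topology Z Z) (W \<inter> C (n0 + Suc n) \<times> C (n0 + Suc n))"
      using open_n[of "n0 + Suc n"] unfolding Z_def subtopology_Times .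
    moreover have "fst PQ \<times> snd PQ \<subseteq> W \<inter> C (n0 + Suc n) \<times> C (n0 + Suc n)"
      using \<Phi> sub unfolding \<Phi>_def by auto
    ultimately obtain U0 V0 where 0: "openin Z U0" "openin Z V0" "fst PQ \<subseteq> U0" "snd PQ \<subseteq> V0"
      "U0 \<times> V0 \<subseteq> W \<inter> C (n0 + Suc n) \<times> C (n0 + Suc n)"
      by (rule Wallace_theorem_prod_topology[OF cP])
    obtain U P' where U: "openin Z U" "fst PQ \<subseteq> U" "U \<subseteq> P'" "compactin Z P'" "P' \<subseteq> U0"
      using compact_Hausdorff_shrink[OF Z cP(1) 0(1,3)] .
    obtain V Q' where V: "openin Z V" "snd PQ \<subseteq> V" "V \<subseteq> Q'" "compactin Z Q'" "Q' \<subseteq> V0"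
      using compact_Hausdorff_shrink[OF Z cP(2) 0(2,4)] .
    have "\<Phi> (Suc n) (P',Q')" using \<Phi> U V 0(5) unfolding \<Phi>_def Z_def by (auto simp: compactin_subtopology)
    moreover have "\<Psi> n PQ (P',Q')" using U V unfolding \<Psi>_def Z_def by auto
    ultimately show ?thesis by blast
  qed
  moreover have "\<exists>PQ. \<Phi> 0 PQ"
    using n0 ab W unfolding \<Phi>_def by (intro exI[of _ "({a},{b})"]) auto
  ultimately obtain f where f: "\<And>n. \<Phi> n (f n)" "\<And>n. \<Psi> n (f n) (f (Suc n))"
    using dependent_nat_choice[of \<Phi> \<Psi>] by metis
  obtain U V where UV: "\<And>n. openin (subtopology Y (C (n0 + Suc n))) (U n)" "\<And>n. openin (subtopology Y (C (n0 + Suc n))) (V n)"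
     "\<And>n. fst (f n) \<subseteq> U n" "\<And>n. U n \<subseteq> fst (f (Suc n))" "\<And>n. snd (f n) \<subseteq> V n" "\<And>n. V n \<subseteq> snd (f (Suc n))"
    using f(2) unfolding \<Psi>_def by metis
  let ?A = "\<Union>n. fst (f n)" and ?B = "\<Union>n. snd (f n)"
  have "openin Y ?A" using UV(1,3,4) by (rule k_omega_chain_union_open[OF C])
  moreover have "openin Y ?B" using UV(2,5,6) by (rule k_omega_chain_union_open[OF C])
  moreover have "?A \<times> ?B \<subseteq> W"
  \<comment> \<open>Coordinates taken from different stages lie in a common rectangle because both
    sides increase.\<close>
  proof clarify
    fix x y n m assume xy: "x \<in> fst (f n)" "y \<in> snd (f m)"
    have "incseq (\<lambda>n. fst (f n))" "incseq (\<lambda>n. snd (f n))"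
      using UV(3-6) by (meson incseq_SucI subset_trans)+
    then have "x \<in> fst (f (max n m))" "y \<in> snd (f (max n m))"
      using xy by (meson max.cobounded1 max.cobounded2 monoD subsetD)+
    then show "(x, y) \<in> W" using f(1)[of "max n m"] unfolding \<Phi>_def by blast
  qed
  moreover have "a \<in> ?A" "b \<in> ?B" using f(1)[of 0] unfolding \<Phi>_def by auto
  ultimately show "\<exists>U V. openin Y U \<and> openin Y V \<and> a \<in> U \<and> b \<in> V \<and> U \<times> V \<subseteq> W" by blast
qed

section \<open>The \<open>k\<close>-property and closed \<open>k\<close>-networks from compact
  exhaustions\<close>

lemma k_omega_imp_k_space:
  assumes "k_omega_space Y"
  shows "k_space Y"
proof -
  obtain C where C: "k_omega_chain Y C" using k_omega_space_imp_chain[OF assms] .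
  show ?thesis unfolding k_space_def
  proof (intro allI impI iffI)
    fix S K assume "closedin Y S" "compactin Y K"
    then show "closedin (subtopology Y K) (K \<inter> S)" by (simp add: closedin_subtopology_Int_closed)
  next
    fix S assume S: "S \<subseteq> topspace Y" "\<forall>K. compactin Y K \<longrightarrow> closedin (subtopology Y K) (K \<inter> S)"
    have "closedin (subtopology Y (C n)) (S \<inter> C n)" for n
      using S(2) k_omega_chainD(1)[OF C, of n] by (metis Int_commute)
    then show "closedin Y S" by (rule k_omega_chain_closedI[OF C S(1)])
  qed
qed

text \<open>Every compact set lies in a single stage, and each stage is compact with a countable
  base. The closures of the basic sets within the stages are compact, hence closed in
  \<open>K\<close>, and regularity of the stage lets finitely many of them fit between a compact set
  and an open one.\<close>

lemma cosmic_k_omega_closed_k_network: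
  assumes K: "cosmic_space K" "k_omega_space K"
  obtains \<M> where "countable \<M>" "k_network_in K \<M>" "\<And>M. M \<in> \<M> \<Longrightarrow> closedin K M"
proof -
  obtain C where C: "k_omega_chain K C" using k_omega_space_imp_chain[OF K(2)] .
  have H: "Hausdorff_space K" and t1: "t1_space K"
    using K(1) by (auto simp: cosmic_space_def regular_t1_space_def regular_t1_imp_Hausdorff_space)
  obtain \<N> where \<N>: "countable \<N>" "network_in K \<N>" using K(1) by (auto simp: cosmic_space_def)
  define Z where "Z n = subtopology K (C n)" for n
  have Z: "compact_space (Z n)" "Hausdorff_space (Z n)" for n
    unfolding Z_def using k_omega_chainD(1)[OF C] H by (simp_all add: compact_space_subtopology Hausdorff_space_subtopology)
  have tZ: "topspace (Z n) = C n" for n unfolding Z_def using k_omega_chainD(4)[OF C] by (simp add: Int_absorb1)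
  have "second_countable (Z n)" for n
  proof (rule compact_network_imp_second_countable[OF Z])
    show "countable ((\<lambda>N. N \<inter> C n) ` \<N>)" using \<N>(1) by simp
    show "network_in (Z n) ((\<lambda>N. N \<inter> C n) ` \<N>)" unfolding network_in_def
    proof (intro conjI allI impI)
      show "(\<lambda>N. N \<inter> C n) ` \<N> \<subseteq> Pow (topspace (Z n))" by (auto simp: tZ)
      fix y U assume "openin (Z n) U \<and> y \<in> U"
      then obtain V where V: "openin K V" "U = V \<inter> C n" "y \<in> V" "y \<in> C n"
        unfolding Z_def by (auto simp: openin_subtopology)
      then obtain N where "N \<in> \<N>" "y \<in> N" "N \<subseteq> V" using \<N>(2) unfolding network_in_def by meson
      then show "\<exists>M\<in>(\<lambda>N. N \<inter> C n) ` \<N>. y \<in> M \<and> M \<subseteq> U" using V by auto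
    qed
  qed
  then have "\<forall>n. \<exists>\<B>. countable \<B> \<and> (\<forall>V\<in>\<B>. openin (Z n) V) \<and>
     (\<forall>U x. openin (Z n) U \<and> x \<in> U \<longrightarrow> (\<exists>V\<in>\<B>. x \<in> V \<and> V \<subseteq> U))"
    unfolding second_countable_def by blast
  then obtain \<B> where \<B>: "\<And>n. countable (\<B> n)" "\<And>n V. V \<in> \<B> n \<Longrightarrow> openin (Z n) V"
     "\<And>n U x. openin (Z n) U \<Longrightarrow> x \<in> U \<Longrightarrow> \<exists>V\<in>\<B> n. x \<in> V \<and> V \<subseteq> U"
    by metis
  define \<M> where "\<M> = (\<Union>n. (\<lambda>V. Z n closure_of V) ` \<B> n)"
  have "closedin K M" if M: "M \<in> \<M>" for M
  proof -
    obtain n V where "M = Z n closure_of V" using M by (auto simp: \<M>_def)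
    then have "closedin (subtopology K (C n)) M" by (simp add: Z_def)
    then show ?thesis using compactin_imp_closedin[OF H k_omega_chainD(1)[OF C]] closedin_trans_full by blast
  qed
  moreover have "countable \<M>" unfolding \<M>_def using \<B>(1) by auto
  moreover have "k_network_in K \<M>" unfolding k_network_in_def
  proof (intro conjI allI impI)
    show "\<M> \<subseteq> Pow (topspace K)" using calculation(1) closedin_subset by blast
    fix U L assume UL: "openin K U \<and> compactin K L \<and> L \<subseteq> U"
    then obtain n where n: "L \<subseteq> C n" using k_omega_chain_compact_subset[OF C t1] by metis
    have Ln: "compactin (Z n) L" using UL n by (simp add: Z_def compactin_subtopology)
    have "openin (Z n) (U \<inter> C n)" using UL by (auto simp: Z_def openin_subtopology)
    have "\<exists>V\<in>\<B> n. y \<in> V \<and> Z n closure_of V \<subseteq> U \<inter> C n" if y: "y \<in> L" for y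
    proof -
      have "compactin (Z n) {y}" "{y} \<subseteq> U \<inter> C n" using y n UL by (auto simp: tZ)
      then obtain U' P where "openin (Z n) U'" "{y} \<subseteq> U'" "U' \<subseteq> P" "compactin (Z n) P" "P \<subseteq> U \<inter> C n"
        using compact_Hausdorff_shrink[OF Z, of n "{y}" "U \<inter> C n"] \<open>openin (Z n) (U \<inter> C n)\<close> by metis
      moreover then obtain V where "V \<in> \<B> n" "y \<in> V" "V \<subseteq> U'" using \<B>(3)[of n U' y] by auto
      moreover have "Z n closure_of V \<subseteq> P"
        using calculation Z(2) by (meson closure_of_minimal compactin_imp_closedin subset_trans)
      ultimately show ?thesis by blast
    qed
    then obtain V where V: "\<And>y. y \<in> L \<Longrightarrow> V y \<in> \<B> n \<and> y \<in> V y \<and> Z n closure_of (V y) \<subseteq> U \<inter> C n" by metis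
    have "\<And>T. T \<in> V ` L \<Longrightarrow> openin (Z n) T" "L \<subseteq> \<Union>(V ` L)" using V \<B>(2) by auto
    then obtain \<F> where "finite \<F>" "\<F> \<subseteq> V ` L" "L \<subseteq> \<Union>\<F>" using Ln by (meson compactinD)
    then obtain I where I: "finite I" "I \<subseteq> L" "L \<subseteq> \<Union>(V ` I)" by (metis finite_subset_image)
    let ?F = "(\<lambda>y. Z n closure_of (V y)) ` I"
    have "V y \<subseteq> Z n closure_of V y" if "y \<in> I" for y
      using V I(2) that \<B>(2) by (meson closure_of_subset openin_subset subsetD)
    then have "L \<subseteq> \<Union>?F" using I(3) by blast
    moreover have "\<Union>?F \<subseteq> U" "?F \<subseteq> \<M>" using V I(2) by (auto simp: \<M>_def)
    ultimately show "\<exists>\<F>. finite \<F> \<and> \<F> \<subseteq> \<M> \<and> L \<subseteq> \<Union>\<F> \<and> \<Union>\<F> \<subseteq> U" using I(1) by (intro exI[of _ ?F]) simp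
  qed
  ultimately show thesis using that by blast
qed

text \<open>A compact subset of the product projects to a finite subset of \<open>D\<close>. It thus
  has finitely many nonempty slices, each treated by the countable network of
  \<open>K\<close>.\<close>

lemma closed_aleph_k_space_prod_discrete:
  assumes K: "cosmic_space K" "k_omega_space K"
  shows "closed_aleph_k_space (prod_topology (discrete_topology D) K)"
proof -
  let ?Z = "prod_topology (discrete_topology D) K"
  obtain \<M> where \<M>: "countable \<M>" "k_network_in K \<M>" "\<And>M. M \<in> \<M> \<Longrightarrow> closedin K M"
    using cosmic_k_omega_closed_k_network[OF K] by metis
  have "regular_space K" "t1_space K" using K(1) by (auto simp: cosmic_space_def regular_t1_space_def)
  then have "regular_t1_space ?Z"
    by (simp add: regular_t1_space_def regular_space_prod_topology t1_space_prod_topology regular_space_discrete_topology Hausdorff_imp_t1_space)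
  define \<N> where "\<N> = (\<lambda>(d,M). {d} \<times> M) ` (D \<times> \<M>)"
  have closed: "closedin ?Z N" if "N \<in> \<N>" for N
    using that \<M>(3) by (auto simp: \<N>_def closedin_prod_Times_iff)
  have "compact_countable_in ?Z \<N>" unfolding compact_countable_in_def
  proof (intro allI impI)
    fix L assume "compactin ?Z L"
    then have "compactin (discrete_topology D) (fst ` L)" by (meson continuous_map_fst image_compactin)
    then have "finite (fst ` L)" by (simp add: compactin_discrete_topology)
    then have "countable (fst ` L)" by (rule countable_finite)
    then have "countable ((\<lambda>(d,M). {d} \<times> M) ` (fst ` L \<times> \<M>))"
      using \<M>(1) by (intro countable_image[OF countable_SIGMA])
    moreover have "{N\<in>\<N>. N \<inter> L \<noteq> {}} \<subseteq> (\<lambda>(d,M). {d} \<times> M) ` (fst ` L \<times> \<M>)"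
    proof
      fix N assume "N \<in> {N\<in>\<N>. N \<inter> L \<noteq> {}}"
      then obtain d M y where "N = {d} \<times> M" "M \<in> \<M>" "(d,y) \<in> L" by (auto simp: \<N>_def)
      then show "N \<in> (\<lambda>(d,M). {d} \<times> M) ` (fst ` L \<times> \<M>)"
        by (intro image_eqI[of _ _ "(d,M)"]) force+
    qed
    ultimately show "countable {N\<in>\<N>. N \<inter> L \<noteq> {}}" by (rule countable_subset[rotated])
  qed
  moreover have "k_network_in ?Z \<N>" unfolding k_network_in_def
  proof (intro conjI allI impI)
    show "\<N> \<subseteq> Pow (topspace ?Z)" using closed closedin_subset by blast
    fix U L assume UL: "openin ?Z U \<and> compactin ?Z L \<and> L \<subseteq> U"
    then have "compactin (discrete_topology D) (fst ` L)" by (meson continuous_map_fst image_compactin)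
    then have fin: "finite (fst ` L)" "fst ` L \<subseteq> D" by (auto simp: compactin_discrete_topology)
    have "\<exists>\<F>. finite \<F> \<and> \<F> \<subseteq> \<M> \<and> {y. (d,y) \<in> L} \<subseteq> \<Union>\<F> \<and> \<Union>\<F> \<subseteq> {y. (d,y) \<in> U}" if d: "d \<in> D" for d
    proof -
      have "continuous_map K ?Z (Pair d)" using d by (simp add: continuous_map_pairedI)
      then have "openin K {y \<in> topspace K. (d,y) \<in> U}" using UL by (simp add: openin_continuous_map_preimage)
      moreover have "{y \<in> topspace K. (d,y) \<in> U} = {y. (d,y) \<in> U}"
        using UL openin_subset by fastforce
      ultimately have 1: "openin K {y. (d,y) \<in> U}" by simp
      have "closedin ?Z ({d} \<times> topspace K)" using d by (simp add: closedin_prod_Times_iff)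
      then have "compactin ?Z (L \<inter> {d} \<times> topspace K)" using UL by (metis compact_Int_closedin)
      then have "compactin K (snd ` (L \<inter> {d} \<times> topspace K))" by (meson continuous_map_snd image_compactin)
      moreover have "snd ` (L \<inter> {d} \<times> topspace K) = {y. (d,y) \<in> L}"
      proof -
        have "L \<subseteq> D \<times> topspace K" using UL compactin_subset_topspace by fastforce
        then show ?thesis by force
      qed
      ultimately have 2: "compactin K {y. (d,y) \<in> L}" by simp
      have "{y. (d,y) \<in> L} \<subseteq> {y. (d,y) \<in> U}" using UL by blast
      from k_network_inE[OF \<M>(2) 1 2 this] show ?thesis by metis
    qed
    then obtain \<F> where \<F>: "\<And>d. d \<in> D \<Longrightarrow> finite (\<F> d) \<and> \<F> d \<subseteq> \<M> \<and> {y. (d,y) \<in> L} \<subseteq> \<Union>(\<F> d) \<and> \<Union>(\<F> d) \<subseteq> {y. (d,y) \<in> U}"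
      by metis
    let ?G = "\<Union>d\<in>fst ` L. (\<lambda>M. {d} \<times> M) ` \<F> d"
    have "finite ((\<lambda>M. {d} \<times> M) ` \<F> d)" if "d \<in> fst ` L" for d
      using \<F>[OF subsetD[OF fin(2) that]] by simp
    then have "\<forall>d\<in>fst ` L. finite ((\<lambda>M. {d} \<times> M) ` \<F> d)" by blast
    then have "finite ?G" by (simp only: finite_UN[OF fin(1)])
    moreover have G: "\<exists>d M. d \<in> D \<and> M \<in> \<M> \<and> N = {d} \<times> M \<and> M \<subseteq> {y. (d,y) \<in> U}" if N: "N \<in> ?G" for N
    proof -
      obtain d M where "d \<in> fst ` L" "M \<in> \<F> d" "N = {d} \<times> M" using N by blast
      moreover from this have "d \<in> D" using fin(2) by blast
      ultimately show ?thesis using \<F>[of d] by blast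
    qed
    moreover have "?G \<subseteq> \<N>" using G unfolding \<N>_def by (intro subsetI) (smt (verit) SigmaI case_prod_conv image_eqI)
    moreover have "L \<subseteq> \<Union>?G"
    proof (clarify)
      fix d y assume L: "(d,y) \<in> L"
      then have dL: "d \<in> fst ` L" by force
      then have "d \<in> D" using fin(2) by (rule subsetD[rotated])
      then have "y \<in> \<Union>(\<F> d)" using \<F>[of d] L by blast
      then obtain M where "M \<in> \<F> d" "y \<in> M" by blast
      then show "(d,y) \<in> \<Union>?G" using dL by (intro UnionI[of "{d} \<times> M"] UN_I[of d]) auto
    qed
    moreover have "\<Union>?G \<subseteq> U"
    proof
      fix z assume "z \<in> \<Union>?G"
      then obtain N where "N \<in> ?G" "z \<in> N" by blast
      then obtain d M where "N = {d} \<times> M" "M \<subseteq> {y. (d,y) \<in> U}" using G[of N] by blast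
      then show "z \<in> U" using \<open>z \<in> N\<close> by blast
    qed
    ultimately show "\<exists>\<F>. finite \<F> \<and> \<F> \<subseteq> \<N> \<and> L \<subseteq> \<Union>\<F> \<and> \<Union>\<F> \<subseteq> U" by (intro exI[of _ ?G]) simp
  qed
  ultimately show ?thesis using \<open>regular_t1_space ?Z\<close> closed unfolding closed_aleph_k_space_def by blast
qed

text \<open>Preimages of the members work: compactness is carried forward by \<open>f\<close>, and
  an open set of \<open>X\<close> is the preimage of an open set of \<open>Z\<close>. Applied to the
  embedding of \<open>X\<close> into AG(X), this recovers the network condition on \<open>X\<close>
  from (2).\<close>

lemma closed_aleph_k_space_embedding:
  assumes Z: "closed_aleph_k_space Z" and f: "embedding_map X Z f" and X: "regular_t1_space X"
  shows "closed_aleph_k_space X"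
proof -
  obtain \<N> where \<N>: "k_network_in Z \<N>" "compact_countable_in Z \<N>" "\<And>N. N \<in> \<N> \<Longrightarrow> closedin Z N"
    using Z unfolding closed_aleph_k_space_def by blast
  have fc: "continuous_map X Z f" using f by (metis embedding_map_def homeomorphic_imp_continuous_map continuous_map_in_subtopology)
  have hm: "homeomorphic_map X (subtopology Z (f ` topspace X)) f" using f by (simp add: embedding_map_def)
  have inj: "inj_on f (topspace X)" using hm homeomorphic_imp_injective_map by blast
  define pre where "pre N = {x \<in> topspace X. f x \<in> N}" for N
  have "compact_countable_in X (pre ` \<N>)" unfolding compact_countable_in_def
  proof (intro allI impI)
    fix K assume "compactin X K"
    then have "compactin Z (f ` K)" using fc by (rule image_compactin)
    then have "countable {N\<in>\<N>. N \<inter> f ` K \<noteq> {}}" using \<N>(2) unfolding compact_countable_in_def by blast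
    moreover have "{M \<in> pre ` \<N>. M \<inter> K \<noteq> {}} \<subseteq> pre ` {N\<in>\<N>. N \<inter> f ` K \<noteq> {}}" by (auto simp: pre_def)
    ultimately show "countable {M \<in> pre ` \<N>. M \<inter> K \<noteq> {}}" by (meson countable_image countable_subset)
  qed
  moreover have "k_network_in X (pre ` \<N>)" unfolding k_network_in_def
  proof (intro conjI allI impI)
    show "pre ` \<N> \<subseteq> Pow (topspace X)" by (auto simp: pre_def)
    fix U K assume UK: "openin X U \<and> compactin X K \<and> K \<subseteq> U"
    have "openin (subtopology Z (f ` topspace X)) (f ` U)"
      using hm UK by (meson homeomorphic_imp_open_map open_map_def)
    then obtain V where V: "openin Z V" "f ` U = V \<inter> f ` topspace X" by (metis openin_subtopology)
    have "compactin Z (f ` K)" using fc UK image_compactin by blast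
    moreover have "f ` K \<subseteq> V" using V UK by blast
    ultimately obtain \<F> where \<F>: "finite \<F>" "\<F> \<subseteq> \<N>" "f ` K \<subseteq> \<Union>\<F>" "\<Union>\<F> \<subseteq> V"
      by (rule k_network_inE[OF \<N>(1) V(1)])
    have KX: "K \<subseteq> topspace X" and UX: "U \<subseteq> topspace X" using UK openin_subset by blast+
    have "x \<in> U" if x: "x \<in> topspace X" "f x \<in> V" for x
    proof -
      have "f x \<in> f ` U" using V(2) x by blast
      then show ?thesis using inj x(1) UX by (metis (no_types, lifting) image_iff inj_onD subsetD)
    qed
    then have "\<Union>(pre ` \<F>) \<subseteq> U" using \<F>(4) by (auto simp: pre_def)
    moreover have "K \<subseteq> \<Union>(pre ` \<F>)" using \<F>(3) KX by (fastforce simp: pre_def)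
    ultimately show "\<exists>\<F>. finite \<F> \<and> \<F> \<subseteq> pre ` \<N> \<and> K \<subseteq> \<Union>\<F> \<and> \<Union>\<F> \<subseteq> U"
      using \<F>(1,2) by (intro exI[of _ "pre ` \<F>"]) auto
  qed
  moreover have "closedin X M" if "M \<in> pre ` \<N>" for M
    using that \<N>(3) fc by (auto simp: pre_def intro: closedin_continuous_map_preimage)
  ultimately show ?thesis using X unfolding closed_aleph_k_space_def by blast
qed

lemma closed_aleph_k_imp_aleph_k: "closed_aleph_k_space X \<Longrightarrow> aleph_k_space X"
  by (auto simp: closed_aleph_k_space_def aleph_k_space_def)

section \<open>Fans\<close>

text \<open>In the compact Hausdorff space \<open>L\<close> a point has a compact neighborhood
  \<open>P\<close> that \<open>f\<close> maps into \<open>W\<close>; the functions mapping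
  \<open>P\<close> into \<open>W\<close> form a subbasic neighborhood of \<open>f\<close>.\<close>

lemma evaluation_continuous_on_compact:
  assumes "Hausdorff_space Y" and L: "compactin Y L"
  shows "continuous_map (prod_topology (subtopology (Ck_topology Y) \<K>) (subtopology Y L)) euclideanreal (\<lambda>(f, y). f y)"
proof -
  let ?Z = "subtopology (Ck_topology Y) \<K>" and ?L = "subtopology Y L"
  have L': "compact_space ?L" "Hausdorff_space ?L" using assms by (simp_all add: compact_space_subtopology Hausdorff_space_subtopology)
  have tL: "topspace ?L = L" using compactin_subset_topspace[OF L] by auto
  have tZ: "topspace ?Z = continuous_real_functions Y \<inter> \<K>" by (simp add: topspace_Ck_topology)
  show ?thesis unfolding continuous_map_def
  proof (intro conjI allI impI)
    fix W :: "real set" assume W: "openin euclideanreal W"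
    show "openin (prod_topology ?Z ?L) {p \<in> topspace (prod_topology ?Z ?L). (case p of (f, y) \<Rightarrow> f y) \<in> W}"
      unfolding openin_prod_topology_alt
    proof (intro allI impI)
      fix f y assume "(f, y) \<in> {p \<in> topspace (prod_topology ?Z ?L). (case p of (f, y) \<Rightarrow> f y) \<in> W}"
      then have f: "f \<in> continuous_real_functions Y" "f \<in> \<K>" and y: "y \<in> L" "f y \<in> W" using tL tZ by auto
      have "continuous_map ?L euclideanreal f"
        using f(1) by (simp add: continuous_real_functions_def continuous_map_from_subtopology)
      then have "openin ?L {z \<in> topspace ?L. f z \<in> W}" using W by (rule openin_continuous_map_preimage)
      then obtain U P where U: "openin ?L U" "{y} \<subseteq> U" "U \<subseteq> P" "compactin ?L P" "P \<subseteq> {z \<in> topspace ?L. f z \<in> W}"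
        using compact_Hausdorff_shrink[OF L', of "{y}"] y tL by (metis (no_types, lifting) compactin_sing empty_subsetI insert_subset mem_Collect_eq)
      let ?N = "{h \<in> continuous_real_functions Y. h ` P \<subseteq> W}"
      have "compactin Y P" using U(4) by (simp add: compactin_subtopology)
      then have "openin (Ck_topology Y) ?N" unfolding Ck_topology_def
        using W by (intro topology_generated_by_Basis) auto
      then have "openin ?Z (?N \<inter> \<K>)" by (auto simp: openin_subtopology)
      moreover have "f \<in> ?N \<inter> \<K>" using f U(5) by auto
      moreover have "(?N \<inter> \<K>) \<times> U \<subseteq> {p \<in> topspace (prod_topology ?Z ?L). (case p of (f, y) \<Rightarrow> f y) \<in> W}"
        using U(3,5) tL by (auto simp: topspace_Ck_topology image_subset_iff subset_iff)
      ultimately show "\<exists>U V. openin ?Z U \<and> openin ?L V \<and> f \<in> U \<and> y \<in> V \<and>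
          U \<times> V \<subseteq> {p \<in> topspace (prod_topology ?Z ?L). (case p of (f, y) \<Rightarrow> f y) \<in> W}"
        using U(1,2) by blast
    qed
  qed auto
qed

lemma evaluation_at_point_continuous:
  assumes "y \<in> topspace Y"
  shows "continuous_map (Ck_topology Y) euclideanreal (\<lambda>f. f y)"
  unfolding continuous_map_def
proof (intro conjI allI impI)
  fix W :: "real set" assume W: "openin euclideanreal W"
  have "openin (Ck_topology Y) {f \<in> continuous_real_functions Y. f ` {y} \<subseteq> W}" unfolding Ck_topology_def
    using W assms by (intro topology_generated_by_Basis CollectI exI[of _ "{y}"] exI[of _ W] conjI) auto
  then show "openin (Ck_topology Y) {f \<in> topspace (Ck_topology Y). f y \<in> W}"
    by (simp add: topspace_Ck_topology)
qed auto

lemma closedin_projection: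
  assumes "compact_space Z" "closedin (prod_topology Z L) S"
  shows "closedin L {y. \<exists>z. (z, y) \<in> S}"
proof -
  have "closedin L (snd ` S)" using closed_map_snd[OF assms(1)] assms(2) unfolding closed_map_def by blast
  moreover have "snd ` S = {y. \<exists>z. (z, y) \<in> S}" by force
  ultimately show ?thesis by simp
qed

text \<open>It suffices that a compact set of functions is equicontinuous. The points where all its
  members deviate by less than \<open>e/2\<close> from their value at \<open>y0\<close> form an open
  set, since this can be tested on compact sets, where evaluation is jointly continuous.\<close>

lemma k_space_imp_Ascoli:
  assumes Y: "Tychonoff_space Y" "k_space Y"
  shows "Ascoli_space Y"
  unfolding Ascoli_space_def
proof (intro conjI allI impI)
  fix \<K> assume \<K>: "compactin (Ck_topology Y) \<K>"
  let ?Z = "subtopology (Ck_topology Y) \<K>"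
  have cZ: "compact_space ?Z" using \<K> by (simp add: compact_space_subtopology)
  have evc: "continuous_map ?Z euclideanreal (\<lambda>f. f y)" if "y \<in> topspace Y" for y
    using evaluation_at_point_continuous[OF that] by (simp add: continuous_map_from_subtopology)
  show "continuous_map (prod_topology ?Z Y) euclideanreal (\<lambda>(f, y). f y)"
    unfolding continuous_map_def
  proof (intro conjI allI impI)
    fix W :: "real set" assume W: "openin euclideanreal W"
    show "openin (prod_topology ?Z Y) {p \<in> topspace (prod_topology ?Z Y). (case p of (f, y) \<Rightarrow> f y) \<in> W}"
      unfolding openin_prod_topology_alt
    proof (intro allI impI)
      fix f0 y0 assume "(f0, y0) \<in> {p \<in> topspace (prod_topology ?Z Y). (case p of (f, y) \<Rightarrow> f y) \<in> W}"
      then have f0: "f0 \<in> topspace ?Z" and y0: "y0 \<in> topspace Y" "f0 y0 \<in> W" by auto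
      obtain e where e: "e > 0" "\<And>t. \<bar>t - f0 y0\<bar> < e \<Longrightarrow> t \<in> W"
        using W y0(2) unfolding open_openin[symmetric] open_real by blast
      define V where "V = {y \<in> topspace Y. \<forall>f\<in>topspace ?Z. \<bar>f y - f y0\<bar> < e/2}"
      have "openin Y V"
      proof (rule k_space_open[THEN iffD1, rule_format, OF Y(2)], intro conjI allI impI)
        show "V \<subseteq> topspace Y" by (auto simp: V_def)
        fix L assume L: "compactin Y L"
        let ?L = "subtopology Y L" and ?P = "prod_topology ?Z (subtopology Y L)"
        have tL: "topspace ?L = L" using compactin_subset_topspace[OF L] by auto
        have "continuous_map ?P euclideanreal (\<lambda>p. \<bar>(case p of (f, y) \<Rightarrow> f y) - fst p y0\<bar>)"
        proof (intro continuous_map_real_abs continuous_map_diff)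
          show "continuous_map ?P euclideanreal (\<lambda>p. case p of (f, y) \<Rightarrow> f y)"
            using evaluation_continuous_on_compact[OF Tychonoff_imp_Hausdorff[OF Y(1)] L] .
          show "continuous_map ?P euclideanreal (\<lambda>p. fst p y0)"
            using continuous_map_compose[OF continuous_map_fst evc[OF y0(1)]] by (simp add: o_def)
        qed
        then have "closedin ?P {p \<in> topspace ?P. \<bar>(case p of (f, y) \<Rightarrow> f y) - fst p y0\<bar> \<in> {e/2..}}"
          by (rule closedin_continuous_map_preimage) simp
        \<comment> \<open>Projection along the compact set of functions is closed, so the points at
          which some function violates the bound form a closed subset of \<open>L\<close>.\<close>
        then have "closedin ?L {y. \<exists>f. (f, y) \<in> {p \<in> topspace ?P. \<bar>(case p of (f, y) \<Rightarrow> f y) - fst p y0\<bar> \<in> {e/2..}}}"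
          by (rule closedin_projection[OF cZ])
        moreover have "{y. \<exists>f. (f, y) \<in> {p \<in> topspace ?P. \<bar>(case p of (f, y) \<Rightarrow> f y) - fst p y0\<bar> \<in> {e/2..}}} =
            {y \<in> L. \<exists>f\<in>topspace ?Z. e/2 \<le> \<bar>f y - f y0\<bar>}"
          unfolding topspace_prod_topology tL by auto
        moreover have "L \<inter> V = topspace ?L - {y \<in> L. \<exists>f\<in>topspace ?Z. e/2 \<le> \<bar>f y - f y0\<bar>}"
          using compactin_subset_topspace[OF L] unfolding tL V_def by (simp only: not_le[symmetric]) blast
        ultimately show "openin ?L (L \<inter> V)" by (simp only: openin_diff[OF openin_topspace])
      qed
      moreover have "openin ?Z {f \<in> topspace ?Z. f y0 \<in> {t. \<bar>t - f0 y0\<bar> < e/2}}"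
      proof (rule openin_continuous_map_preimage[OF evc[OF y0(1)]])
        show "openin euclideanreal {t. \<bar>t - f0 y0\<bar> < e/2}"
          by (simp add: open_Collect_less continuous_intros)
      qed
      moreover have "{f \<in> topspace ?Z. f y0 \<in> {t. \<bar>t - f0 y0\<bar> < e/2}} \<times> V \<subseteq>
          {p \<in> topspace (prod_topology ?Z Y). (case p of (f, y) \<Rightarrow> f y) \<in> W}"
      proof (intro subrelI)
        fix f y assume "(f, y) \<in> {f \<in> topspace ?Z. f y0 \<in> {t. \<bar>t - f0 y0\<bar> < e/2}} \<times> V"
        then have f: "f \<in> topspace ?Z" "\<bar>f y0 - f0 y0\<bar> < e/2" and "y \<in> topspace Y" "\<bar>f y - f y0\<bar> < e/2"
          by (auto simp: V_def)
        then have "\<bar>f y - f0 y0\<bar> < e" by linarith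
        then show "(f, y) \<in> {p \<in> topspace (prod_topology ?Z Y). (case p of (f, y) \<Rightarrow> f y) \<in> W}"
          using e(2) \<open>y \<in> topspace Y\<close> f(1) by simp
      qed
      moreover have "f0 \<in> {f \<in> topspace ?Z. f y0 \<in> {t. \<bar>t - f0 y0\<bar> < e/2}}" "y0 \<in> V"
        using f0 y0 e(1) by (auto simp: V_def)
      ultimately show "\<exists>U V. openin ?Z U \<and> openin Y V \<and> f0 \<in> U \<and> y0 \<in> V \<and>
          U \<times> V \<subseteq> {p \<in> topspace (prod_topology ?Z Y). (case p of (f, y) \<Rightarrow> f y) \<in> W}"
        by blast
    qed
  qed auto
qed (fact Y(1))

text \<open>Let local finiteness fail at \<open>y\<close>. The union \<open>A\<close> of the members
  missing \<open>y\<close> meets every compact set in a finite set, so it is closed. The complement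
  of \<open>A\<close> is a neighborhood of \<open>y\<close> that meets only members containing
  \<open>y\<close>, and compactness of \<open>{y}\<close> leaves finitely many of those.\<close>

lemma k_space_no_Fin_fan:
  assumes Y: "k_space Y" "t1_space Y"
  shows "\<not> Fin_fan Y I F"
proof
  assume fan: "Fin_fan Y I F"
  then have F: "\<And>\<alpha>. \<alpha> \<in> I \<Longrightarrow> finite (F \<alpha>) \<and> F \<alpha> \<subseteq> topspace Y"
    and cf: "\<And>K. compactin Y K \<Longrightarrow> finite {\<alpha>\<in>I. F \<alpha> \<inter> K \<noteq> {}}"
    by (auto simp: Fin_fan_def compact_finite_family_def)
  obtain y where y: "y \<in> topspace Y" "\<And>U. openin Y U \<Longrightarrow> y \<in> U \<Longrightarrow> infinite {\<alpha>\<in>I. F \<alpha> \<inter> U \<noteq> {}}"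
    using fan by (auto simp: Fin_fan_def locally_finite_family_def)
  define A where "A = \<Union>(F ` {\<alpha>\<in>I. y \<notin> F \<alpha>})"
  have "closedin Y A"
  proof -
    have AY: "A \<subseteq> topspace Y" using F by (auto simp: A_def)
    have "closedin (subtopology Y K) (K \<inter> A)" if K: "compactin Y K" for K
    proof -
      have "K \<inter> A \<subseteq> \<Union>(F ` {\<alpha>\<in>I. F \<alpha> \<inter> K \<noteq> {}})" by (auto simp: A_def)
      moreover have "finite (\<Union>(F ` {\<alpha>\<in>I. F \<alpha> \<inter> K \<noteq> {}}))" using cf[OF K] F by auto
      ultimately have "finite (K \<inter> A)" by (rule finite_subset)
      moreover have "t1_space (subtopology Y K)" using Y(2) by (rule t1_space_subtopology)
      ultimately show ?thesis using AY unfolding t1_space_closedin_finite by auto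
    qed
    then show "closedin Y A" using Y(1) AY unfolding k_space_def by blast
  qed
  then have "openin Y (topspace Y - A)" by blast
  moreover have "y \<in> topspace Y - A" using y(1) by (auto simp: A_def)
  ultimately have "infinite {\<alpha>\<in>I. F \<alpha> \<inter> (topspace Y - A) \<noteq> {}}" by (rule y(2))
  moreover have "{\<alpha>\<in>I. F \<alpha> \<inter> (topspace Y - A) \<noteq> {}} \<subseteq> {\<alpha>\<in>I. F \<alpha> \<inter> {y} \<noteq> {}}" by (auto simp: A_def)
  ultimately show False using cf[of "{y}"] y(1) finite_subset by auto
qed

text \<open>Functions that are 1 on \<open>F \<alpha>\<close> and 0 off \<open>U \<alpha>\<close>
  converge to zero in the compact-open topology, because a compact set meets only finitely many
  \<open>U \<alpha>\<close>; with zero they form a compact set. Continuity of evaluation at zero and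
  a point \<open>y\<close> then yields a neighborhood of \<open>y\<close> missed by almost all
  \<open>F \<alpha>\<close>.\<close>

lemma Ascoli_no_strict_Fin_fan:
  assumes Y: "Ascoli_space Y"
  shows "\<not> strict_Fin_fan Y I F"
proof
  assume fan: "strict_Fin_fan Y I F"
  then obtain U where U: "\<And>\<alpha>. \<alpha> \<in> I \<Longrightarrow> functional_neighborhood Y (F \<alpha>) (U \<alpha>)"
    "\<And>K. compactin Y K \<Longrightarrow> finite {\<alpha>\<in>I. U \<alpha> \<inter> K \<noteq> {}}"
    by (auto simp: strict_Fin_fan_def compact_finite_family_def)
  obtain y where y: "y \<in> topspace Y" "\<And>U. openin Y U \<Longrightarrow> y \<in> U \<Longrightarrow> infinite {\<alpha>\<in>I. F \<alpha> \<inter> U \<noteq> {}}"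
    using fan by (auto simp: strict_Fin_fan_def Fin_fan_def locally_finite_family_def)
  have "\<exists>f. f \<in> continuous_real_functions Y \<and> (\<forall>y\<in>F \<alpha>. f y = 1) \<and> (\<forall>y\<in>topspace Y - U \<alpha>. f y = 0)" if \<alpha>: "\<alpha> \<in> I" for \<alpha>
  proof -
    obtain f where f: "continuous_map Y (top_of_set {0..1::real}) f" "f ` F \<alpha> \<subseteq> {0}" "f ` (topspace Y - U \<alpha>) \<subseteq> {1}"
      and FU: "F \<alpha> \<subseteq> topspace Y"
      using U(1)[OF \<alpha>] by (auto simp: functional_neighborhood_def)
    have "continuous_map Y euclideanreal f" using f(1) by (simp add: continuous_map_in_subtopology)
    then have c: "continuous_map Y euclideanreal (\<lambda>x. 1 - f x)" by (intro continuous_intros) auto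
    show ?thesis
    proof (intro exI[of _ "restrict (\<lambda>x. 1 - f x) (topspace Y)"] conjI ballI)
      show "restrict (\<lambda>x. 1 - f x) (topspace Y) \<in> continuous_real_functions Y"
        using continuous_map_eq[OF c] by (simp add: continuous_real_functions_def)
    qed (use f FU in auto)
  qed
  then obtain f where f: "\<And>\<alpha>. \<alpha> \<in> I \<Longrightarrow> f \<alpha> \<in> continuous_real_functions Y"
     "\<And>\<alpha> y. \<alpha> \<in> I \<Longrightarrow> y \<in> F \<alpha> \<Longrightarrow> f \<alpha> y = 1" "\<And>\<alpha> y. \<alpha> \<in> I \<Longrightarrow> y \<in> topspace Y - U \<alpha> \<Longrightarrow> f \<alpha> y = 0"
    by metis
  define z where "z = restrict (\<lambda>_. 0 :: real) (topspace Y)"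
  have z: "z \<in> continuous_real_functions Y"
    using continuous_map_eq[of Y euclideanreal "\<lambda>_. 0 :: real" z] by (simp add: continuous_real_functions_def z_def)
  define \<K> where "\<K> = insert z (f ` I)"
  have near: "finite {\<alpha>\<in>I. f \<alpha> \<notin> O'}" if O': "openin (Ck_topology Y) O'" "z \<in> O'" for O'
  proof -
    \<comment> \<open>Convergence to zero is a property of subbasic sets that passes to finite
      intersections and to unions, so induction over the generation of \<open>O'\<close> proves
      it.\<close>
    have "generate_topology_on {{f \<in> continuous_real_functions Y. f ` K \<subseteq> U} | K U. compactin Y K \<and> open U} O'"
      using O'(1) unfolding Ck_topology_def openin_topology_generated_by_iff .
    then show ?thesis using O'(2)
    proof induction
      case (Int a b)
      then have "finite ({\<alpha>\<in>I. f \<alpha> \<notin> a} \<union> {\<alpha>\<in>I. f \<alpha> \<notin> b})" by blast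
      moreover have "{\<alpha>\<in>I. f \<alpha> \<notin> a \<inter> b} = {\<alpha>\<in>I. f \<alpha> \<notin> a} \<union> {\<alpha>\<in>I. f \<alpha> \<notin> b}" by blast
      ultimately show ?case by simp
    next
      case (UN K)
      then obtain k where "k \<in> K" "z \<in> k" by blast
      then have "finite {\<alpha>\<in>I. f \<alpha> \<notin> k}" using UN by blast
      then show ?case by (rule finite_subset[rotated]) (use \<open>k \<in> K\<close> in blast)
    next
      case (Basis s)
      then obtain K V where s: "s = {f \<in> continuous_real_functions Y. f ` K \<subseteq> V}" "compactin Y K" "open V" by blast
      have KY: "K \<subseteq> topspace Y" using s(2) compactin_subset_topspace by blast
      have "f \<alpha> \<in> s" if "\<alpha> \<in> I" "U \<alpha> \<inter> K = {}" for \<alpha>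
      proof -
        have "f \<alpha> x = z x" if "x \<in> K" for x using f(3)[OF \<open>\<alpha> \<in> I\<close>, of x] that KY \<open>U \<alpha> \<inter> K = {}\<close> by (auto simp: z_def)
        then show ?thesis using Basis.prems f(1)[OF \<open>\<alpha> \<in> I\<close>] s(1) by (auto simp: image_subset_iff)
      qed
      then have "{\<alpha>\<in>I. f \<alpha> \<notin> s} \<subseteq> {\<alpha>\<in>I. U \<alpha> \<inter> K \<noteq> {}}" by blast
      then show ?case using U(2)[OF s(2)] finite_subset by blast
    qed simp
  qed
  have "compactin (Ck_topology Y) \<K>" unfolding compactin_def
  proof (intro conjI allI impI)
    show "\<K> \<subseteq> topspace (Ck_topology Y)" using z f(1) by (auto simp: \<K>_def topspace_Ck_topology)
    fix \<U> assume \<U>: "Ball \<U> (openin (Ck_topology Y)) \<and> \<K> \<subseteq> \<Union>\<U>"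
    then obtain O' where O': "O' \<in> \<U>" "z \<in> O'" by (auto simp: \<K>_def)
    let ?J = "{\<alpha>\<in>I. f \<alpha> \<notin> O'}"
    have "\<forall>\<alpha>\<in>?J. \<exists>V\<in>\<U>. f \<alpha> \<in> V" using \<U> by (auto simp: \<K>_def)
    then obtain V where V: "\<And>\<alpha>. \<alpha> \<in> ?J \<Longrightarrow> V \<alpha> \<in> \<U> \<and> f \<alpha> \<in> V \<alpha>" by metis
    have "finite (insert O' (V ` ?J))" using near O' \<U> by blast
    moreover have "insert O' (V ` ?J) \<subseteq> \<U>" using O' V by blast
    moreover have "\<K> \<subseteq> \<Union>(insert O' (V ` ?J))" using O' V by (auto simp: \<K>_def)
    ultimately show "\<exists>\<F>. finite \<F> \<and> \<F> \<subseteq> \<U> \<and> \<K> \<subseteq> \<Union>\<F>" by blast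
  qed
  let ?P = "prod_topology (subtopology (Ck_topology Y) \<K>) Y"
  have "continuous_map ?P euclideanreal (\<lambda>(f, y). f y)"
    using Y \<open>compactin _ \<K>\<close> unfolding Ascoli_space_def by blast
  \<comment> \<open>The threshold 1 separates the value 0 at \<open>(z, y)\<close> from the value 1
    of \<open>f \<alpha>\<close> on \<open>F \<alpha>\<close>.\<close>
  then have "openin ?P {p \<in> topspace ?P. (case p of (f, y) \<Rightarrow> f y) \<in> {..<1}}" (is "openin _ ?S")
    by (rule openin_continuous_map_preimage) simp
  then have "\<forall>z y. (z, y) \<in> ?S \<longrightarrow> (\<exists>A V. openin (subtopology (Ck_topology Y) \<K>) A \<and> openin Y V \<and>
      z \<in> A \<and> y \<in> V \<and> A \<times> V \<subseteq> ?S)"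
    by (rule openin_prod_topology_alt[THEN iffD1])
  moreover have "(z, y) \<in> ?S"
    using z y(1) by (auto simp: \<K>_def topspace_Ck_topology z_def)
  ultimately have "\<exists>A V. openin (subtopology (Ck_topology Y) \<K>) A \<and> openin Y V \<and>
      z \<in> A \<and> y \<in> V \<and> A \<times> V \<subseteq> ?S" by (elim allE impE)
  then obtain A V where AV: "openin (subtopology (Ck_topology Y) \<K>) A" "openin Y V" "z \<in> A" "y \<in> V" "A \<times> V \<subseteq> ?S"
    by (elim exE conjE)
  obtain O' where O': "openin (Ck_topology Y) O'" "A = O' \<inter> \<K>" using AV(1) by (auto simp: openin_subtopology)
  have "{\<alpha>\<in>I. F \<alpha> \<inter> V \<noteq> {}} \<subseteq> {\<alpha>\<in>I. f \<alpha> \<notin> O'}"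
  proof clarify
    fix \<alpha> assume \<alpha>: "\<alpha> \<in> I" "F \<alpha> \<inter> V \<noteq> {}" "f \<alpha> \<in> O'"
    then obtain x where "x \<in> F \<alpha>" "x \<in> V" by blast
    then have "(f \<alpha>, x) \<in> A \<times> V" using \<alpha> O' by (auto simp: \<K>_def)
    then have "f \<alpha> x < 1" using AV(5) by auto
    then show False using f(2)[OF \<alpha>(1) \<open>x \<in> F \<alpha>\<close>] by simp
  qed
  then show False using near[OF O'(1)] O'(2) AV(3) y(2)[OF AV(2,4)] finite_subset by blast
qed

section \<open>Reindexing of fans and transport along homeomorphisms\<close>

lemma functional_neighborhood_empty: "functional_neighborhood Y {} {}"
  unfolding functional_neighborhood_def
  by (intro conjI exI[of _ "\<lambda>_. 1"]) auto

text \<open>Indices outside the image carry the empty set and never count, so the finiteness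
  conditions for compact sets and for neighborhoods transfer together.\<close>

lemma reindexed_family:
  assumes "inj_on j J" "j ` J \<subseteq> I"
  shows "{i\<in>I. (if i \<in> j ` J then F (inv_into J j i) else {}) \<inter> U \<noteq> {}} = j ` {\<alpha>\<in>J. F \<alpha> \<inter> U \<noteq> {}}"
    (is "?L = ?R")
proof (intro subset_antisym subsetI)
  fix i assume "i \<in> ?L"
  then obtain \<alpha> where "\<alpha> \<in> J" "i = j \<alpha>" by (auto split: if_splits)
  then show "i \<in> ?R" using \<open>i \<in> ?L\<close> assms by (auto simp: inv_into_f_f)
next
  fix i assume "i \<in> ?R"
  then obtain \<alpha> where "\<alpha> \<in> J" "i = j \<alpha>" "F \<alpha> \<inter> U \<noteq> {}" by blast
  then show "i \<in> ?L" using assms by (auto simp: inv_into_f_f)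
qed

lemma Fin_fan_reindex:
  assumes F: "Fin_fan Y J F" and j: "inj_on j J" "j ` J \<subseteq> I"
  shows "Fin_fan Y I (\<lambda>i. if i \<in> j ` J then F (inv_into J j i) else {})"
proof -
  have "inj_on j A" if "A \<subseteq> J" for A using j(1) that by (rule inj_on_subset)
  then have "finite (j ` {\<alpha>\<in>J. F \<alpha> \<inter> U \<noteq> {}}) \<longleftrightarrow> finite {\<alpha>\<in>J. F \<alpha> \<inter> U \<noteq> {}}" for U
    by (simp add: finite_image_iff)
  then show ?thesis using F j(1)
    unfolding Fin_fan_def compact_finite_family_def locally_finite_family_def reindexed_family[OF j]
    by (auto simp: inv_into_f_f)
qed

lemma strict_Fin_fan_reindex:
  assumes F: "strict_Fin_fan Y J F" and j: "inj_on j J" "j ` J \<subseteq> I"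
  shows "strict_Fin_fan Y I (\<lambda>i. if i \<in> j ` J then F (inv_into J j i) else {})"
proof -
  obtain U where U: "\<forall>\<alpha>\<in>J. functional_neighborhood Y (F \<alpha>) (U \<alpha>)" "compact_finite_family Y J U"
    using F unfolding strict_Fin_fan_def by blast
  have "compact_finite_family Y I (\<lambda>i. if i \<in> j ` J then U (inv_into J j i) else {})"
    using U(2) unfolding compact_finite_family_def reindexed_family[OF j] by simp
  moreover have "\<forall>i\<in>I. functional_neighborhood Y (if i \<in> j ` J then F (inv_into J j i) else {}) (if i \<in> j ` J then U (inv_into J j i) else {})"
    using U(1) j(1) by (auto simp: inv_into_f_f functional_neighborhood_empty)
  moreover have "Fin_fan Y I (\<lambda>i. if i \<in> j ` J then F (inv_into J j i) else {})"
    using Fin_fan_reindex[OF _ j] F unfolding strict_Fin_fan_def by blast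
  ultimately show ?thesis unfolding strict_Fin_fan_def by (intro conjI exI)
qed

lemma omega_1_fanI:
  assumes "|J| \<le>o |omega_1|"
  shows "Fin_fan Y J F \<Longrightarrow> \<exists>F. Fin_fan Y omega_1 F"
    and "strict_Fin_fan Y J F \<Longrightarrow> \<exists>F. strict_Fin_fan Y omega_1 F"
proof -
  obtain j where j: "inj_on j J" "j ` J \<subseteq> omega_1" using assms by (metis card_of_ordLeq)
  show "Fin_fan Y J F \<Longrightarrow> \<exists>F. Fin_fan Y omega_1 F"
    by (rule exI) (erule Fin_fan_reindex[OF _ j])
  show "strict_Fin_fan Y J F \<Longrightarrow> \<exists>F. strict_Fin_fan Y omega_1 F"
    by (rule exI) (erule strict_Fin_fan_reindex[OF _ j])
qed

lemma Fin_fan_homeomorphic_image: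
  assumes h: "homeomorphic_maps Y Z h k" and F: "Fin_fan Y I F"
  shows "Fin_fan Z I (\<lambda>\<alpha>. h ` F \<alpha>)"
proof -
  have hk: "continuous_map Y Z h" "continuous_map Z Y k" "\<And>y. y \<in> topspace Y \<Longrightarrow> k (h y) = y" "\<And>z. z \<in> topspace Z \<Longrightarrow> h (k z) = z"
    using h by (auto simp: homeomorphic_maps_def)
  have FY: "finite (F \<alpha>)" "F \<alpha> \<subseteq> topspace Y" if "\<alpha> \<in> I" for \<alpha> using F that by (auto simp: Fin_fan_def)
  show ?thesis unfolding Fin_fan_def compact_finite_family_def
  proof (intro conjI ballI allI impI)
    show "h ` F \<alpha> \<subseteq> topspace Z" if "\<alpha> \<in> I" for \<alpha> using FY[OF that] hk(1) continuous_map_image_subset_topspace by blast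
    fix K assume K: "compactin Z K"
    then have "compactin Y (k ` K)" using hk(2) image_compactin by blast
    then have "finite {\<alpha>\<in>I. F \<alpha> \<inter> k ` K \<noteq> {}}" using F by (simp add: Fin_fan_def compact_finite_family_def)
    moreover have "{\<alpha>\<in>I. h ` F \<alpha> \<inter> K \<noteq> {}} \<subseteq> {\<alpha>\<in>I. F \<alpha> \<inter> k ` K \<noteq> {}}"
    proof clarify
      fix \<alpha> assume \<alpha>: "\<alpha> \<in> I" "h ` F \<alpha> \<inter> K \<noteq> {}" "F \<alpha> \<inter> k ` K = {}"
      then obtain y where y: "y \<in> F \<alpha>" "h y \<in> K" by blast
      then have "y \<in> topspace Y" using FY(2)[OF \<alpha>(1)] by (auto simp: functional_neighborhood_def)
      then have "y \<in> k ` K" using y(2) hk(3) by (metis imageI)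
      then show False using \<alpha>(3) y(1) by blast
    qed
    ultimately show "finite {\<alpha>\<in>I. h ` F \<alpha> \<inter> K \<noteq> {}}" by (rule finite_subset[rotated])
  next
    obtain y where y: "y \<in> topspace Y" "\<And>U. openin Y U \<Longrightarrow> y \<in> U \<Longrightarrow> infinite {\<alpha>\<in>I. F \<alpha> \<inter> U \<noteq> {}}"
      using F by (auto simp: Fin_fan_def locally_finite_family_def)
    show "\<not> locally_finite_family Z I (\<lambda>\<alpha>. h ` F \<alpha>)" unfolding locally_finite_family_def
    proof
      assume "\<forall>y\<in>topspace Z. \<exists>U. openin Z U \<and> y \<in> U \<and> finite {\<alpha>\<in>I. h ` F \<alpha> \<inter> U \<noteq> {}}"
      moreover have "h y \<in> topspace Z" using hk(1) y(1) continuous_map_image_subset_topspace by blast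
      ultimately obtain U where U: "openin Z U" "h y \<in> U" "finite {\<alpha>\<in>I. h ` F \<alpha> \<inter> U \<noteq> {}}" by blast
      have "openin Y {x\<in>topspace Y. h x \<in> U}" using hk(1) U(1) by (rule openin_continuous_map_preimage)
      then have "infinite {\<alpha>\<in>I. F \<alpha> \<inter> {x\<in>topspace Y. h x \<in> U} \<noteq> {}}" using y U(2) by blast
      moreover have "{\<alpha>\<in>I. F \<alpha> \<inter> {x\<in>topspace Y. h x \<in> U} \<noteq> {}} \<subseteq> {\<alpha>\<in>I. h ` F \<alpha> \<inter> U \<noteq> {}}" by blast
      ultimately show False using U(3) finite_subset by blast
    qed
  qed (use FY in auto)
qed

lemma strict_Fin_fan_homeomorphic_image:
  assumes h: "homeomorphic_maps Y Z h k" and F: "strict_Fin_fan Y I F"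
  shows "strict_Fin_fan Z I (\<lambda>\<alpha>. h ` F \<alpha>)"
proof -
  have hk: "continuous_map Y Z h" "continuous_map Z Y k" "\<And>y. y \<in> topspace Y \<Longrightarrow> k (h y) = y" "\<And>z. z \<in> topspace Z \<Longrightarrow> h (k z) = z"
    using h by (auto simp: homeomorphic_maps_def)
  obtain U where U: "\<And>\<alpha>. \<alpha> \<in> I \<Longrightarrow> functional_neighborhood Y (F \<alpha>) (U \<alpha>)" "compact_finite_family Y I U"
    using F unfolding strict_Fin_fan_def by blast
  have "functional_neighborhood Z (h ` F \<alpha>) (h ` U \<alpha>)" if \<alpha>: "\<alpha> \<in> I" for \<alpha>
  proof -
    obtain f where f: "F \<alpha> \<subseteq> topspace Y" "U \<alpha> \<subseteq> topspace Y" "continuous_map Y (top_of_set {0..1::real}) f" "f ` F \<alpha> \<subseteq> {0}" "f ` (topspace Y - U \<alpha>) \<subseteq> {1}"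
      using U(1)[OF \<alpha>] by (auto simp: functional_neighborhood_def)
    have hY: "h ` topspace Y \<subseteq> topspace Z" "k ` topspace Z \<subseteq> topspace Y" using hk(1,2) continuous_map_image_subset_topspace by blast+
    show ?thesis unfolding functional_neighborhood_def
    proof (intro conjI exI[of _ "f \<circ> k"])
      show "continuous_map Z (top_of_set {0..1}) (f \<circ> k)" using hk(2) f(3) by (rule continuous_map_compose)
      show "(f \<circ> k) ` (topspace Z - h ` U \<alpha>) \<subseteq> {1}"
      proof
        fix t assume "t \<in> (f \<circ> k) ` (topspace Z - h ` U \<alpha>)"
        then obtain z where z: "z \<in> topspace Z" "z \<notin> h ` U \<alpha>" "t = f (k z)" by auto
        then have "k z \<in> topspace Y - U \<alpha>" using hk(4) hY by force
        then show "t \<in> {1}" using z(3) f(5) by blast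
      qed
      show "h ` F \<alpha> \<subseteq> topspace Z" "h ` U \<alpha> \<subseteq> topspace Z" using f(1,2) hY by blast+
      show "(f \<circ> k) ` h ` F \<alpha> \<subseteq> {0}" using f(1,4) hk(3) by force
    qed
  qed
  moreover have "compact_finite_family Z I (\<lambda>\<alpha>. h ` U \<alpha>)" unfolding compact_finite_family_def
  proof (intro allI impI)
    fix K assume K: "compactin Z K"
    then have "compactin Y (k ` K)" using hk(2) image_compactin by blast
    then have "finite {\<alpha>\<in>I. U \<alpha> \<inter> k ` K \<noteq> {}}" using U(2) by (simp add: compact_finite_family_def)
    moreover have "{\<alpha>\<in>I. h ` U \<alpha> \<inter> K \<noteq> {}} \<subseteq> {\<alpha>\<in>I. U \<alpha> \<inter> k ` K \<noteq> {}}"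
    proof clarify
      fix \<alpha> assume \<alpha>: "\<alpha> \<in> I" "h ` U \<alpha> \<inter> K \<noteq> {}" "U \<alpha> \<inter> k ` K = {}"
      then obtain y where y: "y \<in> U \<alpha>" "h y \<in> K" by blast
      then have "y \<in> topspace Y" using U(1)[OF \<alpha>(1)] by (auto simp: functional_neighborhood_def)
      then have "y \<in> k ` K" using y(2) hk(3) by (metis imageI)
      then show False using \<alpha>(3) y(1) by blast
    qed
    ultimately show "finite {\<alpha>\<in>I. h ` U \<alpha> \<inter> K \<noteq> {}}" by (rule finite_subset[rotated])
  qed
  moreover have "Fin_fan Z I (\<lambda>\<alpha>. h ` F \<alpha>)"
    by (rule Fin_fan_homeomorphic_image[OF h]) (use F in \<open>simp add: strict_Fin_fan_def\<close>)
  ultimately show ?thesis unfolding strict_Fin_fan_def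
    by (intro conjI exI[of _ "\<lambda>\<alpha>. h ` U \<alpha>"] ballI)
qed

section \<open>Compact subsets of free topological Abelian groups\<close>

text \<open>The additive extension of \<open>f\<close> to formal integer combinations. Values in an
  arbitrary real vector space allow a whole sequence of real functions to be extended at once, as
  one map into a space of bounded sequences.\<close>

definition lin_ext :: "('a \<Rightarrow> 'b::real_vector) \<Rightarrow> ('a \<Rightarrow>\<^sub>0 int) \<Rightarrow> 'b" where
  "lin_ext f g = (\<Sum>x\<in>Poly_Mapping.keys g. of_int (Poly_Mapping.lookup g x) *\<^sub>R f x)"

lemma lin_ext_superset:
  assumes "finite A" "Poly_Mapping.keys g \<subseteq> A"
  shows "lin_ext f g = (\<Sum>x\<in>A. of_int (Poly_Mapping.lookup g x) *\<^sub>R f x)"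
  unfolding lin_ext_def using assms by (intro sum.mono_neutral_left) (auto simp: in_keys_iff)

lemma lin_ext_frag_of [simp]: "lin_ext f (frag_of x) = f x"
  by (simp add: lin_ext_def)

lemma lin_ext_add: "lin_ext f (g + h) = lin_ext f g + lin_ext f h"
proof -
  let ?A = "Poly_Mapping.keys g \<union> Poly_Mapping.keys h"
  have "lin_ext f (g + h) = (\<Sum>x\<in>?A. of_int (Poly_Mapping.lookup (g + h) x) *\<^sub>R f x)"
    by (rule lin_ext_superset) (simp_all add: keys_add)
  also have "\<dots> = (\<Sum>x\<in>?A. of_int (Poly_Mapping.lookup g x) *\<^sub>R f x) + (\<Sum>x\<in>?A. of_int (Poly_Mapping.lookup h x) *\<^sub>R f x)"
    by (simp add: lookup_add scaleR_add_left sum.distrib)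
  also have "\<dots> = lin_ext f g + lin_ext f h"
    by (simp add: lin_ext_superset[of ?A g] lin_ext_superset[of ?A h])
  finally show ?thesis .
qed

lemma lin_ext_cmul: "lin_ext f (frag_cmul k g) = of_int k *\<^sub>R lin_ext f g"
proof -
  have "lin_ext f (frag_cmul k g) = (\<Sum>x\<in>Poly_Mapping.keys g. of_int (Poly_Mapping.lookup (frag_cmul k g) x) *\<^sub>R f x)"
    by (rule lin_ext_superset) (simp_all add: keys_cmul)
  then show ?thesis by (simp add: lin_ext_def scaleR_sum_right)
qed

lemma lin_ext_minus: "lin_ext f (- g) = - lin_ext f g"
  using lin_ext_cmul[of f "-1" g] by simp

lemma lin_ext_diff: "lin_ext f (g - h) = lin_ext f g - lin_ext f h"
  using lin_ext_add[of f g "- h"] by (simp add: lin_ext_minus)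

lemma free_group_compact_keys:
  assumes "compactin (free_group_topology X) K" "g \<in> K"
  shows "Poly_Mapping.keys g \<subseteq> topspace X"
proof -
  have "g \<in> carrier (free_Abelian_group (topspace X))"
    using compactin_subset_topspace[OF assms(1)] assms(2) topspace_free_group_topology by blast
  then show ?thesis by simp
qed

lemma lin_ext_nonzero_keys: "lin_ext f g \<noteq> 0 \<Longrightarrow> \<exists>x\<in>Poly_Mapping.keys g. f x \<noteq> 0"
  unfolding lin_ext_def by (metis (no_types, lifting) scaleR_zero_right sum.neutral)

lemma topological_abelian_group_normed:
  "topological_abelian_group \<lparr>carrier = UNIV, mult = (+), one = 0 :: 'b::real_normed_vector\<rparr> euclidean"
proof -
  let ?H = "\<lparr>carrier = UNIV, mult = (+), one = 0 :: 'b\<rparr>"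
  have g: "comm_group ?H"
  proof (rule comm_groupI)
    show "\<exists>y\<in>carrier ?H. y \<otimes>\<^bsub>?H\<^esub> x = \<one>\<^bsub>?H\<^esub>" for x by (rule bexI[of _ "- x"]) auto
  qed (auto simp: algebra_simps)
  then interpret H: comm_group ?H .
  have inv: "inv\<^bsub>?H\<^esub> x = - x" for x by (rule H.inv_equality) auto
  have "continuous_map (prod_topology euclidean euclidean) euclidean (\<lambda>p. fst p + snd p :: 'b)"
    by (intro continuous_map_add continuous_map_fst continuous_map_snd)
  moreover have "continuous_map euclidean euclidean (\<lambda>x. - x :: 'b)"
    by (intro continuous_map_minus) simp
  ultimately show ?thesis unfolding topological_abelian_group_def inv
    by (simp add: g case_prod_unfold)
qed

text \<open>The universal property for the additive group of a normed space gives a continuous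
  extension, and on the free group the extension is determined by its values on generators.\<close>

lemma continuous_map_lin_ext:
  fixes f :: "'a \<Rightarrow> 'b::real_normed_vector"
  assumes "continuous_map X euclidean f"
  shows "continuous_map (free_group_topology X) euclidean (lin_ext f)"
proof -
  let ?H = "\<lparr>carrier = UNIV, mult = (+), one = 0 :: 'b\<rparr>" and ?A = "free_Abelian_group (topspace X)"
  have H: "topological_abelian_group ?H euclidean" by (rule topological_abelian_group_normed)
  obtain h where h: "h \<in> hom ?A ?H" "continuous_map (free_group_topology X) euclidean h"
    "\<And>x. x \<in> topspace X \<Longrightarrow> h (frag_of x) = f x"
    by (rule universal_for_obtain[OF free_group_universal H assms]) metis
  have G: "group ?H" using H by (simp add: topological_abelian_group_def comm_group_def)
  have l: "lin_ext f \<in> hom ?A ?H" by (simp add: hom_def lin_ext_add)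
  have "h g = lin_ext f g" if "Poly_Mapping.keys g \<subseteq> topspace X" for g
    by (rule hom_free_Abelian_group_eqI[OF G h(1) l _ that]) (simp add: h(3))
  then show ?thesis using h(2) by (auto intro: continuous_map_eq simp: topspace_free_group_topology)
qed

section \<open>Uniform bounds for functionals on compact sets\<close>

lemma apply_bcontfun_sum: "apply_bcontfun (sum h A) n = (\<Sum>x\<in>A. apply_bcontfun (h x) n)"
  by (induction A rule: infinite_finite_induct) (simp_all add: plus_bcontfun.rep_eq zero_bcontfun.rep_eq)

text \<open>A pointwise bounded equicontinuous sequence of functions is a continuous map into a Banach
  space, and extends linearly to the free group.\<close>

lemma compact_lin_ext_bounded:
  fixes f :: "nat \<Rightarrow> 'a \<Rightarrow> real"
  assumes cont: "\<And>n. continuous_map X euclideanreal (f n)"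
    and bdd: "\<And>x. x \<in> topspace X \<Longrightarrow> \<exists>B. \<forall>n. \<bar>f n x\<bar> \<le> B"
    and equi: "\<And>x e. x \<in> topspace X \<Longrightarrow> e > 0 \<Longrightarrow>
      \<exists>V J. openin X V \<and> x \<in> V \<and> finite J \<and> (\<forall>n. n \<notin> J \<longrightarrow> (\<forall>y\<in>V. \<bar>f n y - f n x\<bar> < e))"
    and K: "compactin (free_group_topology X) K"
  obtains B where "\<And>g n. g \<in> K \<Longrightarrow> \<bar>lin_ext (f n) g\<bar> \<le> B"
proof -
  define F :: "'a \<Rightarrow> nat \<Rightarrow>\<^sub>C real" where "F x = Bcontfun (\<lambda>n. f n x)" for x
  have F: "apply_bcontfun (F x) n = f n x" if x: "x \<in> topspace X" for x n
  proof -
    obtain B where "\<And>n. \<bar>f n x\<bar> \<le> B" using bdd[OF x] by blast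
    then have "(\<lambda>n. f n x) \<in> bcontfun"
      by (auto simp: bcontfun_def bounded_iff)
    then show ?thesis unfolding F_def by (simp add: Bcontfun_inverse)
  qed
  have "continuous_map X euclidean F" unfolding continuous_map_def
  proof (intro conjI allI impI)
    fix W :: "(nat \<Rightarrow>\<^sub>C real) set" assume "openin euclidean W"
    then have W: "open W" by simp
    show "openin X {x \<in> topspace X. F x \<in> W}"
    proof (subst openin_subopen, intro ballI)
      fix x assume x: "x \<in> {x \<in> topspace X. F x \<in> W}"
      then have "F x \<in> W" by simp
      then obtain e where e: "e > 0" "ball (F x) e \<subseteq> W" using W[unfolded open_contains_ball] by blast
      have xX: "x \<in> topspace X" using x by simp
      have "e/2 > 0" using e(1) by simp
      from equi[OF xX this] obtain V J where V: "openin X V" "x \<in> V" "finite J"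
        "\<And>n y. n \<notin> J \<Longrightarrow> y \<in> V \<Longrightarrow> \<bar>f n y - f n x\<bar> < e/2" by blast
      \<comment> \<open>The finitely many exceptional indices in \<open>J\<close> are controlled by
        continuity of the single functions \<open>f n\<close>; the others are controlled by
        \<open>V\<close>.\<close>
      define O' where "O' n = {y \<in> topspace X. f n y \<in> ball (f n x) (e/2)}" for n
      have O': "openin X (O' n)" for n unfolding O'_def
        by (rule openin_continuous_map_preimage[OF cont]) simp
      have "openin X (V \<inter> ((\<Inter>n\<in>J. O' n) \<inter> topspace X))"
        using openin_Int[OF V(1) openin_INT[OF V(3) O']] by simp
      moreover have "x \<in> V \<inter> ((\<Inter>n\<in>J. O' n) \<inter> topspace X)" using V(2) xX e(1) by (simp add: O'_def)
      moreover have "F y \<in> W" if y: "y \<in> V \<inter> ((\<Inter>n\<in>J. O' n) \<inter> topspace X)" for y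
      proof -
        have yX: "y \<in> topspace X" using y by blast
        have "\<bar>f n y - f n x\<bar> \<le> e/2" for n
        proof (cases "n \<in> J")
          case True
          then have "y \<in> O' n" using y by blast
          then show ?thesis by (simp add: O'_def dist_real_def abs_minus_commute)
        qed (use V(4)[of n y] y in auto)
        then have "dist (F x) (F y) \<le> e/2"
          by (intro dist_bound) (simp add: F xX yX dist_real_def abs_minus_commute)
        then have "F y \<in> ball (F x) e" using e(1) by simp
        then show ?thesis using e(2) by blast
      qed
      ultimately show "\<exists>T. openin X T \<and> x \<in> T \<and> T \<subseteq> {x \<in> topspace X. F x \<in> W}"
        by (intro exI[of _ "V \<inter> ((\<Inter>n\<in>J. O' n) \<inter> topspace X)"] conjI subsetI) auto
    qed
  qed auto
  then have "continuous_map (free_group_topology X) euclidean (lin_ext F)" by (rule continuous_map_lin_ext)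
  then have "compactin euclidean (lin_ext F ` K)" using K by (rule image_compactin[rotated])
  then have "bounded (lin_ext F ` K)" by (simp add: compact_imp_bounded)
  then obtain B where B: "\<And>g. g \<in> K \<Longrightarrow> norm (lin_ext F g) \<le> B" by (auto simp: bounded_iff)
  have KX: "Poly_Mapping.keys g \<subseteq> topspace X" if "g \<in> K" for g
    using free_group_compact_keys[OF K that] .
  show thesis
  proof
    fix g n assume g: "g \<in> K"
    have "lin_ext (f n) g = apply_bcontfun (lin_ext F g) n"
      unfolding lin_ext_def apply_bcontfun_sum
      using KX[OF g] by (intro sum.cong) (auto simp: scaleR_bcontfun.rep_eq F)
    also have "\<bar>\<dots>\<bar> \<le> norm (lin_ext F g)" using norm_bounded[of "lin_ext F g" n] by simp
    finally show "\<bar>lin_ext (f n) g\<bar> \<le> B" using B[OF g] by linarith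
  qed
qed

text \<open>Near a point all but finitely many of the functions vanish, so pointwise boundedness and
  equicontinuity hold however large the functions are. This freedom of scaling is exploited to bound
  supports.\<close>

lemma locally_finite_functions_compact_bounded:
  fixes f :: "nat \<Rightarrow> 'a \<Rightarrow> real"
  assumes cont: "\<And>n. continuous_map X euclideanreal (f n)"
    and lf: "locally_finite_family X UNIV (\<lambda>n. {x\<in>topspace X. f n x \<noteq> 0})"
    and K: "compactin (free_group_topology X) K"
  obtains B where "\<And>g n. g \<in> K \<Longrightarrow> \<bar>lin_ext (f n) g\<bar> \<le> B"
proof (rule compact_lin_ext_bounded[OF cont _ _ K])
  fix x assume x: "x \<in> topspace X"
  then obtain V where V: "openin X V" "x \<in> V" "finite {n. {x\<in>topspace X. f n x \<noteq> 0} \<inter> V \<noteq> {}}"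
    using lf by (auto simp: locally_finite_family_def)
  let ?J = "{n. {x\<in>topspace X. f n x \<noteq> 0} \<inter> V \<noteq> {}}"
  have zero: "f n y = 0" if "n \<notin> ?J" "y \<in> V" for n y using that V(1) openin_subset by fastforce
  have "\<bar>f n x\<bar> \<le> (\<Sum>n\<in>?J. \<bar>f n x\<bar>)" for n
  proof (cases "n \<in> ?J")
    case True
    then show ?thesis using V(3) by (intro member_le_sum) auto
  next
    case False
    then show ?thesis using zero[of n x] V(2) by (simp add: sum_nonneg)
  qed
  then show "\<exists>B. \<forall>n. \<bar>f n x\<bar> \<le> B" by blast
  show "\<exists>V J. openin X V \<and> x \<in> V \<and> finite J \<and> (\<forall>n. n \<notin> J \<longrightarrow> (\<forall>y\<in>V. \<bar>f n y - f n x\<bar> < e))" if e: "e > 0" for e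
  proof (rule exI[of _ V], rule exI[of _ ?J], intro conjI allI impI ballI)
    fix n y assume "n \<notin> ?J" "y \<in> V"
    then show "\<bar>f n y - f n x\<bar> < e" using zero[of n y] zero[of n x] V(2) e by simp
  qed (fact V)+
qed (use that in blast)

section \<open>Compact sets of words have supports in a common compact set\<close>

lemma noncompact_closure_locally_finite:
  assumes "mu_complete_space X" "\<not> compactin X (X closure_of S)"
  obtains \<U> where "locally_finite_in X \<U>" "infinite \<U>" "\<And>U. U \<in> \<U> \<Longrightarrow> openin X U \<and> U \<inter> S \<noteq> {}"
proof -
  have "\<not> bounded_in X (X closure_of S)" using assms(1)[unfolded mu_complete_space_def, rule_format, of "X closure_of S"] assms(2) by auto
  then have "\<not> (\<forall>\<U>. locally_finite_in X \<U> \<and> (\<forall>U\<in>\<U>. openin X U \<and> U \<inter> (X closure_of S) \<noteq> {}) \<longrightarrow> finite \<U>)"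
    using closure_of_subset_topspace[of X S] unfolding bounded_in_def by simp
  then obtain \<U> where \<U>: "locally_finite_in X \<U>" "\<forall>U\<in>\<U>. openin X U \<and> U \<inter> (X closure_of S) \<noteq> {}" "infinite \<U>"
    unfolding not_all not_imp by (elim exE conjE)
  show thesis
  proof (rule that[OF \<U>(1,3)])
    fix U assume "U \<in> \<U>"
    then have "openin X U" "U \<inter> (X closure_of S) \<noteq> {}" using \<U>(2) by simp_all
    then show "openin X U \<and> U \<inter> S \<noteq> {}" by (simp add: openin_Int_closure_of_eq_empty)
  qed
qed

text \<open>If the closure of all supports is not compact, infinitely many locally finite open sets
  contain letters \<open>x n\<close> of elements \<open>g n\<close> of \<open>K\<close>. Bump
  functions at the \<open>x n\<close> of growing height then define functionals that are unbounded
  on \<open>K\<close>.\<close>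

lemma free_group_compact_support:
  assumes X: "Tychonoff_space X" "mu_complete_space X" and K: "compactin (free_group_topology X) K"
  obtains C where "compactin X C" "\<And>g. g \<in> K \<Longrightarrow> Poly_Mapping.keys g \<subseteq> C"
proof -
  define S where "S = (\<Union>g\<in>K. Poly_Mapping.keys g)"
  have SX: "S \<subseteq> topspace X" using free_group_compact_keys[OF K] unfolding S_def by blast
  have "compactin X (X closure_of S)"
  proof (rule ccontr)
    assume "\<not> compactin X (X closure_of S)"
    then obtain \<U> where \<U>: "locally_finite_in X \<U>" "infinite \<U>" "\<And>U. U \<in> \<U> \<Longrightarrow> openin X U \<and> U \<inter> S \<noteq> {}"
      by (rule noncompact_closure_locally_finite[OF X(2)]) metis
    then obtain u :: "nat \<Rightarrow> 'a set" where u: "inj u" "range u \<subseteq> \<U>" using infinite_countable_subset by blast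
    then have uo: "openin X (u n)" "u n \<inter> S \<noteq> {}" for n using \<U>(3) by blast+
    then have "\<forall>n. \<exists>x g. x \<in> u n \<and> g \<in> K \<and> x \<in> Poly_Mapping.keys g" unfolding S_def by blast
    then obtain x g where xg: "\<And>n. x n \<in> u n" "\<And>n. g n \<in> K" "\<And>n. x n \<in> Poly_Mapping.keys (g n)" by metis
    \<comment> \<open>The other letters of \<open>g n\<close> are removed, so that only the
      coefficient of \<open>x n\<close> contributes to the \<open>n\<close>-th functional.\<close>
    define W where "W n = u n - (Poly_Mapping.keys (g n) - {x n})" for n
    have "closedin X (Poly_Mapping.keys (g n) - {x n})" for n
    proof -
      have "Poly_Mapping.keys (g n) \<subseteq> topspace X" using SX xg(2) unfolding S_def by blast
      moreover have "t1_space X" using X(1) by (simp add: Tychonoff_space_def)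
      ultimately show ?thesis unfolding t1_space_closedin_finite by (meson Diff_subset finite_Diff finite_keys subset_trans)
    qed
    then have Wo: "openin X (W n)" "x n \<in> W n" for n unfolding W_def using uo xg(1) by auto
    have "\<forall>n. \<exists>\<phi>. continuous_map X euclideanreal \<phi> \<and> \<phi> (x n) = 1 \<and> (\<forall>y\<in>topspace X - W n. \<phi> y = 0)"
      using Tychonoff_separation[OF X(1) Wo] by metis
    then obtain \<phi> where \<phi>: "\<And>n. continuous_map X euclideanreal (\<phi> n)" "\<And>n. \<phi> n (x n) = (1::real)"
      "\<And>n y. y \<in> topspace X - W n \<Longrightarrow> \<phi> n y = 0" by metis
    \<comment> \<open>A nonzero integer coefficient has absolute value at least 1, so height
      \<open>n + 1\<close> forces the value on \<open>g n\<close> to be at least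
      \<open>n + 1\<close> in absolute value.\<close>
    define f where "f n y = (real n + 1) * \<phi> n y" for n y
    have cont: "continuous_map X euclideanreal (f n)" for n
      unfolding f_def using \<phi>(1) by (intro continuous_intros) auto
    have "locally_finite_family X UNIV (\<lambda>n. {x\<in>topspace X. f n x \<noteq> 0})" unfolding locally_finite_family_def
    proof
      fix z assume "z \<in> topspace X"
      then obtain V where V: "openin X V" "z \<in> V" "finite {U \<in> \<U>. U \<inter> V \<noteq> {}}"
        using \<U>(1) unfolding locally_finite_in_def by blast
      have "u ` {n. {x\<in>topspace X. f n x \<noteq> 0} \<inter> V \<noteq> {}} \<subseteq> {U \<in> \<U>. U \<inter> V \<noteq> {}}"
      proof (rule image_subsetI)
        fix n assume "n \<in> {n. {x\<in>topspace X. f n x \<noteq> 0} \<inter> V \<noteq> {}}"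
        then obtain y where y: "y \<in> topspace X" "f n y \<noteq> 0" "y \<in> V" by blast
        then have "y \<in> W n" using \<phi>(3)[of y n] by (auto simp: f_def)
        then show "u n \<in> {U \<in> \<U>. U \<inter> V \<noteq> {}}" using y(3) u(2) by (auto simp: W_def)
      qed
      then have "finite (u ` {n. {x\<in>topspace X. f n x \<noteq> 0} \<inter> V \<noteq> {}})" using V(3) finite_subset by blast
      moreover have "inj_on u A" for A using u(1) by (rule inj_on_subset) simp
      ultimately have "finite {n. {x\<in>topspace X. f n x \<noteq> 0} \<inter> V \<noteq> {}}" by (meson finite_imageD)
      then show "\<exists>U. openin X U \<and> z \<in> U \<and> finite {n \<in> UNIV. {x\<in>topspace X. f n x \<noteq> 0} \<inter> U \<noteq> {}}"
        using V(1,2) by auto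
    qed
    then obtain B where B: "\<And>g n. g \<in> K \<Longrightarrow> \<bar>lin_ext (f n) g\<bar> \<le> B"
      using locally_finite_functions_compact_bounded[of X f, OF cont _ K] by metis
    have "lin_ext (f n) (g n) = of_int (Poly_Mapping.lookup (g n) (x n)) * (real n + 1)" for n
    proof -
      have zero: "f n y = 0" if "y \<in> Poly_Mapping.keys (g n) - {x n}" for y
      proof -
        have "y \<in> topspace X - W n" using that SX xg(2)[of n] unfolding S_def W_def by blast
        then show ?thesis using \<phi>(3) by (simp add: f_def)
      qed
      have "lin_ext (f n) (g n) = (\<Sum>y\<in>{x n}. of_int (Poly_Mapping.lookup (g n) y) *\<^sub>R f n y)"
        unfolding lin_ext_def using xg(3) zero by (intro sum.mono_neutral_right) auto
      then show ?thesis by (simp add: f_def \<phi>(2))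
    qed
    moreover have "\<bar>real_of_int (Poly_Mapping.lookup (g n) (x n))\<bar> \<ge> 1" for n
      using xg(3)[of n] by (simp add: in_keys_iff flip: of_int_abs)
    ultimately have le: "\<bar>lin_ext (f n) (g n)\<bar> \<ge> real n + 1" for n
      using mult_right_mono[of 1 "\<bar>real_of_int (Poly_Mapping.lookup (g n) (x n))\<bar>" "real n + 1"]
      by (simp add: abs_mult)
    obtain n :: nat where "B < real n" using reals_Archimedean2 by blast
    then show False using B[OF xg(2), of n n] le[of n] by linarith
  qed
  moreover have "Poly_Mapping.keys g \<subseteq> X closure_of S" if "g \<in> K" for g
    using closure_of_subset[OF SX] that unfolding S_def by blast
  ultimately show thesis using that by blast
qed

section \<open>Compact sets of words have bounded length\<close>

definition word_length :: "('a \<Rightarrow>\<^sub>0 int) \<Rightarrow> real" where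
  "word_length g = (\<Sum>x\<in>Poly_Mapping.keys g. \<bar>of_int (Poly_Mapping.lookup g x)\<bar>)"

lemma lin_ext_le_word_length:
  fixes f :: "'a \<Rightarrow> real"
  assumes "\<And>x. x \<in> Poly_Mapping.keys g \<Longrightarrow> \<bar>f x\<bar> \<le> 1"
  shows "\<bar>lin_ext f g\<bar> \<le> word_length g"
proof -
  have "\<bar>lin_ext f g\<bar> \<le> (\<Sum>x\<in>Poly_Mapping.keys g. \<bar>of_int (Poly_Mapping.lookup g x) *\<^sub>R f x\<bar>)"
    unfolding lin_ext_def by (rule sum_abs)
  also have "\<dots> \<le> word_length g" unfolding word_length_def
    using assms by (intro sum_mono) (simp add: abs_mult mult_left_le)
  finally show ?thesis .
qed

text \<open>The length is the sum of the absolute values of the coefficients, attained by a function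
  with values in \<open>{-1..1}\<close> that extends their signs from the finite support. Dividing
  the \<open>n\<close>-th such function by \<open>n + 1\<close> makes the sequence tend to zero
  uniformly, hence equicontinuous.\<close>

lemma free_group_compact_length:
  assumes X: "Tychonoff_space X" and K: "compactin (free_group_topology X) K"
  obtains B where "\<And>g. g \<in> K \<Longrightarrow> word_length g \<le> B"
proof (rule ccontr)
  assume "\<not> thesis"
  \<comment> \<open>The square leaves more than \<open>n + 1\<close> after division by
    \<open>n + 1\<close>, so the scaled functionals remain unbounded on \<open>K\<close>.\<close>
  then have "\<forall>n::nat. \<exists>g. g \<in> K \<and> word_length g > (real n + 1)^2" using that by (meson not_le)
  then obtain g where g: "\<And>n::nat. g n \<in> K" "\<And>n::nat. word_length (g n) > (real n + 1)^2" by metis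
  have "\<exists>f. continuous_map X euclideanreal f \<and> f ` topspace X \<subseteq> {-1..1} \<and> lin_ext f h = word_length h"
    if h: "h \<in> K" for h
  proof -
    let ?S = "Poly_Mapping.keys h"
    have SX: "?S \<subseteq> topspace X" by (rule free_group_compact_keys[OF K h])
    have "subtopology X ?S = discrete_topology ?S"
      using subtopology_eq_discrete_topology_finite[of X ?S] X SX by (simp add: Tychonoff_space_def Int_absorb1)
    then have "continuous_map (subtopology X ?S) euclidean (\<lambda>x. sgn (real_of_int (Poly_Mapping.lookup h x)))" by simp
    moreover have "compactin X ?S" using SX by (simp add: finite_imp_compactin)
    moreover have "(\<lambda>x. sgn (real_of_int (Poly_Mapping.lookup h x))) ` ?S \<subseteq> {-1..1}" by (auto simp: sgn_real_def)
    moreover have "{-1..1::real} \<noteq> {}" "is_interval {-1..1::real}" "completely_regular_space X"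
      using X by (auto simp: Tychonoff_space_def is_interval_cc)
    ultimately obtain f where f: "continuous_map X euclideanreal f" "f ` topspace X \<subseteq> {-1..1}"
      "\<And>x. x \<in> ?S \<Longrightarrow> f x = sgn (real_of_int (Poly_Mapping.lookup h x))"
      by (metis Tietze_extension_completely_regular)
    have "lin_ext f h = word_length h" unfolding lin_ext_def word_length_def
      by (intro sum.cong) (simp_all add: f(3) abs_sgn)
    then show ?thesis using f by blast
  qed
  then have "\<forall>n. \<exists>f. continuous_map X euclideanreal f \<and> f ` topspace X \<subseteq> {-1..1} \<and> lin_ext f (g n) = word_length (g n)"
    using g(1) by blast
  then obtain s where s: "\<And>n. continuous_map X euclideanreal (s n)" "\<And>n. s n ` topspace X \<subseteq> {-1..1}"
    "\<And>n. lin_ext (s n) (g n) = word_length (g n)" by metis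
  define f where "f n x = inverse (real (Suc n)) * s n x" for n x
  have cont: "continuous_map X euclideanreal (f n)" for n
    unfolding f_def using s(1) by (intro continuous_intros) auto
  have small: "\<bar>f n x\<bar> \<le> inverse (real (Suc n))" if "x \<in> topspace X" for n x
  proof -
    have "\<bar>s n x\<bar> \<le> 1" using s(2)[of n] that by (auto simp: image_subset_iff abs_le_iff minus_le_iff)
    then have "inverse (real (Suc n)) * \<bar>s n x\<bar> \<le> inverse (real (Suc n)) * 1" by (intro mult_left_mono) auto
    then show ?thesis by (simp add: f_def abs_mult)
  qed
  have "\<exists>B. \<forall>h\<in>K. \<forall>n. \<bar>lin_ext (f n) h\<bar> \<le> B"
  proof (rule compact_lin_ext_bounded[of X f, OF cont _ _ K])
    fix x assume x: "x \<in> topspace X"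
    have "\<bar>f n x\<bar> \<le> 1" for n using small[OF x, of n] by (smt (verit) inverse_le_1_iff of_nat_0_le_iff of_nat_Suc)
    then show "\<exists>B. \<forall>n. \<bar>f n x\<bar> \<le> B" by blast
    fix e :: real assume "e > 0"
    then obtain N where N: "inverse (real (Suc N)) < e/2" using reals_Archimedean[of "e/2"] by auto
    have "\<bar>f n y - f n x\<bar> < e" if "n \<notin> {..<N}" "y \<in> topspace X" for n y
    proof -
      have "inverse (real (Suc n)) \<le> inverse (real (Suc N))" using that(1) by (intro le_imp_inverse_le) auto
      then show ?thesis using small[OF x, of n] small[OF that(2), of n] N by linarith
    qed
    then show "\<exists>V J. openin X V \<and> x \<in> V \<and> finite J \<and> (\<forall>n. n \<notin> J \<longrightarrow> (\<forall>y\<in>V. \<bar>f n y - f n x\<bar> < e))"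
      using x by (intro exI[of _ "topspace X"] exI[of _ "{..<N}"]) auto
  qed blast
  then obtain B where B: "\<And>h n. h \<in> K \<Longrightarrow> \<bar>lin_ext (f n) h\<bar> \<le> B" by blast
  have "lin_ext (f n) h = inverse (real (Suc n)) * lin_ext (s n) h" for n h
    unfolding lin_ext_def f_def by (simp add: sum_distrib_left mult.left_commute)
  then have eq: "lin_ext (f n) (g n) = inverse (real (Suc n)) * word_length (g n)" for n by (simp add: s(3))
  have "real n + 1 \<le> B" for n
  proof -
    have "inverse (real (Suc n)) * (real n + 1)^2 \<le> inverse (real (Suc n)) * word_length (g n)"
      using g(2)[of n] by (intro mult_left_mono) auto
    moreover have "inverse (real (Suc n)) * (real n + 1)^2 = real n + 1" by (simp add: power2_eq_square field_simps)
    ultimately show ?thesis using B[OF g(1), of n n] eq[of n] by linarith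
  qed
  moreover obtain n :: nat where "B < real n" using reals_Archimedean2 by blast
  ultimately show False by (smt (verit))
qed

section \<open>Fans in free topological Abelian groups\<close>

abbreviation FT :: "'a topology \<Rightarrow> ('a \<Rightarrow>\<^sub>0 int) topology" where
  "FT \<equiv> free_group_topology"

lemma in_topspace_FT [simp]: "g \<in> topspace (FT X) \<longleftrightarrow> Poly_Mapping.keys g \<subseteq> topspace X"
  unfolding topspace_free_group_topology by (rule carrier_free_Abelian_group_iff)

lemma continuous_map_FT_add:
  assumes "continuous_map Z (FT X) f" "continuous_map Z (FT X) g"
  shows "continuous_map Z (FT X) (\<lambda>z. f z + g z)"
proof -
  have add: "continuous_map (prod_topology (FT X) (FT X)) (FT X) (\<lambda>(x, y). x + y)"
    using free_group_topology_group[of X] by (simp add: topological_abelian_group_def)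
  have "continuous_map Z (prod_topology (FT X) (FT X)) (\<lambda>z. (f z, g z))"
    using assms by (rule continuous_map_pairedI)
  from continuous_map_compose[OF this add] show ?thesis by (simp add: o_def)
qed

lemma continuous_map_FT_minus:
  assumes "continuous_map Z (FT X) f"
  shows "continuous_map Z (FT X) (\<lambda>z. - f z)"
proof -
  have "continuous_map (FT X) (FT X) (\<lambda>x. inv\<^bsub>free_Abelian_group (topspace X)\<^esub> x)"
    using free_group_topology_group[of X] by (simp add: topological_abelian_group_def)
  then have "continuous_map (FT X) (FT X) (\<lambda>x. - x)"
    by (rule continuous_map_eq) simp
  from continuous_map_compose[OF assms this] show ?thesis by (simp add: o_def)
qed

lemma continuous_map_FT_diff:
  assumes "continuous_map Z (FT X) f" "continuous_map Z (FT X) g"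
  shows "continuous_map Z (FT X) (\<lambda>z. f z - g z)"
  using continuous_map_FT_add[OF assms(1) continuous_map_FT_minus[OF assms(2)]] by simp

lemma continuous_map_FT_cmul:
  assumes "continuous_map Z (FT X) f"
  shows "continuous_map Z (FT X) (\<lambda>z. frag_cmul (int n) (f z))"
proof (induction n)
  case (Suc n)
  have "continuous_map Z (FT X) (\<lambda>z. f z + frag_cmul (int n) (f z))"
    by (rule continuous_map_FT_add[OF assms Suc])
  then show ?case by (simp add: frag_cmul_distrib)
qed simp

lemma FT_zero_neighborhood:
  assumes "openin (FT X) U" "0 \<in> U"
  obtains V where "openin (FT X) V" "0 \<in> V" "\<And>a b. a \<in> V \<Longrightarrow> b \<in> V \<Longrightarrow> a + b \<in> U"
proof -
  let ?P = "prod_topology (FT X) (FT X)"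
  have "continuous_map ?P (FT X) (\<lambda>p. fst p + snd p)"
    by (intro continuous_map_FT_add continuous_map_fst continuous_map_snd)
  then have op: "openin ?P {p \<in> topspace ?P. fst p + snd p \<in> U}" (is "openin _ ?S")
    using assms(1) by (rule openin_continuous_map_preimage)
  have "(0, 0) \<in> ?S" using assms(2) by simp
  then have "\<exists>A B. openin (FT X) A \<and> openin (FT X) B \<and> 0 \<in> A \<and> 0 \<in> B \<and> A \<times> B \<subseteq> ?S"
    using op[unfolded openin_prod_topology_alt] by simp
  then obtain A B where AB: "openin (FT X) A" "openin (FT X) B" "0 \<in> A" "0 \<in> B" "A \<times> B \<subseteq> ?S" by auto
  show thesis
  proof (rule that[of "A \<inter> B"])
    fix a b assume "a \<in> A \<inter> B" "b \<in> A \<inter> B"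
    then have "(a, b) \<in> A \<times> B" by simp
    then show "a + b \<in> U" using AB(5) by auto
  qed (use AB in auto)
qed

lemma frag_of_diff_neighborhood:
  assumes "openin (FT X) V" "0 \<in> V" "l \<in> topspace X"
  shows "openin X {x \<in> topspace X. frag_cmul (int k) (frag_of x - frag_of l) \<in> V}"
proof -
  have "continuous_map X (FT X) (\<lambda>x. frag_cmul (int k) (frag_of x - frag_of l))"
    using assms(3) by (intro continuous_map_FT_cmul continuous_map_FT_diff frag_of_continuous) simp
  then show ?thesis using assms(1) by (rule openin_continuous_map_preimage)
qed

lemma eventually_multiple_in_neighborhood:
  assumes "openin (FT X) V" "0 \<in> V" "limitin X s l sequentially"
  shows "\<forall>\<^sub>F n in sequentially. frag_cmul (int k) (frag_of (s n) - frag_of l) \<in> V"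
proof -
  have l: "l \<in> topspace X" using assms(3) by (rule limitin_topspace)
  have "l \<in> {x \<in> topspace X. frag_cmul (int k) (frag_of x - frag_of l) \<in> V}" using l assms(2) by simp
  then have "\<forall>\<^sub>F n in sequentially. s n \<in> {x \<in> topspace X. frag_cmul (int k) (frag_of x - frag_of l) \<in> V}"
    using assms(3) frag_of_diff_neighborhood[OF assms(1,2) l] unfolding limitin_def by blast
  then show ?thesis by (rule eventually_mono) simp
qed

section \<open>The strict fan produced by sets with noncompact closure\<close>

lemma functional_neighborhood_positive:
  assumes u: "continuous_map Y euclideanreal u" and A: "A \<subseteq> topspace Y" "\<And>a. a \<in> A \<Longrightarrow> u a \<ge> 1"
  shows "functional_neighborhood Y A {y \<in> topspace Y. u y > 0}"
proof -
  have "continuous_map Y euclideanreal (\<lambda>y. 1 - max 0 (min 1 (u y)))"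
    using u by (intro continuous_intros) auto
  then have "continuous_map Y (top_of_set {0..1::real}) (\<lambda>y. 1 - max 0 (min 1 (u y)))"
    by (auto simp: continuous_map_in_subtopology)
  then show ?thesis unfolding functional_neighborhood_def using A
    by (intro conjI exI[of _ "\<lambda>y. 1 - max 0 (min 1 (u y))"]) auto
qed

text \<open>For a fan of singletons, the positivity sets of real functions serve as functional
  neighborhoods. The value at least 1 at \<open>g i\<close> places the point in its positivity set,
  so a single finiteness condition covers both the points and their neighborhoods.\<close>

lemma strict_Fin_fanI:
  assumes g: "\<And>i. i \<in> I \<Longrightarrow> g i \<in> topspace Y"
    and u: "\<And>i. i \<in> I \<Longrightarrow> continuous_map Y euclideanreal (u i)" "\<And>i. i \<in> I \<Longrightarrow> u i (g i) \<ge> 1"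
    and cf: "\<And>K. compactin Y K \<Longrightarrow> finite {i \<in> I. \<exists>y\<in>K. u i y > 0}"
    and y: "y \<in> topspace Y" "\<And>U. openin Y U \<Longrightarrow> y \<in> U \<Longrightarrow> infinite {i \<in> I. g i \<in> U}"
  shows "strict_Fin_fan Y I (\<lambda>i. {g i})"
proof -
  define U where "U i = {y \<in> topspace Y. u i y > 0}" for i
  have fn: "functional_neighborhood Y {g i} (U i)" if "i \<in> I" for i
    unfolding U_def using g[OF that] u[OF that] by (intro functional_neighborhood_positive) auto
  have cfU: "finite {i \<in> I. U i \<inter> K \<noteq> {}}" if "compactin Y K" for K
    using cf[OF that] by (rule finite_subset[rotated]) (auto simp: U_def)
  have "finite {i \<in> I. {g i} \<inter> K \<noteq> {}}" if "compactin Y K" for K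
  proof (rule finite_subset[OF _ cfU[OF that]], clarify)
    fix i assume i: "i \<in> I" "{g i} \<inter> K \<noteq> {}" "U i \<inter> K = {}"
    moreover have "g i \<in> U i" using g[OF i(1)] u(2)[OF i(1)] by (simp add: U_def)
    ultimately show False by blast
  qed
  moreover have "\<not> locally_finite_family Y I (\<lambda>i. {g i})"
    using y unfolding locally_finite_family_def by auto
  ultimately show ?thesis
    unfolding strict_Fin_fan_def Fin_fan_def compact_finite_family_def
    using g fn cfU by (intro conjI exI[of _ U] ballI allI impI) simp_all
qed

lemma locally_finite_in_compact:
  assumes "locally_finite_in X \<U>" "compactin X Q"
  shows "finite {U \<in> \<U>. U \<inter> Q \<noteq> {}}"
proof -
  have "\<forall>x\<in>Q. \<exists>V. openin X V \<and> x \<in> V \<and> finite {U \<in> \<U>. U \<inter> V \<noteq> {}}"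
    using assms compactin_subset_topspace[OF assms(2)] unfolding locally_finite_in_def by blast
  from bchoice[OF this] obtain V where V: "\<forall>x\<in>Q. openin X (V x) \<and> x \<in> V x \<and> finite {U \<in> \<U>. U \<inter> V x \<noteq> {}}" ..
  then have "\<And>T. T \<in> V ` Q \<Longrightarrow> openin X T" "Q \<subseteq> \<Union>(V ` Q)" by auto
  then obtain \<F> where "finite \<F>" "\<F> \<subseteq> V ` Q" "Q \<subseteq> \<Union>\<F>" using assms(2) by (meson compactinD)
  then obtain I where I: "finite I" "I \<subseteq> Q" "Q \<subseteq> \<Union>(V ` I)" by (metis finite_subset_image)
  have "{U \<in> \<U>. U \<inter> Q \<noteq> {}} \<subseteq> (\<Union>x\<in>I. {U \<in> \<U>. U \<inter> V x \<noteq> {}})" using I(3) by blast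
  moreover have "finite (\<Union>x\<in>I. {U \<in> \<U>. U \<inter> V x \<noteq> {}})" using I V by blast
  ultimately show ?thesis by (rule finite_subset)
qed

text \<open>Compact \<open>Q\<close> meets only finitely many sets of a locally finite family, and
  these can be discarded. This keeps the later bump functions zero at the auxiliary points collected
  in \<open>Q\<close>.\<close>

lemma noncompact_closure_discrete_sequence:
  assumes X: "mu_complete_space X" "\<not> compactin X (X closure_of S)" and Q: "compactin X Q"
  shows "\<exists>W d. (\<forall>m::nat. openin X (W m) \<and> d m \<in> W m \<and> d m \<in> S \<and> W m \<inter> Q = {}) \<and>
    (\<forall>C. compactin X C \<longrightarrow> finite {m. W m \<inter> C \<noteq> {}})"
proof -
  obtain \<U> where \<U>: "locally_finite_in X \<U>" "infinite \<U>" "\<And>U. U \<in> \<U> \<Longrightarrow> openin X U \<and> U \<inter> S \<noteq> {}"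
    by (rule noncompact_closure_locally_finite[OF X]) metis
  have "infinite (\<U> - {U \<in> \<U>. U \<inter> Q \<noteq> {}})"
    using \<U>(2) locally_finite_in_compact[OF \<U>(1) Q] by (rule Diff_infinite_finite[rotated])
  then obtain W :: "nat \<Rightarrow> 'a set" where W: "inj W" "range W \<subseteq> \<U> - {U \<in> \<U>. U \<inter> Q \<noteq> {}}"
    using infinite_countable_subset by blast
  have WU: "W m \<in> \<U>" "W m \<inter> Q = {}" for m using W(2) by blast+
  then have "\<forall>m. \<exists>d. d \<in> W m \<and> d \<in> S" using \<U>(3) by blast
  then obtain d where d: "\<And>m. d m \<in> W m" "\<And>m. d m \<in> S" by metis
  have fin: "finite {m. W m \<inter> C \<noteq> {}}" if "compactin X C" for C
  proof -
    have "W ` {m. W m \<inter> C \<noteq> {}} \<subseteq> {U \<in> \<U>. U \<inter> C \<noteq> {}}" using WU(1) by blast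
    then have "finite (W ` {m. W m \<inter> C \<noteq> {}})" using locally_finite_in_compact[OF \<U>(1) that] finite_subset by blast
    moreover have "inj_on W A" for A using W(1) by (rule inj_on_subset) simp
    ultimately show ?thesis by (meson finite_imageD)
  qed
  show ?thesis
    by (rule exI[of _ W], rule exI[of _ d]) (use WU \<U>(3) d fin in blast)
qed

text \<open>For elements of a compact set, bounded length admits only finitely many
  \<open>p\<close>, and for each \<open>p\<close> the compact support meets only finitely many
  \<open>W p m\<close>. The function \<open>u (p, m)\<close> is the minimum of one functional for
  either purpose.\<close>

lemma noncompact_sets_strict_fan:
  assumes X: "Tychonoff_space X" "mu_complete_space X"
    and s: "limitin X s l sequentially" "\<And>m. s m \<noteq> l" "range s \<subseteq> topspace X"
    and \<P>: "countable \<P>" "\<And>p. p \<in> \<P> \<Longrightarrow> p \<subseteq> topspace X \<and> \<not> compactin X (X closure_of p)"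
    and x: "x \<in> topspace X" "\<And>U. openin X U \<Longrightarrow> x \<in> U \<Longrightarrow> \<exists>p\<in>\<P>. p \<subseteq> U"
  shows "\<exists>F. strict_Fin_fan (FT X) (\<P> \<times> (UNIV :: nat set)) F"
proof -
  have lX: "l \<in> topspace X" using s(1) by (rule limitin_topspace)
  have sX: "s m \<in> topspace X" for m using s(3) by blast
  \<comment> \<open>At these points the functions \<open>\<psi> p m\<close> have to vanish, so that
    only \<open>d p m\<close> contributes to their value on the fan element.\<close>
  define Q where "Q = insert x (insert l (range s))"
  have "compactin X (insert l (range s))" by (rule compactin_sequence_with_limit[OF s(1) _ s(3)]) simp
  then have Q: "compactin X Q" using x(1) unfolding Q_def by (metis compactin_Un compactin_sing insert_is_Un)
  have "\<forall>p\<in>\<P>. \<exists>W d. (\<forall>m::nat. openin X (W m) \<and> d m \<in> W m \<and> d m \<in> p \<and> W m \<inter> Q = {}) \<and>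
    (\<forall>C. compactin X C \<longrightarrow> finite {m. W m \<inter> C \<noteq> {}})"
    using noncompact_closure_discrete_sequence[OF X(2) _ Q] \<P>(2) by blast
  from bchoice[OF this] obtain W where "\<forall>p\<in>\<P>. \<exists>d. (\<forall>m::nat. openin X (W p m) \<and> d m \<in> W p m \<and> d m \<in> p \<and> W p m \<inter> Q = {}) \<and>
    (\<forall>C. compactin X C \<longrightarrow> finite {m. W p m \<inter> C \<noteq> {}})" ..
  from bchoice[OF this] obtain d where Wd: "\<forall>p\<in>\<P>. (\<forall>m::nat. openin X (W p m) \<and> d p m \<in> W p m \<and> d p m \<in> p \<and> W p m \<inter> Q = {}) \<and>
    (\<forall>C. compactin X C \<longrightarrow> finite {m. W p m \<inter> C \<noteq> {}})" ..
  have W: "\<And>p m. p \<in> \<P> \<Longrightarrow> openin X (W p m)" "\<And>p m. p \<in> \<P> \<Longrightarrow> d p m \<in> W p (m::nat)"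
    "\<And>p m. p \<in> \<P> \<Longrightarrow> d p m \<in> p" "\<And>p m. p \<in> \<P> \<Longrightarrow> W p m \<inter> Q = {}"
    "\<And>p C. p \<in> \<P> \<Longrightarrow> compactin X C \<Longrightarrow> finite {m. W p m \<inter> C \<noteq> {}}" using Wd by simp_all
  have dX: "d p m \<in> topspace X" if "p \<in> \<P>" for p m using W(3)[OF that] \<P>(2)[OF that] by blast
  have "openin X (topspace X - {l})"
    using X(1) lX by (simp add: Tychonoff_space_def t1_space_openin_delete_alt flip: Diff_insert)
  then have "\<exists>\<phi>. continuous_map X euclideanreal \<phi> \<and> \<phi> (s m) = 1 \<and>
    (\<forall>y\<in>topspace X. 0 \<le> \<phi> y \<and> \<phi> y \<le> 1) \<and> \<phi> l = 0" for m
    using Tychonoff_separation[OF X(1), of "topspace X - {l}" "s m"] sX s(2) lX by (metis DiffD2 DiffI insertI1 singletonD)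
  then obtain \<phi> where \<phi>: "\<And>m. continuous_map X euclideanreal (\<phi> m)" "\<And>m. \<phi> m (s m) = (1::real)"
    "\<And>m y. y \<in> topspace X \<Longrightarrow> 0 \<le> \<phi> m y \<and> \<phi> m y \<le> 1" "\<And>m. \<phi> m l = 0" by metis
  have "\<exists>\<psi>. continuous_map X euclideanreal \<psi> \<and> \<psi> (d p m) = 1 \<and> (\<forall>y\<in>topspace X - W p m. \<psi> y = 0)"
    if "p \<in> \<P>" for p m
    using Tychonoff_separation[OF X(1) W(1,2)[OF that]] by metis
  then have "\<forall>p\<in>\<P>. \<forall>m. \<exists>\<psi>. continuous_map X euclideanreal \<psi> \<and> \<psi> (d p m) = 1 \<and> (\<forall>y\<in>topspace X - W p m. \<psi> y = 0)"
    by blast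
  then obtain \<psi> where \<psi>: "\<And>p m. p \<in> \<P> \<Longrightarrow> continuous_map X euclideanreal (\<psi> p m)"
    "\<And>p m. p \<in> \<P> \<Longrightarrow> \<psi> p m (d p m) = (1::real)"
    "\<And>p m y. p \<in> \<P> \<Longrightarrow> y \<in> topspace X - W p m \<Longrightarrow> \<psi> p m y = 0" by metis
  \<comment> \<open>Countability of \<open>\<P>\<close> makes this numbering injective, so each
    bound on \<open>n p\<close> leaves finitely many \<open>p\<close>.\<close>
  define n where "n p = to_nat_on \<P> p" for p
  define g where "g = (\<lambda>(p,m). frag_of (d p m) - frag_of x + frag_cmul (int (n p)) (frag_of (s m) - frag_of l))"
  \<comment> \<open>The functional of \<open>\<phi> m\<close> is at least \<open>n p - 1\<close> on
    \<open>g (p, m)\<close>, as \<open>\<phi> m\<close> may take the value 1 at \<open>x\<close>;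
    subtracting \<open>n p - 2\<close> makes this at least 1. Positivity on \<open>h\<close>
    conversely forces the length of \<open>h\<close> above \<open>n p - 2\<close>.\<close>
  define u where "u = (\<lambda>(p,m) h. min (lin_ext (\<phi> m) h - (real (n p) - 2)) (lin_ext (\<psi> p m) h))"
  have "strict_Fin_fan (FT X) (\<P> \<times> UNIV) (\<lambda>i. {g i})"
  proof (rule strict_Fin_fanI[where u = u and y = 0])
    fix i assume i: "i \<in> \<P> \<times> (UNIV :: nat set)"
    then obtain p m where pm: "i = (p, m)" "p \<in> \<P>" by blast
    have k1: "Poly_Mapping.keys (frag_of (d p m) - frag_of x) \<subseteq> topspace X"
      using keys_diff[of "frag_of (d p m)" "frag_of x"] dX[OF pm(2)] x(1) by auto
    have k2: "Poly_Mapping.keys (frag_cmul (int (n p)) (frag_of (s m) - frag_of l)) \<subseteq> topspace X"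
      using keys_cmul[of "int (n p)" "frag_of (s m) - frag_of l"] keys_diff[of "frag_of (s m)" "frag_of l"] sX[of m] lX by auto
    show "g i \<in> topspace (FT X)"
      using keys_add[of "frag_of (d p m) - frag_of x" "frag_cmul (int (n p)) (frag_of (s m) - frag_of l)"] k1 k2
      by (auto simp: g_def pm(1))
    show "continuous_map (FT X) euclideanreal (u i)" unfolding u_def pm(1) case_prod_conv
      using continuous_map_lin_ext[OF \<phi>(1)[of m]] continuous_map_lin_ext[OF \<psi>(1)[OF pm(2), of m]]
      by (intro continuous_intros) auto
    have q: "y \<in> topspace X - W p m" if "y \<in> Q" for y
      using that W(4)[OF pm(2), of m] compactin_subset_topspace[OF Q] by blast
    have "\<psi> p m y = 0" if "y \<in> Q" for y using \<psi>(3)[OF pm(2) q[OF that]] .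
    then have "\<psi> p m x = 0" "\<psi> p m l = 0" "\<psi> p m (s m) = 0" by (simp_all add: Q_def)
    then have 1: "lin_ext (\<psi> p m) (g i) = 1"
      by (simp add: g_def pm(1) lin_ext_add lin_ext_diff lin_ext_cmul \<psi>(2)[OF pm(2)])
    have "lin_ext (\<phi> m) (g i) = \<phi> m (d p m) - \<phi> m x + real (n p)"
      by (simp add: g_def pm(1) lin_ext_add lin_ext_diff lin_ext_cmul \<phi>)
    moreover have "\<phi> m (d p m) \<ge> 0" "\<phi> m x \<le> 1" using \<phi>(3) dX[OF pm(2)] x(1) by blast+
    ultimately show "1 \<le> u i (g i)" using 1 by (simp add: u_def pm(1))
  next
    fix K assume K: "compactin (FT X) K"
    obtain C where C: "compactin X C" "\<And>h. h \<in> K \<Longrightarrow> Poly_Mapping.keys h \<subseteq> C"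
      by (rule free_group_compact_support[OF X K]) blast
    obtain B where B: "\<And>h. h \<in> K \<Longrightarrow> word_length h \<le> B"
      by (rule free_group_compact_length[OF X(1) K]) blast
    have CX: "C \<subseteq> topspace X" using C(1) by (rule compactin_subset_topspace)
    let ?I = "Sigma {p\<in>\<P>. real (n p) \<le> B + 2} (\<lambda>p. {m. W p m \<inter> C \<noteq> {}})"
    obtain N :: nat where "B + 2 \<le> real N" using real_arch_simple by blast
    then have "{p\<in>\<P>. real (n p) \<le> B + 2} \<subseteq> {p\<in>\<P>. n p \<in> {..N}}" by auto
    moreover have "finite {p\<in>\<P>. n p \<in> {..N}}"
      unfolding n_def using \<P>(1) by (intro finite_inverse_image_gen) (auto simp: inj_on_to_nat_on)
    ultimately have "finite {p\<in>\<P>. real (n p) \<le> B + 2}" by (rule finite_subset)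
    then have "finite ?I" using W(5)[OF _ C(1)] by (intro finite_SigmaI) auto
    moreover have "{i \<in> \<P> \<times> UNIV. \<exists>h\<in>K. 0 < u i h} \<subseteq> ?I"
    proof
      fix i assume "i \<in> {i \<in> \<P> \<times> UNIV. \<exists>h\<in>K. 0 < u i h}"
      then obtain p m h where i: "i = (p, m)" "p \<in> \<P>" "h \<in> K" "0 < u (p, m) h" by blast
      then have pos: "lin_ext (\<phi> m) h > real (n p) - 2" "lin_ext (\<psi> p m) h > 0" by (auto simp: u_def)
      have keys: "Poly_Mapping.keys h \<subseteq> C" by (rule C(2)[OF i(3)])
      have "\<bar>lin_ext (\<phi> m) h\<bar> \<le> word_length h"
        using \<phi>(3) keys CX by (intro lin_ext_le_word_length) (auto simp: subset_iff)
      then have "real (n p) \<le> B + 2" using pos(1) B[OF i(3)] by linarith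
      moreover obtain y where "y \<in> Poly_Mapping.keys h" "\<psi> p m y \<noteq> 0"
        using lin_ext_nonzero_keys[of "\<psi> p m" h] pos(2) by force
      moreover from this have "y \<in> W p m" using \<psi>(3)[OF i(2), of y m] keys CX by blast
      ultimately show "i \<in> ?I" using keys i by blast
    qed
    ultimately show "finite {i \<in> \<P> \<times> UNIV. \<exists>h\<in>K. 0 < u i h}" by (rule finite_subset[rotated])
  next
    fix U assume U: "openin (FT X) U" "0 \<in> U"
    obtain V where V: "openin (FT X) V" "0 \<in> V" "\<And>a b. a \<in> V \<Longrightarrow> b \<in> V \<Longrightarrow> a + b \<in> U"
      by (rule FT_zero_neighborhood[OF U]) blast
    \<comment> \<open>A fixed \<open>p\<close> suffices for accumulation: all differences with
      \<open>x\<close> of points of \<open>p\<close> lie in \<open>V\<close>, and \<open>n p\<close>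
      times the difference of \<open>s m\<close> and \<open>l\<close> lies in \<open>V\<close> for
      all large \<open>m\<close>.\<close>
    have "x \<in> {y \<in> topspace X. frag_cmul (int 1) (frag_of y - frag_of x) \<in> V}" using x(1) V(2) by simp
    then obtain p where p: "p \<in> \<P>" "p \<subseteq> {y \<in> topspace X. frag_cmul (int 1) (frag_of y - frag_of x) \<in> V}"
      using x(2)[OF frag_of_diff_neighborhood[OF V(1,2) x(1)]] by blast
    obtain N where N: "\<And>m. m \<ge> N \<Longrightarrow> frag_cmul (int (n p)) (frag_of (s m) - frag_of l) \<in> V"
      using eventually_multiple_in_neighborhood[OF V(1,2) s(1), of "n p"] unfolding eventually_sequentially by blast
    have "Pair p ` {N..} \<subseteq> {i \<in> \<P> \<times> UNIV. g i \<in> U}"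
    proof (rule image_subsetI)
      fix m assume "m \<in> {N..}"
      then have "frag_cmul (int (n p)) (frag_of (s m) - frag_of l) \<in> V" using N by simp
      moreover have "frag_of (d p m) - frag_of x \<in> V" using p(2) W(3)[OF p(1), of m] by auto
      ultimately have "g (p, m) \<in> U" using V(3) by (simp add: g_def)
      then show "(p, m) \<in> {i \<in> \<P> \<times> UNIV. g i \<in> U}" using p(1) by simp
    qed
    moreover have "infinite (Pair p ` {N..})" by (simp add: finite_image_iff inj_on_def infinite_Ici)
    ultimately show "infinite {i \<in> \<P> \<times> UNIV. g i \<in> U}" using infinite_super by blast
  qed simp
  then show ?thesis by blast
qed

section \<open>The first uncountable ordinal\<close>

lemma cardSuc_natLeq_Card_order: "Card_order (cardSuc natLeq)"
  by (rule cardSuc_Card_order[OF natLeq_Card_order])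

lemma omega_1_ordIso: "|omega_1| =o cardSuc natLeq"
  unfolding omega_1_def by (rule card_of_Field_ordIso[OF cardSuc_natLeq_Card_order])

lemma uncountable_omega_1: "uncountable omega_1"
proof
  assume "countable omega_1"
  then have "|omega_1| \<le>o natLeq" by (simp add: countable_card_le_natLeq)
  then have "cardSuc natLeq \<le>o natLeq" using omega_1_ordIso ordIso_symmetric ordIso_ordLeq_trans by blast
  then show False using cardSuc_greater[OF natLeq_Card_order] not_ordLess_ordLeq by blast
qed

lemma countable_underS_omega_1:
  assumes "\<beta> \<in> omega_1"
  shows "countable (underS (cardSuc natLeq) \<beta>)"
proof -
  have "|underS (cardSuc natLeq) \<beta>| <o cardSuc natLeq"
    using card_of_underS[OF cardSuc_natLeq_Card_order] assms by (simp add: omega_1_def)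
  then show ?thesis
    unfolding countable_card_le_natLeq using cardSuc_ordLeq_ordLess[OF natLeq_Card_order card_of_Card_order] by blast
qed

lemma countable_ordLeq_omega_1:
  assumes "countable A"
  shows "|A| \<le>o |omega_1|"
proof -
  have "|A| \<le>o natLeq" using assms by (simp add: countable_card_le_natLeq)
  then have "|A| \<le>o cardSuc natLeq" using cardSuc_ordLeq[OF natLeq_Card_order] ordLeq_transitive by blast
  then show ?thesis using ordIso_symmetric[OF omega_1_ordIso] ordLeq_ordIso_trans by blast
qed

lemma uncountable_omega_1_ordLeq:
  assumes "uncountable A"
  shows "|omega_1| \<le>o |A|"
proof -
  have "\<not> |A| \<le>o natLeq" using assms by (simp add: countable_card_le_natLeq)
  then have "natLeq <o |A|"
    using not_ordLeq_iff_ordLess[of natLeq "|A|"] card_of_Well_order natLeq_Card_order card_order_on_well_order_on by blast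
  then have "cardSuc natLeq \<le>o |A|" using cardSuc_ordLess_ordLeq[OF natLeq_Card_order card_of_Card_order] by blast
  then show ?thesis using omega_1_ordIso ordIso_ordLeq_trans by blast
qed

section \<open>Fans indexed by pairs of countable ordinals\<close>

definition omega_1_pairs :: "(nat set \<times> nat set) set" where
  "omega_1_pairs = {(\<alpha>, \<beta>). \<beta> \<in> omega_1 \<and> \<alpha> \<in> underS (cardSuc natLeq) \<beta>}"

lemma omega_1_pairsD:
  assumes "(\<alpha>, \<beta>) \<in> omega_1_pairs"
  shows "\<alpha> \<in> omega_1" "\<beta> \<in> omega_1" "\<alpha> \<noteq> \<beta>"
  using assms unfolding omega_1_pairs_def underS_def omega_1_def Field_def by auto

lemma omega_1_pairs_ordLeq: "|omega_1_pairs| \<le>o |omega_1|"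
proof -
  have inf: "infinite omega_1" using uncountable_omega_1 countable_finite by blast
  have "omega_1_pairs \<subseteq> omega_1 \<times> omega_1" using omega_1_pairsD by fast
  then have "|omega_1_pairs| \<le>o |omega_1 \<times> omega_1|" by (rule card_of_mono1)
  then show ?thesis using card_of_Times_same_infinite[OF inf] ordLeq_ordIso_trans by blast
qed

text \<open>Otherwise counting the predecessors within \<open>A\<close> would be an injection of
  \<open>A\<close> into the natural numbers.\<close>

lemma uncountable_subset_omega_1_infinite_underS:
  assumes A: "A \<subseteq> omega_1" "uncountable A"
  shows "\<exists>\<beta>\<in>A. infinite (A \<inter> underS (cardSuc natLeq) \<beta>)"
proof (rule ccontr)
  let ?r = "cardSuc natLeq"
  assume "\<not> (\<exists>\<beta>\<in>A. infinite (A \<inter> underS ?r \<beta>))"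
  then have fin: "finite (A \<inter> underS ?r \<beta>)" if "\<beta> \<in> A" for \<beta> using that by blast
  interpret wo: wo_rel ?r
    using cardSuc_natLeq_Card_order card_order_on_well_order_on unfolding wo_rel_def by blast
  have less: "card (A \<inter> underS ?r \<alpha>) < card (A \<inter> underS ?r \<beta>)" if "\<alpha> \<in> A" "\<beta> \<in> A" "\<alpha> \<noteq> \<beta>" "(\<alpha>, \<beta>) \<in> ?r" for \<alpha> \<beta>
  proof (rule psubset_card_mono[OF fin[OF that(2)]])
    have "\<alpha> \<in> A \<inter> underS ?r \<beta>" "\<alpha> \<notin> underS ?r \<alpha>" using that by (auto simp: underS_def)
    moreover have "underS ?r \<alpha> \<subseteq> underS ?r \<beta>"
      using wo.TRANS wo.ANTISYM that(3,4) unfolding underS_def trans_def antisym_def by blast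
    ultimately show "A \<inter> underS ?r \<alpha> \<subset> A \<inter> underS ?r \<beta>" by blast
  qed
  have "inj_on (\<lambda>\<beta>. card (A \<inter> underS ?r \<beta>)) A"
  proof (rule inj_onI, rule ccontr)
    fix \<alpha> \<beta> assume *: "\<alpha> \<in> A" "\<beta> \<in> A" "card (A \<inter> underS ?r \<alpha>) = card (A \<inter> underS ?r \<beta>)" "\<alpha> \<noteq> \<beta>"
    then have "(\<alpha>, \<beta>) \<in> ?r \<or> (\<beta>, \<alpha>) \<in> ?r"
      using wo.TOTAL A(1) unfolding omega_1_def total_on_def by blast
    then show False using less[of \<alpha> \<beta>] less[of \<beta> \<alpha>] * by auto
  qed
  then have "countable A" by (rule countableI)
  then show False using A(2) by simp
qed

text \<open>The injections of the initial segments of \<open>\<omega>\<^sub>1\<close> into the natural numbers make the family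
  meet every neighborhood of zero infinitely often, by a pigeonhole argument. The coefficients 2 and 3
  prevent cancellation between the two summands.\<close>

definition pair_element :: "(nat set \<Rightarrow> nat \<Rightarrow> 'a) \<Rightarrow> (nat set \<Rightarrow> 'a) \<Rightarrow> nat set \<times> nat set \<Rightarrow> 'a \<Rightarrow>\<^sub>0 int" where
  "pair_element s l = (\<lambda>(\<alpha>, \<beta>). let n = to_nat_on (underS (cardSuc natLeq) \<beta>) \<alpha> in
     frag_cmul (int 2) (frag_of (s \<alpha> n) - frag_of (l \<alpha>)) + frag_cmul (int 3) (frag_of (s \<beta> n) - frag_of (l \<beta>)))"

text \<open>Let \<open>N \<alpha>\<close> be the index from which both multiples for
  \<open>\<alpha>\<close> stay in \<open>V\<close>. Some value \<open>k\<close> is taken uncountably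
  often, and some \<open>\<beta>\<close> with this value has infinitely many predecessors with the
  same value. The numbering of the predecessors of \<open>\<beta>\<close> is injective, so it is at
  least \<open>k\<close> on all but finitely many of them, and each such pair gives an element of
  \<open>V + V\<close>.\<close>

lemma infinite_pair_elements_near_zero:
  assumes s: "\<And>\<alpha>. \<alpha> \<in> omega_1 \<Longrightarrow> limitin X (s \<alpha>) (l \<alpha>) sequentially"
    and U: "openin (FT X) U" "0 \<in> U"
  shows "infinite {i \<in> omega_1_pairs. pair_element s l i \<in> U}"
proof -
  obtain V where V: "openin (FT X) V" "0 \<in> V" "\<And>a b. a \<in> V \<Longrightarrow> b \<in> V \<Longrightarrow> a + b \<in> U"
    by (rule FT_zero_neighborhood[OF U]) blast
  have "\<forall>\<alpha>\<in>omega_1. \<exists>N. \<forall>n\<ge>N. frag_cmul (int 2) (frag_of (s \<alpha> n) - frag_of (l \<alpha>)) \<in> V \<and>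
      frag_cmul (int 3) (frag_of (s \<alpha> n) - frag_of (l \<alpha>)) \<in> V"
  proof
    fix \<alpha> assume "\<alpha> \<in> omega_1"
    note ev = eventually_multiple_in_neighborhood[OF V(1,2) s[OF this]]
    show "\<exists>N. \<forall>n\<ge>N. frag_cmul (int 2) (frag_of (s \<alpha> n) - frag_of (l \<alpha>)) \<in> V \<and>
      frag_cmul (int 3) (frag_of (s \<alpha> n) - frag_of (l \<alpha>)) \<in> V"
      unfolding eventually_sequentially[symmetric] by (rule eventually_conj[OF ev ev])
  qed
  from bchoice[OF this] obtain N where N: "\<forall>\<alpha>\<in>omega_1. \<forall>n\<ge>N \<alpha>. frag_cmul (int 2) (frag_of (s \<alpha> n) - frag_of (l \<alpha>)) \<in> V \<and>
      frag_cmul (int 3) (frag_of (s \<alpha> n) - frag_of (l \<alpha>)) \<in> V" ..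
  have "omega_1 = (\<Union>k. {\<alpha>\<in>omega_1. N \<alpha> = k})" by blast
  then have "uncountable (\<Union>k. {\<alpha>\<in>omega_1. N \<alpha> = k})" using uncountable_omega_1 by simp
  then obtain k where k: "uncountable {\<alpha>\<in>omega_1. N \<alpha> = k}" by (meson countable_UN uncountable_def countableI_type)
  let ?A = "{\<alpha>\<in>omega_1. N \<alpha> = k}"
  obtain \<beta> where \<beta>: "\<beta> \<in> ?A" "infinite (?A \<inter> underS (cardSuc natLeq) \<beta>)"
    using uncountable_subset_omega_1_infinite_underS[OF _ k] by blast
  let ?S = "underS (cardSuc natLeq) \<beta>"
  have inj: "inj_on (to_nat_on ?S) ?S" using countable_underS_omega_1 \<beta>(1) by (intro inj_on_to_nat_on) blast
  have "finite {\<alpha>\<in>?S. to_nat_on ?S \<alpha> \<in> {..<k}}"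
    by (rule finite_inverse_image_gen[OF _ inj]) simp
  then have "infinite (?A \<inter> ?S - {\<alpha>\<in>?S. to_nat_on ?S \<alpha> \<in> {..<k}})" using \<beta>(2) by (rule Diff_infinite_finite)
  then have "infinite ((\<lambda>\<alpha>. (\<alpha>, \<beta>)) ` (?A \<inter> ?S - {\<alpha>\<in>?S. to_nat_on ?S \<alpha> \<in> {..<k}}))"
    by (simp add: finite_image_iff inj_on_def)
  moreover have "(\<lambda>\<alpha>. (\<alpha>, \<beta>)) ` (?A \<inter> ?S - {\<alpha>\<in>?S. to_nat_on ?S \<alpha> \<in> {..<k}}) \<subseteq> {i \<in> omega_1_pairs. pair_element s l i \<in> U}"
  proof (rule image_subsetI)
    fix \<alpha> assume \<alpha>: "\<alpha> \<in> ?A \<inter> ?S - {\<alpha>\<in>?S. to_nat_on ?S \<alpha> \<in> {..<k}}"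
    then have "(\<alpha>, \<beta>) \<in> omega_1_pairs" using \<beta>(1) by (simp add: omega_1_pairs_def)
    moreover have "to_nat_on ?S \<alpha> \<ge> N \<alpha>" "to_nat_on ?S \<alpha> \<ge> N \<beta>" using \<alpha> \<beta>(1) by auto
    then have "pair_element s l (\<alpha>, \<beta>) \<in> U" unfolding pair_element_def Let_def case_prod_conv
      using N \<alpha> \<beta>(1) by (intro V(3)) blast+
    ultimately show "(\<alpha>, \<beta>) \<in> {i \<in> omega_1_pairs. pair_element s l i \<in> U}" by blast
  qed
  ultimately show ?thesis using infinite_super by blast
qed

lemma pair_element_in_FT:
  assumes "\<And>\<alpha>. \<alpha> \<in> omega_1 \<Longrightarrow> limitin X (s \<alpha>) (l \<alpha>) sequentially \<and> range (s \<alpha>) \<subseteq> topspace X" "i \<in> omega_1_pairs"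
  shows "pair_element s l i \<in> topspace (FT X)"
proof -
  obtain \<alpha> \<beta> where i: "i = (\<alpha>, \<beta>)" "(\<alpha>, \<beta>) \<in> omega_1_pairs" using assms(2) by (cases i) auto
  let ?n = "to_nat_on (underS (cardSuc natLeq) \<beta>) \<alpha>"
  have X: "s \<gamma> n \<in> topspace X" "l \<gamma> \<in> topspace X" if "\<gamma> \<in> omega_1" for \<gamma> n
    using assms(1)[OF that] by (auto dest: limitin_topspace)
  have k: "Poly_Mapping.keys (frag_cmul k (frag_of (s \<gamma> n) - frag_of (l \<gamma>))) \<subseteq> topspace X" if "\<gamma> \<in> omega_1" for k \<gamma> n
    using keys_cmul[of k "frag_of (s \<gamma> n) - frag_of (l \<gamma>)"] keys_diff[of "frag_of (s \<gamma> n)" "frag_of (l \<gamma>)"] X[OF that] by auto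
  show ?thesis unfolding i(1) pair_element_def Let_def case_prod_conv in_topspace_FT
    using keys_add k[OF omega_1_pairsD(1)[OF i(2)]] k[OF omega_1_pairsD(2)[OF i(2)]] by (meson Un_least subset_trans)
qed

text \<open>An element of a compact set has its support in a compact \<open>C\<close>. Since both
  \<open>s \<alpha> n\<close> and \<open>s \<beta> n\<close> survive in the support, both indices
  belong to the finite set of sequences meeting \<open>C\<close>.\<close>

lemma omega_1_sequences_Fin_fan:
  assumes X: "Tychonoff_space X" "mu_complete_space X"
    and s: "\<And>\<alpha>. \<alpha> \<in> omega_1 \<Longrightarrow> limitin X (s \<alpha>) (l \<alpha>) sequentially \<and> range (s \<alpha>) \<subseteq> topspace X"
    and ne: "\<And>\<alpha> n. \<alpha> \<in> omega_1 \<Longrightarrow> s \<alpha> n \<noteq> l \<alpha>"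
    and disj: "\<And>\<alpha> \<beta>. \<alpha> \<in> omega_1 \<Longrightarrow> \<beta> \<in> omega_1 \<Longrightarrow> \<alpha> \<noteq> \<beta> \<Longrightarrow> range (s \<alpha>) \<inter> range (s \<beta>) = {}"
    and cf: "\<And>C. compactin X C \<Longrightarrow> finite {\<alpha>\<in>omega_1. range (s \<alpha>) \<inter> C \<noteq> {}}"
  shows "\<exists>F. Fin_fan (FT X) omega_1_pairs F"
proof -
  have "Fin_fan (FT X) omega_1_pairs (\<lambda>i. {pair_element s l i})"
    unfolding Fin_fan_def compact_finite_family_def
  proof (intro conjI ballI allI impI)
    fix i assume "i \<in> omega_1_pairs"
    then show "{pair_element s l i} \<subseteq> topspace (FT X)" using pair_element_in_FT[OF s] by simp
  next
    fix K assume K: "compactin (FT X) K"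
    obtain C where C: "compactin X C" "\<And>h. h \<in> K \<Longrightarrow> Poly_Mapping.keys h \<subseteq> C"
      by (rule free_group_compact_support[OF X K]) blast
    let ?A = "{\<alpha>\<in>omega_1. range (s \<alpha>) \<inter> C \<noteq> {}}"
    have "{i \<in> omega_1_pairs. {pair_element s l i} \<inter> K \<noteq> {}} \<subseteq> ?A \<times> ?A"
    proof
      fix i assume i: "i \<in> {i \<in> omega_1_pairs. {pair_element s l i} \<inter> K \<noteq> {}}"
      then obtain \<alpha> \<beta> where ab: "i = (\<alpha>, \<beta>)" "(\<alpha>, \<beta>) \<in> omega_1_pairs" by (cases i) auto
      note p = omega_1_pairsD[OF ab(2)]
      define n where "n = to_nat_on (underS (cardSuc natLeq) \<beta>) \<alpha>"
      have keys: "Poly_Mapping.keys (pair_element s l (\<alpha>, \<beta>)) \<subseteq> C" using i ab C(2) by auto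
      have "s \<alpha> n \<noteq> s \<beta> n" using disj[OF p] by blast
      moreover have "s \<alpha> n \<noteq> l \<alpha>" "s \<beta> n \<noteq> l \<beta>" using ne p by blast+
      \<comment> \<open>The possible coincidences left are \<open>s \<alpha> n = l \<beta>\<close>
        and \<open>s \<beta> n = l \<alpha>\<close>; they change the coefficients to 2 - 3 and 3 -
        2, which are nonzero.\<close>
      ultimately have "Poly_Mapping.lookup (pair_element s l (\<alpha>, \<beta>)) (s \<alpha> n) \<noteq> 0"
        "Poly_Mapping.lookup (pair_element s l (\<alpha>, \<beta>)) (s \<beta> n) \<noteq> 0"
        unfolding pair_element_def Let_def case_prod_conv n_def[symmetric] lookup_add lookup_frag_cmul lookup_minus
        by (auto simp: lookup_single when_def)
      then have "s \<alpha> n \<in> C" "s \<beta> n \<in> C" using keys by (auto simp: in_keys_iff)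
      then show "i \<in> ?A \<times> ?A" using ab p by blast
    qed
    moreover have "finite (?A \<times> ?A)" using cf[OF C(1)] by simp
    ultimately show "finite {i \<in> omega_1_pairs. {pair_element s l i} \<inter> K \<noteq> {}}" by (rule finite_subset)
  next
    show "\<not> locally_finite_family (FT X) omega_1_pairs (\<lambda>i. {pair_element s l i})"
      unfolding locally_finite_family_def
    proof
      assume "\<forall>y\<in>topspace (FT X). \<exists>U. openin (FT X) U \<and> y \<in> U \<and> finite {\<alpha> \<in> omega_1_pairs. {pair_element s l \<alpha>} \<inter> U \<noteq> {}}"
      moreover have "0 \<in> topspace (FT X)" by simp
      ultimately obtain U where "openin (FT X) U" "0 \<in> U" "finite {\<alpha> \<in> omega_1_pairs. {pair_element s l \<alpha>} \<inter> U \<noteq> {}}" by blast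
      then show False using infinite_pair_elements_near_zero[where X = X and s = s and l = l and U = U] s by simp
    qed
  qed simp
  then show ?thesis by blast
qed

text \<open>With disjoint open sets \<open>P \<alpha>\<close> there are bump functions at the terms
  of each sequence that vanish on the points of all others. The minimum of the two functionals takes
  the value \<open>min 2 3\<close> on a pair element, and where it is positive the support meets
  both \<open>P \<alpha>\<close> and \<open>P \<beta>\<close>.\<close>

lemma omega_1_sequences_strict_Fin_fan:
  assumes X: "Tychonoff_space X" "mu_complete_space X"
    and s: "\<And>\<alpha>. \<alpha> \<in> omega_1 \<Longrightarrow> limitin X (s \<alpha>) (l \<alpha>) sequentially \<and> range (s \<alpha>) \<subseteq> topspace X"
    and ne: "\<And>\<alpha> n. \<alpha> \<in> omega_1 \<Longrightarrow> s \<alpha> n \<noteq> l \<alpha>"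
    and P: "\<And>\<alpha>. \<alpha> \<in> omega_1 \<Longrightarrow> openin X (P \<alpha>) \<and> range (s \<alpha>) \<subseteq> P \<alpha> \<and> l \<alpha> \<in> P \<alpha>"
    and disj: "\<And>\<alpha> \<beta>. \<alpha> \<in> omega_1 \<Longrightarrow> \<beta> \<in> omega_1 \<Longrightarrow> \<alpha> \<noteq> \<beta> \<Longrightarrow> P \<alpha> \<inter> P \<beta> = {}"
    and cf: "\<And>C. compactin X C \<Longrightarrow> finite {\<alpha>\<in>omega_1. P \<alpha> \<inter> C \<noteq> {}}"
  shows "\<exists>F. strict_Fin_fan (FT X) omega_1_pairs F"
proof -
  have sP: "s \<alpha> n \<in> P \<alpha>" "l \<alpha> \<in> P \<alpha>" "P \<alpha> \<subseteq> topspace X" if "\<alpha> \<in> omega_1" for \<alpha> n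
    using P[OF that] openin_subset by blast+
  \<comment> \<open>The limit is removed so that the bump functions vanish there; otherwise the
    contributions of the term and of its limit could cancel.\<close>
  have op: "openin X (P \<alpha> - {l \<alpha>})" if "\<alpha> \<in> omega_1" for \<alpha>
    using X(1) P[OF that] by (simp add: Tychonoff_space_def t1_space_openin_delete_alt)
  have "\<exists>f. continuous_map X euclideanreal f \<and> f (s \<alpha> n) = 1 \<and> (\<forall>y\<in>topspace X - (P \<alpha> - {l \<alpha>}). f y = 0)"
    if "\<alpha> \<in> omega_1" for \<alpha> n
    using Tychonoff_separation[OF X(1) op[OF that], of "s \<alpha> n"] sP(1)[OF that] ne[OF that] by (metis DiffI singletonD)
  then have "\<forall>\<alpha>\<in>omega_1. \<forall>n. \<exists>f. continuous_map X euclideanreal f \<and> f (s \<alpha> n) = (1::real) \<and> (\<forall>y\<in>topspace X - (P \<alpha> - {l \<alpha>}). f y = 0)" by blast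
  then have "\<forall>\<alpha>\<in>omega_1. \<exists>f. \<forall>n. continuous_map X euclideanreal (f n) \<and> f n (s \<alpha> n) = (1::real) \<and> (\<forall>y\<in>topspace X - (P \<alpha> - {l \<alpha>}). f n y = 0)" by metis
  from bchoice[OF this] obtain \<psi> where \<psi>': "\<forall>\<alpha>\<in>omega_1. \<forall>n. continuous_map X euclideanreal (\<psi> \<alpha> n) \<and> \<psi> \<alpha> n (s \<alpha> n) = (1::real) \<and> (\<forall>y\<in>topspace X - (P \<alpha> - {l \<alpha>}). \<psi> \<alpha> n y = 0)" ..
  have \<psi>: "continuous_map X euclideanreal (\<psi> \<alpha> n)" "\<psi> \<alpha> n (s \<alpha> n) = 1" "\<psi> \<alpha> n (l \<alpha>) = 0"
    "\<And>y. y \<in> topspace X \<Longrightarrow> y \<notin> P \<alpha> \<Longrightarrow> \<psi> \<alpha> n y = 0" if "\<alpha> \<in> omega_1" for \<alpha> n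
    using \<psi>'[rule_format, OF that, of n] sP(2,3)[OF that] by auto
  define u where "u = (\<lambda>(\<alpha>,\<beta>) h. let n = to_nat_on (underS (cardSuc natLeq) \<beta>) \<alpha> in
    min (lin_ext (\<psi> \<alpha> n) h) (lin_ext (\<psi> \<beta> n) h))"
  have "strict_Fin_fan (FT X) omega_1_pairs (\<lambda>i. {pair_element s l i})"
  proof (rule strict_Fin_fanI[where u = u and y = 0])
    fix i assume i: "i \<in> omega_1_pairs"
    then show "pair_element s l i \<in> topspace (FT X)" using pair_element_in_FT[OF s] by simp
    obtain \<alpha> \<beta> where ab: "i = (\<alpha>, \<beta>)" "(\<alpha>, \<beta>) \<in> omega_1_pairs" using i by (cases i) auto
    note p = omega_1_pairsD[OF ab(2)]
    define n where "n = to_nat_on (underS (cardSuc natLeq) \<beta>) \<alpha>"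
    show "continuous_map (FT X) euclideanreal (u i)" unfolding u_def ab(1) case_prod_conv Let_def
      by (intro continuous_map_real_min continuous_map_lin_ext \<psi>(1) p)
    have "P \<alpha> \<inter> P \<beta> = {}" by (rule disj[OF p])
    then have "\<psi> \<alpha> n (s \<beta> n) = 0" "\<psi> \<alpha> n (l \<beta>) = 0" "\<psi> \<beta> n (s \<alpha> n) = 0" "\<psi> \<beta> n (l \<alpha>) = 0"
      using sP(1)[OF p(1), of n] sP(2,3)[OF p(1)] sP(1)[OF p(2), of n] sP(2,3)[OF p(2)] by (auto intro!: \<psi>(4)[OF p(1)] \<psi>(4)[OF p(2)])
    then show "1 \<le> u i (pair_element s l i)"
      using \<psi>(2,3)[OF p(1)] \<psi>(2,3)[OF p(2)]
      unfolding u_def pair_element_def ab(1) case_prod_conv Let_def n_def[symmetric]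
      by (simp add: lin_ext_add lin_ext_diff lin_ext_cmul)
  next
    fix K assume K: "compactin (FT X) K"
    obtain C where C: "compactin X C" "\<And>h. h \<in> K \<Longrightarrow> Poly_Mapping.keys h \<subseteq> C"
      by (rule free_group_compact_support[OF X K]) blast
    have CX: "C \<subseteq> topspace X" using C(1) by (rule compactin_subset_topspace)
    let ?A = "{\<alpha>\<in>omega_1. P \<alpha> \<inter> C \<noteq> {}}"
    have meets: "\<gamma> \<in> ?A" if h: "\<gamma> \<in> omega_1" "h \<in> K" "lin_ext (\<psi> \<gamma> n) h > 0" for \<gamma> h n
    proof -
      obtain y where y: "y \<in> Poly_Mapping.keys h" "\<psi> \<gamma> n y \<noteq> 0"
        using lin_ext_nonzero_keys[of "\<psi> \<gamma> n" h] h(3) by force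
      then have "y \<in> C" using C(2)[OF that(2)] by blast
      then have "y \<in> P \<gamma>" using \<psi>(4)[OF that(1), of y n] y(2) CX by blast
      then show ?thesis using \<open>y \<in> C\<close> that(1) by blast
    qed
    have "{i \<in> omega_1_pairs. \<exists>h\<in>K. 0 < u i h} \<subseteq> ?A \<times> ?A"
    proof
      fix i assume "i \<in> {i \<in> omega_1_pairs. \<exists>h\<in>K. 0 < u i h}"
      then obtain \<alpha> \<beta> h where ab: "i = (\<alpha>, \<beta>)" "(\<alpha>, \<beta>) \<in> omega_1_pairs" "h \<in> K" "0 < u (\<alpha>, \<beta>) h" by (cases i) auto
      note p = omega_1_pairsD[OF ab(2)]
      have "\<alpha> \<in> ?A" "\<beta> \<in> ?A" using ab(4) meets[OF p(1) ab(3)] meets[OF p(2) ab(3)] by (auto simp: u_def Let_def)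
      then show "i \<in> ?A \<times> ?A" using ab(1) by blast
    qed
    moreover have "finite (?A \<times> ?A)" using cf[OF C(1)] by simp
    ultimately show "finite {i \<in> omega_1_pairs. \<exists>h\<in>K. 0 < u i h}" by (rule finite_subset)
  next
    fix U assume "openin (FT X) U" "0 \<in> U"
    then show "infinite {i \<in> omega_1_pairs. pair_element s l i \<in> U}"
      using infinite_pair_elements_near_zero[where X = X and s = s and l = l and U = U] s by blast
  qed simp
  then show ?thesis by blast
qed

section \<open>Spaces with a compact-countable \<open>k\<close>-network\<close>

definition nontrivial_sequence :: "'a topology \<Rightarrow> (nat \<Rightarrow> 'a) \<Rightarrow> 'a \<Rightarrow> bool" where
  "nontrivial_sequence X s l \<longleftrightarrow> limitin X s l sequentially \<and> range s \<subseteq> topspace X \<and> (\<forall>n. s n \<noteq> l)"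

lemma nontrivial_sequence_subseq:
  assumes "nontrivial_sequence X s l" "strict_mono r"
  shows "nontrivial_sequence X (s \<circ> r) l"
  using assms limitin_subsequence[OF assms(2), of X s l] unfolding nontrivial_sequence_def by auto

text \<open>The \<open>k\<^sub>\<real>\<close>-property is applied to the characteristic function of
  \<open>A\<close>, which is continuous on \<open>L\<close> exactly because \<open>A\<close> splits
  \<open>L\<close> into two closed pieces.\<close>

lemma k_real_space_clopenI:
  assumes X: "k_real_space X" and A: "A \<subseteq> topspace X"
    and L: "\<And>L. compactin X L \<Longrightarrow> closedin (subtopology X L) (L \<inter> A) \<and> closedin (subtopology X L) (L - A)"
  shows "openin X A \<and> closedin X A"
proof -
  define f where "f x = (if x \<in> A then 1 else 0 :: real)" for x
  have "continuous_map (subtopology X K) euclideanreal f" if K: "compactin X K" for K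
    unfolding continuous_map_closedin
  proof (intro conjI allI impI)
    fix T :: "real set"
    have "topspace (subtopology X K) = K" using compactin_subset_topspace[OF K] by auto
    then have "{x \<in> topspace (subtopology X K). f x \<in> T} = (if 1 \<in> T then K \<inter> A else {}) \<union> (if 0 \<in> T then K - A else {})"
      by (auto simp: f_def)
    then show "closedin (subtopology X K) {x \<in> topspace (subtopology X K). f x \<in> T}" using L[OF K] by auto
  qed auto
  then have f: "continuous_map X euclideanreal f" using X unfolding k_real_space_def by blast
  have "openin X {x \<in> topspace X. f x \<in> {1/2<..}}" using f by (rule openin_continuous_map_preimage) simp
  moreover have "closedin X {x \<in> topspace X. f x \<in> {1/2..}}" using f by (rule closedin_continuous_map_preimage) simp
  moreover have "{x \<in> topspace X. f x \<in> {1/2<..}} = A" "{x \<in> topspace X. f x \<in> {1/2..}} = A"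
    using A by (auto simp: f_def)
  ultimately show ?thesis by simp
qed

locale k_network_space =
  fixes X :: "'a topology" and \<N> :: "'a set set"
  assumes Tychonoff: "Tychonoff_space X" and mu_complete: "mu_complete_space X" and k_real: "k_real_space X"
    and k_network: "k_network_in X \<N>" and compact_countable: "compact_countable_in X \<N>"
begin

lemma Hausdorff: "Hausdorff_space X"
  by (rule Tychonoff_imp_Hausdorff[OF Tychonoff])

text \<open>For clopen sets \<open>X\<close> behaves like a sequential space: the two pieces of each
  compact set are tested for closedness by sequences, and \<open>1\<close> and \<open>2\<close> say
  that no sequence crosses between \<open>A\<close> and its complement.\<close>

lemma sequential_clopenI:
  assumes A: "A \<subseteq> topspace X"
    and 1: "\<And>s l. nontrivial_sequence X s l \<Longrightarrow> range s \<subseteq> A \<Longrightarrow> l \<in> A"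
    and 2: "\<And>s l. nontrivial_sequence X s l \<Longrightarrow> range s \<inter> A = {} \<Longrightarrow> l \<notin> A"
  shows "openin X A \<and> closedin X A"
proof (rule k_real_space_clopenI[OF k_real A], intro conjI)
  fix L assume L: "compactin X L"
  have LX: "L \<subseteq> topspace X" by (rule compactin_subset_topspace[OF L])
  show "closedin (subtopology X L) (L \<inter> A)"
  proof (rule ccontr)
    assume "\<not> closedin (subtopology X L) (L \<inter> A)"
    then obtain s l where s: "range s \<subseteq> L \<inter> A" "l \<in> L - L \<inter> A" "limitin X s l sequentially"
      by (rule not_closedin_compact_sequence[OF Hausdorff k_network compact_countable L Int_lower1])
    then have "nontrivial_sequence X s l" using LX unfolding nontrivial_sequence_def by blast
    then show False using 1[of s l] s by blast
  qed
  show "closedin (subtopology X L) (L - A)"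
  proof (rule ccontr)
    assume "\<not> closedin (subtopology X L) (L - A)"
    then obtain s l where s: "range s \<subseteq> L - A" "l \<in> L - (L - A)" "limitin X s l sequentially"
      by (rule not_closedin_compact_sequence[OF Hausdorff k_network compact_countable L Diff_subset])
    then have "nontrivial_sequence X s l" using LX unfolding nontrivial_sequence_def by blast
    then show False using 2[of s l] s by blast
  qed
qed

definition relcompact_members :: "'a set set" where
  "relcompact_members = {N\<in>\<N>. compactin X (X closure_of N)}"

text \<open>Only countably many members with noncompact closure meet \<open>K\<close>. If every
  neighborhood of some point of \<open>K\<close> contained one of them, there would be a strict fan,
  with \<open>s\<close> supplying the growing lengths. So each \<open>x\<close> in \<open>K\<close>
  has a neighborhood \<open>V x\<close> containing none, and the network is applied to finitely many
  compact pieces of \<open>K\<close> inside such neighborhoods.\<close>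

lemma relcompact_members_k_network:
  assumes no_fan: "\<not> (\<exists>F. strict_Fin_fan (FT X) omega_1 F)" and s: "nontrivial_sequence X s l"
  shows "k_network_in X relcompact_members"
  unfolding k_network_in_def
proof (intro conjI allI impI)
  show "relcompact_members \<subseteq> Pow (topspace X)" using k_network unfolding k_network_in_def relcompact_members_def by blast
  fix U K assume UK: "openin X U \<and> compactin X K \<and> K \<subseteq> U"
  define \<P> where "\<P> = {N\<in>\<N>. N \<inter> K \<noteq> {} \<and> \<not> compactin X (X closure_of N)}"
  have "\<P> \<subseteq> {N\<in>\<N>. N \<inter> K \<noteq> {}}" by (auto simp: \<P>_def)
  then have cP: "countable \<P>" using compact_countable UK unfolding compact_countable_in_def by (meson countable_subset)
  have P: "p \<subseteq> topspace X \<and> \<not> compactin X (X closure_of p)" if "p \<in> \<P>" for p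
    using that k_network unfolding \<P>_def k_network_in_def by blast
  have KX: "K \<subseteq> topspace X" using UK compactin_subset_topspace by blast
  have "\<exists>V. openin X V \<and> x \<in> V \<and> (\<forall>p\<in>\<P>. \<not> p \<subseteq> V)" if x: "x \<in> K" for x
  proof (rule ccontr)
    assume "\<not> (\<exists>V. openin X V \<and> x \<in> V \<and> (\<forall>p\<in>\<P>. \<not> p \<subseteq> V))"
    then have "\<exists>p\<in>\<P>. p \<subseteq> V" if "openin X V" "x \<in> V" for V using that by blast
    moreover have "x \<in> topspace X" using x KX by blast
    ultimately obtain F where "strict_Fin_fan (FT X) (\<P> \<times> (UNIV :: nat set)) F"
      using noncompact_sets_strict_fan[OF Tychonoff mu_complete _ _ _ cP P] s unfolding nontrivial_sequence_def by metis
    moreover have "|\<P> \<times> (UNIV :: nat set)| \<le>o |omega_1|" using cP by (intro countable_ordLeq_omega_1 countable_SIGMA) auto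
    ultimately show False using no_fan omega_1_fanI(2) by metis
  qed
  then have "\<forall>x\<in>K. \<exists>V. openin X V \<and> x \<in> V \<and> (\<forall>p\<in>\<P>. \<not> p \<subseteq> V)" by blast
  from bchoice[OF this] obtain V where V: "\<forall>x\<in>K. openin X (V x) \<and> x \<in> V x \<and> (\<forall>p\<in>\<P>. \<not> p \<subseteq> V x)" ..
  have reg: "regular_space X" using Tychonoff_imp_regular_t1[OF Tychonoff] by (simp add: regular_t1_space_def)
  have "\<forall>x\<in>K. \<exists>G. openin X G \<and> x \<in> G \<and> X closure_of G \<subseteq> V x \<inter> U"
  proof
    fix x assume x: "x \<in> K"
    have "openin X (V x \<inter> U)" "x \<in> V x \<inter> U" using V x UK by auto
    then have "\<exists>G C. openin X G \<and> closedin X C \<and> x \<in> G \<and> G \<subseteq> C \<and> C \<subseteq> V x \<inter> U"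
      using reg unfolding neighbourhood_base_of_closedin[symmetric] neighbourhood_base_of by blast
    then show "\<exists>G. openin X G \<and> x \<in> G \<and> X closure_of G \<subseteq> V x \<inter> U" by (meson closure_of_minimal subset_trans)
  qed
  from bchoice[OF this] obtain G where G: "\<forall>x\<in>K. openin X (G x) \<and> x \<in> G x \<and> X closure_of (G x) \<subseteq> V x \<inter> U" ..
  have "\<And>T. T \<in> G ` K \<Longrightarrow> openin X T" "K \<subseteq> \<Union>(G ` K)" using G by auto
  then obtain \<F>0 where "finite \<F>0" "\<F>0 \<subseteq> G ` K" "K \<subseteq> \<Union>\<F>0" using UK by (meson compactinD)
  then obtain I where I: "finite I" "I \<subseteq> K" "K \<subseteq> \<Union>(G ` I)" by (metis finite_subset_image)
  have "\<forall>x\<in>I. \<exists>\<F>. finite \<F> \<and> \<F> \<subseteq> \<N> \<and> K \<inter> X closure_of (G x) \<subseteq> \<Union>\<F> \<and> \<Union>\<F> \<subseteq> V x \<inter> U"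
  proof
    fix x assume x: "x \<in> I"
    have "compactin X (K \<inter> X closure_of (G x))" using UK by (intro compact_Int_closedin closedin_closure_of) auto
    moreover have "K \<inter> X closure_of (G x) \<subseteq> V x \<inter> U" "openin X (V x \<inter> U)" using G V x I(2) UK by blast+
    ultimately obtain \<F> where "finite \<F>" "\<F> \<subseteq> \<N>" "K \<inter> X closure_of (G x) \<subseteq> \<Union>\<F>" "\<Union>\<F> \<subseteq> V x \<inter> U"
      by (metis k_network_inE[OF k_network])
    then show "\<exists>\<F>. finite \<F> \<and> \<F> \<subseteq> \<N> \<and> K \<inter> X closure_of (G x) \<subseteq> \<Union>\<F> \<and> \<Union>\<F> \<subseteq> V x \<inter> U" by blast
  qed
  from bchoice[OF this] obtain \<F> where \<F>: "\<forall>x\<in>I. finite (\<F> x) \<and> \<F> x \<subseteq> \<N> \<and> K \<inter> X closure_of (G x) \<subseteq> \<Union>(\<F> x) \<and> \<Union>(\<F> x) \<subseteq> V x \<inter> U" ..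
  \<comment> \<open>\<open>\<P>\<close> concerns only members meeting \<open>K\<close>; the rest
    contribute nothing to covering \<open>K\<close> and are dropped.\<close>
  let ?F = "\<Union>x\<in>I. {N\<in>\<F> x. N \<inter> K \<noteq> {}}"
  have "finite ?F" using I(1) \<F> by auto
  moreover have "?F \<subseteq> relcompact_members"
  proof
    fix N assume "N \<in> ?F"
    then obtain x where x: "x \<in> I" "N \<in> \<F> x" "N \<inter> K \<noteq> {}" by blast
    have "N \<in> \<N>" "N \<subseteq> V x" using \<F> x(1,2) by blast+
    moreover have "N \<notin> \<P>" using V x(1) I(2) \<open>N \<subseteq> V x\<close> by blast
    ultimately show "N \<in> relcompact_members" using x(3) unfolding \<P>_def relcompact_members_def by blast
  qed
  moreover have "K \<subseteq> \<Union>?F"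
  proof
    fix y assume y: "y \<in> K"
    then obtain x where x: "x \<in> I" "y \<in> G x" using I(3) by blast
    have "G x \<subseteq> X closure_of (G x)" using G x(1) I(2) by (meson closure_of_subset openin_subset subsetD)
    then have "y \<in> \<Union>(\<F> x)" using \<F> x y by blast
    then show "y \<in> \<Union>?F" using x(1) y by blast
  qed
  moreover have "\<Union>?F \<subseteq> U" using \<F> by blast
  ultimately show "\<exists>\<F>. finite \<F> \<and> \<F> \<subseteq> relcompact_members \<and> K \<subseteq> \<Union>\<F> \<and> \<Union>\<F> \<subseteq> U" by (intro exI[of _ ?F]) simp
qed

end

text \<open>Zorn's lemma gives a maximal set of sequences no two of which meet a common member. If
  it is uncountable, \<open>omega_1\<close> embeds into it; if it is countable, its terms form
  \<open>Z\<close>, and maximality links every further sequence to \<open>Z\<close> by a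
  member.\<close>

lemma maximal_separated_sequences:
  assumes cover: "topspace X \<subseteq> \<Union>\<M>"
  obtains (sequences) s l where "\<And>\<alpha>. \<alpha> \<in> omega_1 \<Longrightarrow> nontrivial_sequence X (s \<alpha>) (l \<alpha>)"
      "\<And>\<alpha> \<beta> M. \<alpha> \<in> omega_1 \<Longrightarrow> \<beta> \<in> omega_1 \<Longrightarrow> \<alpha> \<noteq> \<beta> \<Longrightarrow> M \<in> \<M> \<Longrightarrow> range (s \<alpha>) \<inter> M = {} \<or> range (s \<beta>) \<inter> M = {}"
    | (countable) Z where "countable Z" "Z \<subseteq> topspace X"
      "\<And>s l. nontrivial_sequence X s l \<Longrightarrow> \<exists>M\<in>\<M>. range s \<inter> M \<noteq> {} \<and> Z \<inter> M \<noteq> {}"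
proof -
  define S where "S = {p. nontrivial_sequence X (fst p) (snd p)}"
  define sep where "sep p q \<longleftrightarrow> (\<forall>M\<in>\<M>. range (fst p) \<inter> M = {} \<or> range (fst q) \<inter> M = {})" for p q :: "(nat \<Rightarrow> 'a) \<times> 'a"
  define \<Q> where "\<Q> = {\<A>. \<A> \<subseteq> S \<and> pairwise sep \<A>}"
  have "\<exists>\<A>\<in>\<Q>. \<forall>\<B>\<in>\<Q>. \<A> \<subseteq> \<B> \<longrightarrow> \<B> = \<A>"
  proof (rule subset_Zorn')
    fix \<C> assume \<C>: "subset.chain \<Q> \<C>"
    have "pairwise sep (\<Union>\<C>)" unfolding pairwise_def
    proof (intro ballI impI)
      fix p q assume "p \<in> \<Union>\<C>" "q \<in> \<Union>\<C>" "p \<noteq> q"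
      then obtain \<A> \<B> where AB: "\<A> \<in> \<C>" "\<B> \<in> \<C>" "p \<in> \<A>" "q \<in> \<B>" by blast
      have "\<A> \<subseteq> \<B> \<or> \<B> \<subseteq> \<A>" using \<C> AB(1,2) unfolding subset_chain_def by blast
      moreover have "\<A> \<in> \<Q>" "\<B> \<in> \<Q>" using \<C> AB(1,2) unfolding subset_chain_def by blast+
      ultimately show "sep p q" using AB(3,4) \<open>p \<noteq> q\<close> unfolding \<Q>_def pairwise_def by blast
    qed
    moreover have "\<Union>\<C> \<subseteq> S" using \<C> unfolding subset_chain_def \<Q>_def by blast
    ultimately show "\<Union>\<C> \<in> \<Q>" by (simp add: \<Q>_def)
  qed
  then obtain \<A> where \<A>: "\<A> \<in> \<Q>" "\<And>\<B>. \<B> \<in> \<Q> \<Longrightarrow> \<A> \<subseteq> \<B> \<Longrightarrow> \<B> = \<A>" by blast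
  show thesis
  proof (cases "countable \<A>")
    case True
    define Z where "Z = (\<Union>p\<in>\<A>. range (fst p))"
    show thesis
    proof (rule countable[of Z])
      show "countable Z" unfolding Z_def using True by (intro countable_UN) auto
      show "Z \<subseteq> topspace X" using \<A>(1) unfolding Z_def \<Q>_def S_def nontrivial_sequence_def by blast
      fix s l assume s: "nontrivial_sequence X s l"
      show "\<exists>M\<in>\<M>. range s \<inter> M \<noteq> {} \<and> Z \<inter> M \<noteq> {}"
      proof (cases "(s, l) \<in> \<A>")
        case True
        \<comment> \<open>A sequence already in the maximal set needs the covering: any member
          containing \<open>s 0\<close> meets both it and \<open>Z\<close>.\<close>
        have "s 0 \<in> \<Union>\<M>" using s cover unfolding nontrivial_sequence_def by blast
        then obtain M where "M \<in> \<M>" "s 0 \<in> M" by blast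
        moreover have "s 0 \<in> Z" using True unfolding Z_def by force
        ultimately show ?thesis by blast
      next
        case False
        then have "insert (s, l) \<A> \<notin> \<Q>" using \<A>(2) by blast
        moreover have "insert (s, l) \<A> \<subseteq> S" using s \<A>(1) by (auto simp: S_def \<Q>_def)
        ultimately have "\<not> pairwise sep (insert (s, l) \<A>)" by (simp add: \<Q>_def)
        moreover have "pairwise sep \<A>" using \<A>(1) by (simp add: \<Q>_def)
        ultimately obtain p where "p \<in> \<A>" "\<not> sep p (s, l) \<or> \<not> sep (s, l) p" unfolding pairwise_insert by blast
        then obtain M where "M \<in> \<M>" "range s \<inter> M \<noteq> {}" "range (fst p) \<inter> M \<noteq> {}" unfolding sep_def by auto
        then show ?thesis using \<open>p \<in> \<A>\<close> unfolding Z_def by blast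
      qed
    qed
  next
    case False
    then obtain j where j: "inj_on j omega_1" "j ` omega_1 \<subseteq> \<A>"
      using uncountable_omega_1_ordLeq[OF False] by (metis card_of_ordLeq)
    show thesis
    proof (rule sequences[of "\<lambda>\<alpha>. fst (j \<alpha>)" "\<lambda>\<alpha>. snd (j \<alpha>)"])
      fix \<alpha> assume "\<alpha> \<in> omega_1"
      then have "j \<alpha> \<in> S" using j(2) \<A>(1) unfolding \<Q>_def by blast
      then show "nontrivial_sequence X (fst (j \<alpha>)) (snd (j \<alpha>))" by (simp add: S_def)
    next
      fix \<alpha> \<beta> M assume *: "\<alpha> \<in> omega_1" "\<beta> \<in> omega_1" "\<alpha> \<noteq> \<beta>" "M \<in> \<M>"
      then have "j \<alpha> \<in> \<A>" "j \<beta> \<in> \<A>" "j \<alpha> \<noteq> j \<beta>" using j by (auto simp: inj_on_def)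
      then have "sep (j \<alpha>) (j \<beta>)" using \<A>(1) unfolding \<Q>_def pairwise_def by blast
      then show "range (fst (j \<alpha>)) \<inter> M = {} \<or> range (fst (j \<beta>)) \<inter> M = {}" using *(4) unfolding sep_def by blast
    qed
  qed
qed

text \<open>The internal form of condition (1): \<open>Y\<close> is the cosmic summand, and openness
  of every subset of the complement is discreteness of the other summand.\<close>

definition discrete_cosmic_decomposition :: "'a topology \<Rightarrow> 'a set \<Rightarrow> bool" where
  "discrete_cosmic_decomposition X Y \<longleftrightarrow> openin X Y \<and> closedin X Y \<and>
     (\<forall>A \<subseteq> topspace X - Y. openin X A) \<and>
     cosmic_space (subtopology X Y) \<and> k_omega_space (subtopology X Y)"

text \<open>A nested sequence of extensions, by Tietze's theorem, of a separating function from one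
  compact set to the next.\<close>

lemma compact_exhaustion_separation:
  assumes X: "Tychonoff_space X" and L: "\<And>n. compactin X (L n)" "incseq L"
    and F: "\<And>n::nat. closedin X (F \<inter> L n)" and x: "x \<in> L 0" "x \<notin> F"
  obtains f where "\<And>n. continuous_map X euclideanreal (f n)" "\<And>n y. y \<in> L n \<Longrightarrow> f (Suc n) y = f n y"
    "\<And>n. f n x = 0" "\<And>n y. y \<in> F \<inter> L n \<Longrightarrow> f n y = (1::real)"
proof -
  have cr: "completely_regular_space X" using X by (simp add: Tychonoff_space_def)
  have Lcl: "closedin X (L n)" for n using compactin_imp_closedin[OF Tychonoff_imp_Hausdorff[OF X] L(1)] .
  have LX: "L n \<subseteq> topspace X" for n using compactin_subset_topspace[OF L(1)] .
  have xL: "x \<in> L n" for n using x(1) L(2) by (meson le0 monoD subsetD)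
  define \<Phi> where "\<Phi> n g \<longleftrightarrow> continuous_map X euclideanreal g \<and> g x = 0 \<and> (\<forall>y\<in>F \<inter> L n. g y = 1)" for n and g :: "'a \<Rightarrow> real"
  define \<Psi> where "\<Psi> n g h \<longleftrightarrow> (\<forall>y\<in>L n. h y = g y)" for n and g h :: "'a \<Rightarrow> real"
  have "\<exists>h. \<Phi> (Suc n) h \<and> \<Psi> n g h" if g: "\<Phi> n g" for n g
  proof -
    \<comment> \<open>The two prescriptions agree on the overlap, as \<open>g\<close> is already 1
      on \<open>F \<inter> L n\<close>; both pieces are closed, so the glued function is continuous
      and Tietze's theorem applies.\<close>
    define h where "h y = (if y \<in> L n then g y else 1)" for y
    let ?S = "L n \<union> (F \<inter> L (Suc n))"
    have S: "compactin X ?S"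
      by (intro compactin_Un L(1) closed_compactin[OF L(1)[of "Suc n"] Int_lower2 F])
    have gc: "continuous_map X euclideanreal g" and g1: "\<And>y. y \<in> F \<inter> L n \<Longrightarrow> g y = 1" and gx: "g x = 0"
      using g unfolding \<Phi>_def by auto
    have "continuous_map (subtopology X ?S) euclideanreal h" unfolding continuous_map_closedin
    proof (intro conjI allI impI)
      fix T :: "real set" assume T: "closedin euclideanreal T"
      have "closedin X {y \<in> topspace X. g y \<in> T}" using gc T by (rule closedin_continuous_map_preimage)
      then have "closedin X (({y \<in> topspace X. g y \<in> T} \<inter> L n) \<union> (if 1 \<in> T then F \<inter> L (Suc n) else {}))"
        using Lcl F by auto
      moreover have "{y \<in> topspace (subtopology X ?S). h y \<in> T} =
          ({y \<in> topspace X. g y \<in> T} \<inter> L n) \<union> (if 1 \<in> T then F \<inter> L (Suc n) else {})" (is "?l = ?r")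
      proof (intro subset_antisym subsetI)
        fix y assume "y \<in> ?l"
        then show "y \<in> ?r" by (auto simp: h_def split: if_splits)
      next
        fix y assume y: "y \<in> ?r"
        then have "y \<in> topspace X" "y \<in> ?S" using LX[of n] LX[of "Suc n"] by (auto split: if_splits)
        moreover have "h y \<in> T" using y g1[of y] by (auto simp: h_def split: if_splits)
        ultimately show "y \<in> ?l" by auto
      qed
      moreover have "?r \<subseteq> ?S" by auto
      ultimately show "closedin (subtopology X ?S) {y \<in> topspace (subtopology X ?S). h y \<in> T}"
        by (simp add: closedin_subset_topspace)
    qed auto
    then obtain k where k: "continuous_map X euclideanreal k" "\<And>y. y \<in> ?S \<Longrightarrow> k y = h y"
      using Tietze_extension_completely_regular[OF cr S is_interval_univ UNIV_not_empty] by (metis subset_UNIV)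
    have "k y = 1" if y: "y \<in> F \<inter> L (Suc n)" for y
      using k(2)[of y] y g1[of y] by (auto simp: h_def)
    moreover have "k y = g y" if "y \<in> L n" for y using k(2)[of y] that by (simp add: h_def)
    ultimately show ?thesis using k(1) gx xL[of n] unfolding \<Phi>_def \<Psi>_def by (intro exI[of _ k]) auto
  qed
  moreover have "\<exists>g. \<Phi> 0 g"
  proof -
    have "disjnt {x} (F \<inter> L 0)" "compactin X {x}" using x LX by auto
    then obtain g where "continuous_map X euclideanreal g" "g ` {x} \<subseteq> {0}" "g ` (F \<inter> L 0) \<subseteq> {1}"
      using Urysohn_completely_regular_compact_closed_alt[OF cr _ F, of "{x}" 0] by metis
    then show ?thesis unfolding \<Phi>_def by (intro exI[of _ g]) auto
  qed
  ultimately obtain f where "\<And>n. \<Phi> n (f n) \<and> \<Psi> n (f n) (f (Suc n))"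
    using dependent_nat_choice[of \<Phi> \<Psi>] by metis
  then show thesis by (intro that[of f]) (auto simp: \<Phi>_def \<Psi>_def)
qed

section \<open>The decomposition given by a countable saturated family\<close>

context k_network_space
begin

text \<open>By saturation, a relatively compact member meeting the union \<open>Y\<close> belongs to
  \<open>\<C>\<close>, and the closures of members of \<open>\<C>\<close> stay in \<open>Y\<close>.
  So \<open>\<C>\<close> is a network of \<open>Y\<close> and these closures are a countable compact
  cover; that the cover determines the topology is the part requiring the
  \<open>k\<^sub>\<real>\<close>-property.\<close>

lemma countable_saturated_subfamily_decomposition:
  assumes kn: "k_network_in X relcompact_members"
    and \<C>: "countable \<C>" "\<C> \<subseteq> relcompact_members"
    and sat: "\<And>A B. A \<in> relcompact_members \<Longrightarrow> B \<in> \<C> \<Longrightarrow> A \<inter> X closure_of B \<noteq> {} \<Longrightarrow> A \<in> \<C>"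
    and seq: "\<And>s l. nontrivial_sequence X s l \<Longrightarrow> range s \<inter> \<Union>\<C> \<noteq> {}"
  shows "discrete_cosmic_decomposition X (\<Union>\<C>)"
proof -
  define Y where "Y = \<Union>\<C>"
  have sub: "A \<subseteq> topspace X" "A \<subseteq> X closure_of A" "compactin X (X closure_of A)" if "A \<in> relcompact_members" for A
  proof -
    show "A \<subseteq> topspace X" using kn that unfolding k_network_in_def by blast
    then show "A \<subseteq> X closure_of A" by (rule closure_of_subset)
    show "compactin X (X closure_of A)" using that unfolding relcompact_members_def by blast
  qed
  have YX: "Y \<subseteq> topspace X" using sub(1) \<C>(2) unfolding Y_def by blast
  have meet: "A \<in> \<C>" if A: "A \<in> relcompact_members" "y \<in> A" "y \<in> Y" for A y
  proof -
    obtain B where B: "B \<in> \<C>" "y \<in> B" using A(3) unfolding Y_def by blast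
    then show ?thesis using sat[OF A(1) B(1)] sub(2)[of B] \<C>(2) A(2) by blast
  qed
  have clY: "X closure_of B \<subseteq> Y" if B: "B \<in> \<C>" for B
  proof
    fix x assume x: "x \<in> X closure_of B"
    then have "x \<in> topspace X" by (simp add: in_closure_of)
    then obtain A where A: "A \<in> relcompact_members" "x \<in> A" by (metis k_network_in_point[OF kn openin_topspace])
    then have "A \<in> \<C>" using sat[OF A(1) B] x by blast
    then show "x \<in> Y" using A(2) unfolding Y_def by blast
  qed
  \<comment> \<open>A subsequence outside \<open>Y\<close> would again be a nontrivial sequence,
    contradicting \<open>seq\<close>.\<close>
  have ev: "\<exists>N. \<forall>n\<ge>N. s n \<in> Y" if s: "nontrivial_sequence X s l" for s l
  proof (rule ccontr)
    assume "\<not> (\<exists>N. \<forall>n\<ge>N. s n \<in> Y)"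
    then have "infinite {n. s n \<notin> Y}" unfolding infinite_nat_iff_unbounded_le by blast
    then obtain r :: "nat \<Rightarrow> nat" where r: "strict_mono r" "\<And>n. r n \<in> {n. s n \<notin> Y}" using infinite_enumerate by blast
    have "range (s \<circ> r) \<inter> Y \<noteq> {}" unfolding Y_def by (rule seq[OF nontrivial_sequence_subseq[OF s r(1)]])
    then show False using r(2) by auto
  qed
  have lim: "l \<in> Y" if s: "nontrivial_sequence X s l" for s l
  proof -
    have sl: "limitin X s l sequentially" "range s \<subseteq> topspace X" using s unfolding nontrivial_sequence_def by blast+
    have "compactin X (insert l (range s))" by (rule compactin_sequence_with_limit[OF sl(1) _ sl(2)]) simp
    then obtain \<F> where \<F>: "finite \<F>" "\<F> \<subseteq> relcompact_members" "insert l (range s) \<subseteq> \<Union>\<F>"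
      by (metis k_network_inE[OF kn openin_topspace] compactin_subset_topspace)
    \<comment> \<open>One of finitely many covering members contains infinitely many terms. It meets
      \<open>Y\<close>, hence belongs to \<open>\<C>\<close>, and its closure contains the
      limit.\<close>
    have "(\<Union>A\<in>\<F>. {n. s n \<in> A}) = UNIV" using \<F>(3) by blast
    then have "infinite (\<Union>A\<in>\<F>. {n. s n \<in> A})" by simp
    then obtain A where A: "A \<in> \<F>" "infinite {n. s n \<in> A}" using \<F>(1) by blast
    obtain N where N: "\<And>n. n \<ge> N \<Longrightarrow> s n \<in> Y" using ev[OF s] by blast
    obtain n where "n \<ge> N" "s n \<in> A" using A(2) unfolding infinite_nat_iff_unbounded_le by blast
    then have "A \<in> \<C>" using meet[of A "s n"] N A(1) \<F>(2) by blast
    moreover have "l \<in> X closure_of A" unfolding in_closure_of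
    proof (intro conjI allI impI)
      show "l \<in> topspace X" using sl(1) by (rule limitin_topspace)
      fix T assume "l \<in> T \<and> openin X T"
      then obtain M where "\<forall>n\<ge>M. s n \<in> T" using sl(1) unfolding limitin_sequentially by blast
      moreover obtain n where "n \<ge> M" "s n \<in> A" using A(2) unfolding infinite_nat_iff_unbounded_le by blast
      ultimately show "\<exists>y. y \<in> A \<and> y \<in> T" by blast
    qed
    ultimately show ?thesis using clY by blast
  qed
  \<comment> \<open>Every nontrivial sequence is eventually in \<open>Y\<close> together with its
    limit, so any set of further points may be added. The case of the empty set gives that
    \<open>Y\<close> is clopen; the general case gives discreteness of the complement.\<close>
  have clopen: "openin X (Y \<union> A) \<and> closedin X (Y \<union> A)" if A: "A \<subseteq> topspace X" for A
  proof (rule sequential_clopenI)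
    fix s l assume s: "nontrivial_sequence X s l"
    show "l \<in> Y \<union> A" using lim[OF s] by blast
    assume "range s \<inter> (Y \<union> A) = {}"
    then show "l \<notin> Y \<union> A" using ev[OF s] by blast
  qed (use A YX in blast)
  have Yc: "openin X Y" "closedin X Y" using clopen[of "{}"] by auto
  have tY: "topspace (subtopology X Y) = Y" using YX by auto
  have "openin X A" if A: "A \<subseteq> topspace X - Y" for A
  proof -
    have "A = (Y \<union> A) \<inter> (topspace X - Y)" using A by blast
    moreover have "openin X ((Y \<union> A) \<inter> (topspace X - Y))" using clopen[of A] A Yc by blast
    ultimately show ?thesis by simp
  qed
  moreover have "cosmic_space (subtopology X Y)" unfolding cosmic_space_def
  proof (intro conjI exI[of _ \<C>])
    show "regular_t1_space (subtopology X Y)" using Tychonoff_imp_regular_t1[OF Tychonoff]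
      by (simp add: regular_t1_space_def regular_space_subtopology t1_space_subtopology)
    show "network_in (subtopology X Y) \<C>" unfolding network_in_def
    proof (intro conjI allI impI)
      show "\<C> \<subseteq> Pow (topspace (subtopology X Y))" unfolding tY unfolding Y_def by blast
      fix y U assume U: "openin (subtopology X Y) U \<and> y \<in> U"
      then have "openin X U" "y \<in> Y" using Yc(1) by (auto simp: openin_open_subtopology)
      then obtain A where A: "A \<in> relcompact_members" "y \<in> A" "A \<subseteq> U" using U by (metis k_network_in_point[OF kn])
      then show "\<exists>N\<in>\<C>. y \<in> N \<and> N \<subseteq> U" using meet[OF A(1,2) \<open>y \<in> Y\<close>] by blast
    qed
  qed (fact \<C>(1))
  moreover have "k_omega_space (subtopology X Y)" unfolding k_omega_space_def
  proof (intro exI[of _ "(\<lambda>B. X closure_of B) ` \<C>"] conjI ballI allI impI)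
    show "countable ((\<lambda>B. X closure_of B) ` \<C>)" using \<C>(1) by simp
    show "compactin (subtopology X Y) K" if "K \<in> (\<lambda>B. X closure_of B) ` \<C>" for K
      using that sub(3) clY \<C>(2) by (auto simp: compactin_subtopology)
    show "\<Union>((\<lambda>B. X closure_of B) ` \<C>) = topspace (subtopology X Y)"
    proof
      show "\<Union>((\<lambda>B. X closure_of B) ` \<C>) \<subseteq> topspace (subtopology X Y)" unfolding tY using clY by blast
      have "B \<subseteq> X closure_of B" if "B \<in> \<C>" for B using sub(2) \<C>(2) that by blast
      then show "topspace (subtopology X Y) \<subseteq> \<Union>((\<lambda>B. X closure_of B) ` \<C>)" unfolding tY unfolding Y_def by blast
    qed
    fix F assume FY: "F \<subseteq> topspace (subtopology X Y)"
    show "closedin (subtopology X Y) F \<longleftrightarrow>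
      (\<forall>K\<in>(\<lambda>B. X closure_of B) ` \<C>. closedin (subtopology (subtopology X Y) K) (F \<inter> K))" (is "_ \<longleftrightarrow> ?rhs")
    proof
      assume ?rhs
      have Fcl: "closedin X (F \<inter> X closure_of B)" if B: "B \<in> \<C>" for B
      proof -
        have "closedin (subtopology (subtopology X Y) (X closure_of B)) (F \<inter> X closure_of B)" using \<open>?rhs\<close> B by blast
        then have "closedin (subtopology X (X closure_of B)) (F \<inter> X closure_of B)"
          using clY[OF B] by (simp add: subtopology_subtopology Int_absorb1)
        then show ?thesis using closedin_closure_of closedin_trans_full by blast
      qed
      \<comment> \<open>Closedness of \<open>F\<close> is verified pointwise: the open set arises
        from a function on all of \<open>X\<close> that is 0 at \<open>x\<close> and 1 on
        \<open>F\<close>, continuous because it is continuous on compact sets.\<close>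
      have sep: "\<exists>U. openin X U \<and> x \<in> U \<and> U \<inter> F = {}" if x: "x \<in> Y" "x \<notin> F" for x
      proof -
        have "\<C> \<noteq> {}" using x(1) unfolding Y_def by blast
        define b where "b = from_nat_into \<C>"
        have b: "b i \<in> \<C>" for i unfolding b_def using \<open>\<C> \<noteq> {}\<close> by (rule from_nat_into)
        define L where "L n = insert x (\<Union>i\<le>n. X closure_of (b i))" for n :: nat
        have xX: "x \<in> topspace X" using x(1) YX by blast
        have cb: "compactin X (X closure_of (b i))" for i using sub(3) b \<C>(2) by blast
        have Lc: "compactin X (L n)" for n
        proof -
          have "compactin X (\<Union>((\<lambda>i. X closure_of (b i)) ` {..n}))" using cb by (intro compactin_Union) auto
          then show ?thesis unfolding L_def using xX by (metis compactin_Un compactin_sing insert_is_Un)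
        qed
        have Linc: "incseq L" unfolding L_def by (intro incseq_SucI) auto
        have FL: "closedin X (F \<inter> L n)" for n
        proof -
          have "F \<inter> L n = (\<Union>i\<in>{..n}. F \<inter> X closure_of (b i))" using x(2) unfolding L_def by auto
          moreover have "closedin X (\<Union>i\<in>{..n}. F \<inter> X closure_of (b i))"
            using Fcl[OF b] by (intro closedin_Union) auto
          ultimately show ?thesis by simp
        qed
        obtain f where f: "\<And>n. continuous_map X euclideanreal (f n)" "\<And>n y. y \<in> L n \<Longrightarrow> f (Suc n) y = f n y"
          "\<And>n. f n x = 0" "\<And>n y. y \<in> F \<inter> L n \<Longrightarrow> f n y = (1::real)"
          by (rule compact_exhaustion_separation[OF Tychonoff Lc Linc FL _ x(2)]) (auto simp: L_def)
        have stable: "f m y = f n y" if "y \<in> L n" "n \<le> m" for m n y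
          using that(2)
        proof (induction m rule: dec_induct)
          case (step k)
          have "y \<in> L k" using that(1) step(1) Linc by (meson monoD subsetD)
          then show ?case using f(2) step by simp
        qed simp
        have Lcover: "\<exists>n. y \<in> L n" if y: "y \<in> Y" for y
        proof -
          obtain B where "B \<in> \<C>" "y \<in> B" using y unfolding Y_def by blast
          moreover then obtain i where "B = b i" unfolding b_def using \<C>(1) from_nat_into_surj by metis
          ultimately have "y \<in> X closure_of (b i)" using sub(2) \<C>(2) by blast
          then show ?thesis unfolding L_def by blast
        qed
        \<comment> \<open>By \<open>stable\<close> the choice of the stage is immaterial. The
          constant 1 off \<open>Y\<close> is harmless because \<open>Y\<close> is clopen.\<close>
        define h where "h y = (if y \<in> Y then f (LEAST n. y \<in> L n) y else 1)" for y
        have hL: "h y = f n y" if "y \<in> L n" "y \<in> Y" for n y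
          using stable[OF LeastI[of "\<lambda>n. y \<in> L n", OF that(1)], of n] that by (simp add: h_def Least_le)
        have "continuous_map (subtopology X K) euclideanreal h" if K: "compactin X K" for K
        proof -
          have KX: "K \<subseteq> topspace X" by (rule compactin_subset_topspace[OF K])
          obtain \<F> where \<F>: "finite \<F>" "\<F> \<subseteq> relcompact_members" "K \<subseteq> \<Union>\<F>"
            by (metis k_network_inE[OF kn openin_topspace K KX])
          have "finite {A\<in>\<F>. A \<in> \<C>}" using \<F>(1) by simp
          moreover have "\<forall>A\<in>{A\<in>\<F>. A \<in> \<C>}. \<exists>i. A = b i" unfolding b_def using \<C>(1) from_nat_into_surj by (metis mem_Collect_eq)
          ultimately obtain i where i: "\<forall>A\<in>{A\<in>\<F>. A \<in> \<C>}. A = b (i A)" by metis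
          have "finite (i ` {A\<in>\<F>. A \<in> \<C>})" using \<F>(1) by simp
          then obtain n where n: "\<forall>k\<in>i ` {A\<in>\<F>. A \<in> \<C>}. k \<le> n"
            unfolding finite_nat_set_iff_bounded_le by blast
          \<comment> \<open>Finitely many relatively compact members cover \<open>K\<close>, and
            those meeting \<open>Y\<close> are in \<open>\<C>\<close>; hence a single stage contains
            \<open>K \<inter> Y\<close>, and on \<open>K\<close> the glued function agrees with one
            \<open>f n\<close> there.\<close>
          have KL: "y \<in> L n" if y: "y \<in> K" "y \<in> Y" for y
          proof -
            obtain A where A: "A \<in> \<F>" "y \<in> A" using y(1) \<F>(3) by blast
            then have "A \<in> \<C>" using meet[of A y] \<F>(2) y(2) by blast
            then have "A = b (i A)" "i A \<le> n" using i n A(1) by blast+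
            moreover have "y \<in> X closure_of A" using sub(2) A \<F>(2) by blast
            ultimately show ?thesis unfolding L_def by (metis UN_I atMost_iff insertCI)
          qed
          have hK: "h y = (if y \<in> Y then f n y else 1)" if "y \<in> K" for y
            using hL[OF KL[OF that]] by (simp add: h_def)
          show ?thesis unfolding continuous_map_closedin
          proof (intro conjI allI impI)
            fix T :: "real set" assume T: "closedin euclideanreal T"
            have "{y \<in> topspace (subtopology X K). h y \<in> T} =
              K \<inter> (({y \<in> topspace X. f n y \<in> T} \<inter> Y) \<union> (if 1 \<in> T then topspace X - Y else {}))"
              using KX by (auto simp: hK split: if_splits)
            moreover have "closedin X (({y \<in> topspace X. f n y \<in> T} \<inter> Y) \<union> (if 1 \<in> T then topspace X - Y else {}))"
              using closedin_continuous_map_preimage[OF f(1) T] Yc by auto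
            ultimately show "closedin (subtopology X K) {y \<in> topspace (subtopology X K). h y \<in> T}"
              by (simp only: closedin_subtopology_Int_closed)
          qed auto
        qed
        then have "continuous_map X euclideanreal h" using k_real unfolding k_real_space_def by blast
        then have "openin X {y \<in> topspace X. h y \<in> {..<1}}" by (rule openin_continuous_map_preimage) simp
        moreover have "h x = 0" using hL[of x 0] x(1) f(3) by (simp add: L_def)
        moreover have "h y = 1" if "y \<in> F" for y
        proof -
          have "y \<in> Y" using that FY tY by blast
          moreover then obtain n where "y \<in> L n" using Lcover by blast
          ultimately show ?thesis using hL f(4) that by simp
        qed
        ultimately show ?thesis using xX by (intro exI[of _ "{y \<in> topspace X. h y \<in> {..<1}}"]) auto
      qed
      have "openin (subtopology X Y) (Y - F)"
      proof (subst openin_subopen, intro ballI)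
        fix x assume "x \<in> Y - F"
        then obtain U where U: "openin X U" "x \<in> U" "U \<inter> F = {}" using sep by blast
        then show "\<exists>T. openin (subtopology X Y) T \<and> x \<in> T \<and> T \<subseteq> Y - F"
          using \<open>x \<in> Y - F\<close> by (intro exI[of _ "U \<inter> Y"]) (auto simp: openin_subtopology)
      qed
      then show "closedin (subtopology X Y) F" using FY unfolding closedin_def tY by simp
    qed (simp add: closedin_subtopology_Int_closed Int_commute)
  qed
  ultimately show ?thesis using Yc unfolding discrete_cosmic_decomposition_def Y_def by blast
qed

section \<open>Saturation of countable families under touching\<close>

definition touching :: "('a set \<times> 'a set) set" where
  "touching = {(B, A). A \<in> relcompact_members \<and> B \<in> relcompact_members \<and> A \<inter> X closure_of B \<noteq> {}}"

text \<open>The compact closure of a member meets only countably many others, so one step from a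
  countable family stays countable, and hence so does the iteration of all finite numbers of
  steps.\<close>

lemma countable_touching_closure:
  assumes "countable \<S>"
  shows "countable (touching\<^sup>* `` \<S>)"
proof (rule countable_rtrancl[OF _ assms])
  fix \<S> :: "'a set set" assume "countable \<S>"
  moreover have "countable (touching `` {B})" for B
  proof (cases "B \<in> relcompact_members")
    case True
    then have "compactin X (X closure_of B)" by (simp add: relcompact_members_def)
    then have "countable {A\<in>\<N>. A \<inter> X closure_of B \<noteq> {}}" using compact_countable unfolding compact_countable_in_def by blast
    then show ?thesis by (rule countable_subset[rotated]) (auto simp: touching_def relcompact_members_def)
  qed (auto simp: touching_def)
  ultimately have "countable (\<Union>B\<in>\<S>. touching `` {B})" by blast
  moreover have "touching `` \<S> = (\<Union>B\<in>\<S>. touching `` {B})" by blast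
  ultimately show "countable (touching `` \<S>)" by simp
qed

text \<open>The starting family is countable because single points are compact, and its closure
  under \<open>touching\<close> is saturated by construction.\<close>

lemma touching_closure_decomposition:
  assumes kn: "k_network_in X relcompact_members"
    and Z: "countable Z" "Z \<subseteq> topspace X"
    and seq: "\<And>s l. nontrivial_sequence X s l \<Longrightarrow>
      range s \<inter> \<Union>(touching\<^sup>* `` {A\<in>relcompact_members. A \<inter> Z \<noteq> {}}) \<noteq> {}"
  shows "\<exists>Y. discrete_cosmic_decomposition X Y"
proof -
  let ?S = "{A\<in>relcompact_members. A \<inter> Z \<noteq> {}}"
  have "countable {A\<in>\<N>. A \<inter> {z} \<noteq> {}}" if "z \<in> Z" for z
    using compact_countable Z(2) that unfolding compact_countable_in_def by (meson compactin_sing subsetD)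
  then have "countable (\<Union>z\<in>Z. {A\<in>\<N>. A \<inter> {z} \<noteq> {}})" using Z(1) by blast
  moreover have "?S \<subseteq> (\<Union>z\<in>Z. {A\<in>\<N>. A \<inter> {z} \<noteq> {}})" unfolding relcompact_members_def by blast
  ultimately have "countable ?S" by (rule countable_subset[rotated])
  then have c: "countable (touching\<^sup>* `` ?S)" by (rule countable_touching_closure)
  have sub: "touching\<^sup>* `` ?S \<subseteq> relcompact_members"
  proof
    fix A assume "A \<in> touching\<^sup>* `` ?S"
    then obtain B where "(B, A) \<in> touching\<^sup>*" "B \<in> relcompact_members" by blast
    then show "A \<in> relcompact_members" by (induction rule: rtrancl_induct) (auto simp: touching_def)
  qed
  have "A \<in> touching\<^sup>* `` ?S" if "A \<in> relcompact_members" "B \<in> touching\<^sup>* `` ?S" "A \<inter> X closure_of B \<noteq> {}" for A B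
  proof -
    have "(B, A) \<in> touching" using that sub unfolding touching_def by blast
    then show ?thesis using that(2) by (meson Image_iff rtrancl.rtrancl_into_rtrancl)
  qed
  then have "discrete_cosmic_decomposition X (\<Union>(touching\<^sup>* `` ?S))"
    using seq by (intro countable_saturated_subfamily_decomposition[OF kn c sub])
  then show ?thesis by blast
qed

text \<open>A compact set is covered by finitely many members, and each of them meets at most one of
  the separated sets.\<close>

lemma members_finite_separated:
  assumes \<M>: "\<And>C. compactin X C \<Longrightarrow> \<exists>\<F>. finite \<F> \<and> \<F> \<subseteq> \<M> \<and> C \<subseteq> \<Union>\<F>"
    and sep: "\<And>\<alpha> \<beta> M. \<alpha> \<in> I \<Longrightarrow> \<beta> \<in> I \<Longrightarrow> \<alpha> \<noteq> \<beta> \<Longrightarrow> M \<in> \<M> \<Longrightarrow> P \<alpha> \<inter> M = {} \<or> P \<beta> \<inter> M = {}"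
    and C: "compactin X C"
  shows "finite {\<alpha>\<in>I. P \<alpha> \<inter> C \<noteq> {}}"
proof -
  obtain \<F> where \<F>: "finite \<F>" "\<F> \<subseteq> \<M>" "C \<subseteq> \<Union>\<F>" using \<M>[OF C] by blast
  have "finite {\<alpha>\<in>I. P \<alpha> \<inter> M \<noteq> {}}" if "M \<in> \<F>" for M
  proof (cases "{\<alpha>\<in>I. P \<alpha> \<inter> M \<noteq> {}} = {}")
    case False
    then obtain \<alpha> where \<alpha>: "\<alpha> \<in> I" "P \<alpha> \<inter> M \<noteq> {}" by blast
    have "{\<alpha>\<in>I. P \<alpha> \<inter> M \<noteq> {}} \<subseteq> {\<alpha>}" using sep[OF \<alpha>(1), of _ M] \<alpha>(2) \<F>(2) that by blast
    then show ?thesis by (rule finite_subset) simp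
  qed (simp only: finite.emptyI)
  then have "finite (\<Union>M\<in>\<F>. {\<alpha>\<in>I. P \<alpha> \<inter> M \<noteq> {}})" using \<F>(1) by blast
  then show ?thesis by (rule finite_subset[rotated]) (use \<F>(3) in blast)
qed

section \<open>From the absence of fans to a decomposition\<close>

lemma k_network_compact_cover:
  assumes "k_network_in X \<M>" "compactin X C"
  shows "\<exists>\<F>. finite \<F> \<and> \<F> \<subseteq> \<M> \<and> C \<subseteq> \<Union>\<F>"
  using k_network_inE[OF assms(1) openin_topspace assms(2) compactin_subset_topspace[OF assms(2)]] by metis

lemma k_network_cover:
  assumes "k_network_in X \<M>"
  shows "topspace X \<subseteq> \<Union>\<M>"
proof
  fix y assume "y \<in> topspace X"
  then obtain N where "N \<in> \<M>" "y \<in> N" by (rule k_network_in_point[OF assms openin_topspace])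
  then show "y \<in> \<Union>\<M>" by blast
qed

text \<open>Without nontrivial convergent sequences every subset is clopen, so \<open>X\<close> is
  discrete. The case is split off because the fans of the other case are built from such
  sequences.\<close>

lemma trivial_decomposition:
  assumes "\<And>s l. \<not> nontrivial_sequence X s l"
  shows "\<exists>Y. discrete_cosmic_decomposition X Y"
proof -
  have "openin X A" if "A \<subseteq> topspace X" for A using sequential_clopenI[OF that] assms by blast
  moreover have "cosmic_space (subtopology X {})" unfolding cosmic_space_def
    using Tychonoff_imp_regular_t1[OF Tychonoff]
    by (intro conjI exI[of _ "{}"]) (auto simp: regular_t1_space_def regular_space_subtopology t1_space_subtopology network_in_def dest: openin_subset)
  moreover have "k_omega_space (subtopology X {})" unfolding k_omega_space_def
    by (intro exI[of _ "{}"]) auto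
  ultimately show ?thesis unfolding discrete_cosmic_decomposition_def by (intro exI[of _ "{}"]) auto
qed

text \<open>The maximal separated family is taken with respect to the relatively compact members.
  Separation makes sequences disjoint, since a common point lies in some member, and compact-finite,
  since finitely many members cover a compact set. If uncountable, the family yields a fan;
  otherwise \<open>Z\<close> generates the decomposition.\<close>

lemma no_Fin_fan_imp_decomposition:
  assumes no_fan: "\<not> (\<exists>F. Fin_fan (FT X) omega_1 F)"
  shows "\<exists>Y. discrete_cosmic_decomposition X Y"
proof (cases "\<exists>s l. nontrivial_sequence X s l")
  case True
  then obtain s0 l0 where s0: "nontrivial_sequence X s0 l0" by blast
  have "\<not> (\<exists>F. strict_Fin_fan (FT X) omega_1 F)" using no_fan unfolding strict_Fin_fan_def by blast
  then have kn: "k_network_in X relcompact_members" using relcompact_members_k_network s0 by blast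
  show ?thesis
  proof (rule maximal_separated_sequences[OF k_network_cover[OF kn]])
    fix s l
    assume nt: "\<And>\<alpha>. \<alpha> \<in> omega_1 \<Longrightarrow> nontrivial_sequence X (s \<alpha>) (l \<alpha>)"
      and sep: "\<And>\<alpha> \<beta> M. \<alpha> \<in> omega_1 \<Longrightarrow> \<beta> \<in> omega_1 \<Longrightarrow> \<alpha> \<noteq> \<beta> \<Longrightarrow> M \<in> relcompact_members \<Longrightarrow> range (s \<alpha>) \<inter> M = {} \<or> range (s \<beta>) \<inter> M = {}"
    have s: "limitin X (s \<alpha>) (l \<alpha>) sequentially \<and> range (s \<alpha>) \<subseteq> topspace X" "\<And>n. s \<alpha> n \<noteq> l \<alpha>" if "\<alpha> \<in> omega_1" for \<alpha>
      using nt[OF that] unfolding nontrivial_sequence_def by blast+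
    have disj: "range (s \<alpha>) \<inter> range (s \<beta>) = {}" if "\<alpha> \<in> omega_1" "\<beta> \<in> omega_1" "\<alpha> \<noteq> \<beta>" for \<alpha> \<beta>
    proof (rule ccontr)
      assume "range (s \<alpha>) \<inter> range (s \<beta>) \<noteq> {}"
      then obtain y where y: "y \<in> range (s \<alpha>)" "y \<in> range (s \<beta>)" by blast
      then have "y \<in> topspace X" using s(1)[OF \<open>\<alpha> \<in> omega_1\<close>] by blast
      then obtain M where "M \<in> relcompact_members" "y \<in> M" by (metis k_network_in_point[OF kn openin_topspace])
      then show False using sep[OF that] y by blast
    qed
    have cf: "finite {\<alpha>\<in>omega_1. range (s \<alpha>) \<inter> C \<noteq> {}}" if "compactin X C" for C
      by (rule members_finite_separated[OF k_network_compact_cover[OF kn] sep that])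
    have "\<exists>F. Fin_fan (FT X) omega_1_pairs F"
      by (rule omega_1_sequences_Fin_fan[OF Tychonoff mu_complete s disj cf])
    then show ?thesis using no_fan omega_1_fanI(1)[OF omega_1_pairs_ordLeq] by blast
  next
    fix Z assume Z: "countable Z" "Z \<subseteq> topspace X"
      and seq: "\<And>s l. nontrivial_sequence X s l \<Longrightarrow> \<exists>M\<in>relcompact_members. range s \<inter> M \<noteq> {} \<and> Z \<inter> M \<noteq> {}"
    show ?thesis
    proof (rule touching_closure_decomposition[OF kn Z])
      fix s l assume "nontrivial_sequence X s l"
      from seq[OF this] obtain M where M: "M \<in> relcompact_members" "range s \<inter> M \<noteq> {}" "Z \<inter> M \<noteq> {}" by blast
      then have "M \<in> touching\<^sup>* `` {A\<in>relcompact_members. A \<inter> Z \<noteq> {}}" by (intro ImageI[of M M]) auto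
      then show "range s \<inter> \<Union>(touching\<^sup>* `` {A\<in>relcompact_members. A \<inter> Z \<noteq> {}}) \<noteq> {}" using M(2) by blast
    qed
  qed
qed (use trivial_decomposition in blast)

text \<open>A finite cover of a compact set splits into members inside \<open>Q\<close> and members
  missing \<open>Q\<close>. As members are closed, both unions are closed, and they cut the compact
  set into its two pieces.\<close>

lemma saturated_clopen:
  assumes kn: "k_network_in X relcompact_members" and closed: "\<And>N. N \<in> \<N> \<Longrightarrow> closedin X N"
    and Q: "Q \<subseteq> topspace X" "\<And>A. A \<in> relcompact_members \<Longrightarrow> A \<subseteq> Q \<or> A \<inter> Q = {}"
  shows "openin X Q \<and> closedin X Q"
proof (rule k_real_space_clopenI[OF k_real Q(1)])
  fix L assume L: "compactin X L"
  obtain \<F> where \<F>: "finite \<F>" "\<F> \<subseteq> relcompact_members" "L \<subseteq> \<Union>\<F>" using k_network_compact_cover[OF kn L] by blast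
  have cl: "closedin X (\<Union>\<G>)" if "\<G> \<subseteq> \<F>" for \<G>
    using that \<F>(1,2) closed unfolding relcompact_members_def
    by (intro closedin_Union) (auto intro: finite_subset)
  have FQ: "A \<subseteq> Q \<or> A \<inter> Q = {}" if "A \<in> \<F>" for A using Q(2) \<F>(2) that by blast
  have split: "\<exists>A\<in>\<F>. y \<in> A \<and> (A \<subseteq> Q \<or> A \<inter> Q = {})" if "y \<in> L" for y
    using subsetD[OF \<F>(3) that] FQ by (elim UnionE) blast
  have "L \<inter> Q \<subseteq> \<Union>{A\<in>\<F>. A \<subseteq> Q}" "L - Q \<subseteq> \<Union>{A\<in>\<F>. A \<inter> Q = {}}"
    by (rule subsetI, use split in blast)+
  then have "L \<inter> Q = L \<inter> \<Union>{A\<in>\<F>. A \<subseteq> Q}" "L - Q = L \<inter> \<Union>{A\<in>\<F>. A \<inter> Q = {}}"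
    by blast+
  then show "closedin (subtopology X L) (L \<inter> Q) \<and> closedin (subtopology X L) (L - Q)"
    using cl[of "{A\<in>\<F>. A \<subseteq> Q}"] cl[of "{A\<in>\<F>. A \<inter> Q = {}}"] by (simp add: closedin_subtopology_Int_closed)
qed

text \<open>A strict fan needs disjoint open sets around the sequences. The unions of touching
  classes, called blocks, are clopen and pairwise equal or disjoint, so the maximal separated family
  is formed with respect to blocks instead of single members.\<close>

lemma no_strict_Fin_fan_imp_decomposition:
  assumes closed: "\<And>N. N \<in> \<N> \<Longrightarrow> closedin X N" and no_fan: "\<not> (\<exists>F. strict_Fin_fan (FT X) omega_1 F)"
  shows "\<exists>Y. discrete_cosmic_decomposition X Y"
proof (cases "\<exists>s l. nontrivial_sequence X s l")
  case True
  then obtain s0 l0 where s0: "nontrivial_sequence X s0 l0" by blast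
  have kn: "k_network_in X relcompact_members" using relcompact_members_k_network no_fan s0 by blast
  have rcl: "X closure_of A = A" if "A \<in> relcompact_members" for A
    using that closed unfolding relcompact_members_def by (simp add: closure_of_closedin)
  \<comment> \<open>Symmetry comes from closed members: \<open>A \<inter> X closure_of B\<close> is
    then simply \<open>A \<inter> B\<close>.\<close>
  have "sym touching" unfolding sym_def touching_def using rcl by (auto simp: Int_commute)
  then have sym: "(B, A) \<in> touching\<^sup>*" if "(A, B) \<in> touching\<^sup>*" for A B using that by (meson sym_rtrancl symD)
  define block where "block A = \<Union>(touching\<^sup>* `` {A})" for A
  have mem: "B \<in> relcompact_members" if "(A, B) \<in> touching\<^sup>*" "A \<in> relcompact_members" for A B
    using that by (induction rule: rtrancl_induct) (auto simp: touching_def)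
  have block_sub: "A \<subseteq> block A" for A unfolding block_def by blast
  have overlap: "block A = block B" if AB: "A \<in> relcompact_members" "B \<in> relcompact_members" "y \<in> block A" "y \<in> block B" for A B y
  proof -
    obtain A' B' where *: "(A, A') \<in> touching\<^sup>*" "y \<in> A'" "(B, B') \<in> touching\<^sup>*" "y \<in> B'"
      using AB(3,4) unfolding block_def by blast
    then have "(A', B') \<in> touching" using mem AB(1,2) rcl[of A'] unfolding touching_def by blast
    then have "(A, B) \<in> touching\<^sup>*" using *(1,3) sym by (meson rtrancl.rtrancl_into_rtrancl rtrancl_trans)
    then have "touching\<^sup>* `` {A} = touching\<^sup>* `` {B}" using sym by (auto intro: rtrancl_trans)
    then show ?thesis by (simp add: block_def)
  qed
  have mX: "A \<subseteq> topspace X" if "A \<in> relcompact_members" for A using kn that unfolding k_network_in_def by blast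
  have bclopen: "openin X (block A) \<and> closedin X (block A)" if A: "A \<in> relcompact_members" for A
  proof (rule saturated_clopen[OF kn closed])
    show "block A \<subseteq> topspace X" using mem[OF _ A] mX unfolding block_def by blast
    fix B assume B: "B \<in> relcompact_members"
    show "B \<subseteq> block A \<or> B \<inter> block A = {}"
      using overlap[OF B A] block_sub[of B] by blast
  qed
  let ?\<M> = "block ` relcompact_members"
  have cover: "topspace X \<subseteq> \<Union>?\<M>" using k_network_cover[OF kn] block_sub by blast
  have compact_cover: "\<exists>\<F>. finite \<F> \<and> \<F> \<subseteq> ?\<M> \<and> C \<subseteq> \<Union>\<F>" if "compactin X C" for C
  proof -
    have "\<exists>\<F>. finite \<F> \<and> \<F> \<subseteq> relcompact_members \<and> C \<subseteq> \<Union>\<F>" by (rule k_network_compact_cover[OF kn that])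
    then obtain \<F> where "finite \<F>" "\<F> \<subseteq> relcompact_members" "C \<subseteq> \<Union>\<F>" by blast
    then show ?thesis using block_sub by (intro exI[of _ "block ` \<F>"]) blast
  qed
  show ?thesis
  proof (rule maximal_separated_sequences[OF cover])
    fix s l
    assume nt: "\<And>\<alpha>. \<alpha> \<in> omega_1 \<Longrightarrow> nontrivial_sequence X (s \<alpha>) (l \<alpha>)"
      and sep: "\<And>\<alpha> \<beta> M. \<alpha> \<in> omega_1 \<Longrightarrow> \<beta> \<in> omega_1 \<Longrightarrow> \<alpha> \<noteq> \<beta> \<Longrightarrow> M \<in> ?\<M> \<Longrightarrow> range (s \<alpha>) \<inter> M = {} \<or> range (s \<beta>) \<inter> M = {}"
    have "\<forall>\<alpha>\<in>omega_1. \<exists>A k. A \<in> relcompact_members \<and> l \<alpha> \<in> block A \<and> (\<forall>n\<ge>k. s \<alpha> n \<in> block A)"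
    proof
      fix \<alpha> assume "\<alpha> \<in> omega_1"
      then have l: "limitin X (s \<alpha>) (l \<alpha>) sequentially" using nt unfolding nontrivial_sequence_def by blast
      then have "l \<alpha> \<in> topspace X" by (rule limitin_topspace)
      then obtain A where A: "A \<in> relcompact_members" "l \<alpha> \<in> block A" using cover by blast
      then obtain k where "\<forall>n\<ge>k. s \<alpha> n \<in> block A" using l bclopen[OF A(1)] unfolding limitin_sequentially by blast
      then show "\<exists>A k. A \<in> relcompact_members \<and> l \<alpha> \<in> block A \<and> (\<forall>n\<ge>k. s \<alpha> n \<in> block A)" using A by blast
    qed
    from bchoice[OF this] obtain A where "\<forall>\<alpha>\<in>omega_1. \<exists>k. A \<alpha> \<in> relcompact_members \<and> l \<alpha> \<in> block (A \<alpha>) \<and> (\<forall>n\<ge>k. s \<alpha> n \<in> block (A \<alpha>))" ..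
    from bchoice[OF this] obtain k where Ak: "\<forall>\<alpha>\<in>omega_1. A \<alpha> \<in> relcompact_members \<and> l \<alpha> \<in> block (A \<alpha>) \<and> (\<forall>n\<ge>k \<alpha>. s \<alpha> n \<in> block (A \<alpha>))" ..
    \<comment> \<open>Dropping the first terms places the whole sequence and its limit in one clopen
      block.\<close>
    define t where "t \<alpha> n = s \<alpha> (n + k \<alpha>)" for \<alpha> n
    have t: "limitin X (t \<alpha>) (l \<alpha>) sequentially \<and> range (t \<alpha>) \<subseteq> topspace X" "\<And>n. t \<alpha> n \<noteq> l \<alpha>" if "\<alpha> \<in> omega_1" for \<alpha>
      using nt[OF that] limitin_sequentially_offset[of X "s \<alpha>" "l \<alpha>" "k \<alpha>"] unfolding nontrivial_sequence_def t_def by auto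
    have tb: "t \<alpha> n \<in> block (A \<alpha>)" if "\<alpha> \<in> omega_1" for \<alpha> n using Ak that by (simp add: t_def)
    have disj: "block (A \<alpha>) \<inter> block (A \<beta>) = {}" if ab: "\<alpha> \<in> omega_1" "\<beta> \<in> omega_1" "\<alpha> \<noteq> \<beta>" for \<alpha> \<beta>
    proof (rule ccontr)
      assume "block (A \<alpha>) \<inter> block (A \<beta>) \<noteq> {}"
      then have "block (A \<alpha>) = block (A \<beta>)" using overlap Ak ab by blast
      then have "s \<alpha> (0 + k \<alpha>) \<in> block (A \<alpha>)" "s \<beta> (0 + k \<beta>) \<in> block (A \<alpha>)"
        using tb[OF ab(1), of 0] tb[OF ab(2), of 0] by (simp_all add: t_def)
      then show False using sep[OF ab, of "block (A \<alpha>)"] Ak ab(1) by blast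
    qed
    have cf: "finite {\<alpha>\<in>omega_1. block (A \<alpha>) \<inter> C \<noteq> {}}" if "compactin X C" for C
    proof (rule members_finite_separated[OF compact_cover _ that])
      fix \<alpha> \<beta> M assume ab: "\<alpha> \<in> omega_1" "\<beta> \<in> omega_1" "\<alpha> \<noteq> \<beta>" and "M \<in> ?\<M>"
      then obtain B where B: "M = block B" "B \<in> relcompact_members" by blast
      show "block (A \<alpha>) \<inter> M = {} \<or> block (A \<beta>) \<inter> M = {}"
      proof (rule ccontr)
        assume "\<not> ?thesis"
        then have "block (A \<alpha>) = block B" "block (A \<beta>) = block B" using overlap B Ak ab by blast+
        then show False using disj[OF ab] tb[OF ab(1)] by blast
      qed
    qed
    have P: "openin X (block (A \<alpha>)) \<and> range (t \<alpha>) \<subseteq> block (A \<alpha>) \<and> l \<alpha> \<in> block (A \<alpha>)" if "\<alpha> \<in> omega_1" for \<alpha>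
      using bclopen Ak tb that by blast
    have "\<exists>F. strict_Fin_fan (FT X) omega_1_pairs F"
      by (rule omega_1_sequences_strict_Fin_fan[OF Tychonoff mu_complete t P disj cf])
    then show ?thesis using no_fan omega_1_fanI(2)[OF omega_1_pairs_ordLeq] by blast
  next
    fix Z assume Z: "countable Z" "Z \<subseteq> topspace X"
      and seq: "\<And>s l. nontrivial_sequence X s l \<Longrightarrow> \<exists>M\<in>?\<M>. range s \<inter> M \<noteq> {} \<and> Z \<inter> M \<noteq> {}"
    show ?thesis
    proof (rule touching_closure_decomposition[OF kn Z])
      fix s l assume "nontrivial_sequence X s l"
      then obtain A where A: "A \<in> relcompact_members" "range s \<inter> block A \<noteq> {}" "Z \<inter> block A \<noteq> {}" using seq by blast
      then obtain A1 A2 n z where *: "(A, A1) \<in> touching\<^sup>*" "s n \<in> A1" "(A, A2) \<in> touching\<^sup>*" "z \<in> A2" "z \<in> Z"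
        unfolding block_def by blast
      \<comment> \<open>Inside one block, the member meeting \<open>Z\<close> is joined to the
        member met by the sequence, via \<open>A\<close> and symmetry.\<close>
      have "(A2, A1) \<in> touching\<^sup>*" by (rule rtrancl_trans[OF sym[OF *(3)] *(1)])
      moreover have "A2 \<in> relcompact_members" by (rule mem[OF *(3) A(1)])
      ultimately show "range s \<inter> \<Union>(touching\<^sup>* `` {A\<in>relcompact_members. A \<inter> Z \<noteq> {}}) \<noteq> {}"
        using *(2,4,5) by blast
    qed
  qed
qed (use trivial_decomposition in blast)

end

section \<open>Free groups over \<open>k\<^sub>\<omega>\<close>-spaces\<close>

lemma FT_separating_functional:
  assumes X: "Tychonoff_space X" and g: "g \<in> topspace (FT X)" "g \<noteq> 0"
  obtains f where "continuous_map X euclideanreal f" "lin_ext f g \<noteq> (0::real)"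
proof -
  obtain x where x: "x \<in> Poly_Mapping.keys g" using g(2) keys_eq_empty by blast
  let ?W = "topspace X - (Poly_Mapping.keys g - {x})"
  have gX: "Poly_Mapping.keys g \<subseteq> topspace X" using g(1) by simp
  have "closedin X (Poly_Mapping.keys g - {x})"
    using X gX unfolding Tychonoff_space_def t1_space_closedin_finite by (meson Diff_subset finite_Diff finite_keys subset_trans)
  then have "openin X ?W" by blast
  then obtain f where f: "continuous_map X euclideanreal f" "f x = 1" "\<And>y. y \<in> topspace X - ?W \<Longrightarrow> f y = 0"
    by (rule Tychonoff_separation[OF X]) (use x gX in blast)+
  have "lin_ext f g = (\<Sum>y\<in>{x}. of_int (Poly_Mapping.lookup g y) *\<^sub>R f y)"
    unfolding lin_ext_def using x gX by (intro sum.mono_neutral_right) (auto intro!: f(3))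
  then have "lin_ext f g \<noteq> 0" using x f(2) by (simp add: in_keys_iff)
  then show thesis using that f(1) by blast
qed

lemma FT_Hausdorff:
  assumes X: "Tychonoff_space X"
  shows "Hausdorff_space (FT X)"
  unfolding Hausdorff_space_def
proof (intro allI impI)
  fix g h assume gh: "g \<in> topspace (FT X) \<and> h \<in> topspace (FT X) \<and> g \<noteq> h"
  then have "g - h \<in> topspace (FT X)" "g - h \<noteq> 0" using keys_diff[of g h] by auto
  then obtain f where f: "continuous_map X euclideanreal f" "lin_ext f (g - h) \<noteq> (0::real)"
    by (rule FT_separating_functional[OF X])
  then have "lin_ext f g \<noteq> lin_ext f h" by (simp add: lin_ext_diff)
  from hausdorff[OF this] obtain U V where UV: "open U" "open V" "lin_ext f g \<in> U" "lin_ext f h \<in> V" "U \<inter> V = {}"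
    by blast
  note c = continuous_map_lin_ext[OF f(1)]
  have "openin (FT X) {k \<in> topspace (FT X). lin_ext f k \<in> U}" "openin (FT X) {k \<in> topspace (FT X). lin_ext f k \<in> V}"
    by (rule openin_continuous_map_preimage[OF c], simp add: UV(1,2))+
  then show "\<exists>U V. openin (FT X) U \<and> openin (FT X) V \<and> g \<in> U \<and> h \<in> V \<and> disjnt U V"
    using UV(3-5) gh by (intro exI[of _ "{k \<in> topspace (FT X). lin_ext f k \<in> U}"] exI[of _ "{k \<in> topspace (FT X). lin_ext f k \<in> V}"])
      (auto simp: disjnt_iff)
qed

lemma FT_translation_open:
  assumes "openin (FT X) V" "g \<in> topspace (FT X)"
  shows "openin (FT X) {h \<in> topspace (FT X). h - g \<in> V}"
proof -
  have "continuous_map (FT X) (FT X) (\<lambda>h. h - g)"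
    using assms(2) continuous_map_FT_diff[of "FT X" X "\<lambda>h. h" "\<lambda>h. g"] by simp
  then show ?thesis using assms(1) by (rule openin_continuous_map_preimage)
qed

text \<open>The usual argument for topological groups: if \<open>V + V\<close> translated by
  \<open>g\<close> misses \<open>C\<close>, then \<open>g + V\<close> and \<open>C - V\<close> are
  disjoint open sets.\<close>

lemma FT_regular: "regular_space (FT X)"
  unfolding regular_space_def
proof (intro allI impI)
  fix C g assume C: "closedin (FT X) C \<and> g \<in> topspace (FT X) - C"
  let ?U = "{h \<in> topspace (FT X). h + g \<in> topspace (FT X) - C}"
  have gX: "g \<in> topspace (FT X)" using C by blast
  have "continuous_map (FT X) (FT X) (\<lambda>h. h + g)"
    using gX continuous_map_FT_add[of "FT X" X "\<lambda>h. h" "\<lambda>h. g"] by simp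
  then have "openin (FT X) ?U" using C by (intro openin_continuous_map_preimage) auto
  moreover have "0 \<in> ?U" using C by simp
  ultimately obtain V where V: "openin (FT X) V" "0 \<in> V" "\<And>a b. a \<in> V \<Longrightarrow> b \<in> V \<Longrightarrow> a + b \<in> ?U"
    by (rule FT_zero_neighborhood) blast
  have "continuous_map (FT X) (FT X) (\<lambda>h. - h)"
    using continuous_map_FT_minus[of "FT X" X "\<lambda>h. h"] by simp
  then have V': "openin (FT X) {h \<in> topspace (FT X). - h \<in> V}" using V(1) by (rule openin_continuous_map_preimage)
  let ?A = "{h \<in> topspace (FT X). h - g \<in> V}"
  let ?B = "\<Union>c\<in>C. {h \<in> topspace (FT X). h - c \<in> {h \<in> topspace (FT X). - h \<in> V}}"
  have CX: "C \<subseteq> topspace (FT X)" using C closedin_subset by blast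
  have "openin (FT X) ?A" using FT_translation_open[OF V(1) gX] .
  moreover have "openin (FT X) {h \<in> topspace (FT X). h - c \<in> {h \<in> topspace (FT X). - h \<in> V}}" if "c \<in> C" for c
    using FT_translation_open[OF V'] CX that by blast
  then have "openin (FT X) ?B" by blast
  moreover have "g \<in> ?A" using gX V(2) by simp
  moreover have "C \<subseteq> ?B"
  proof
    fix c assume c: "c \<in> C"
    then have "c \<in> topspace (FT X)" using CX by blast
    then have "c \<in> {h \<in> topspace (FT X). h - c \<in> {h \<in> topspace (FT X). - h \<in> V}}" using V(2) by simp
    then show "c \<in> ?B" using c by blast
  qed
  moreover have "disjnt ?A ?B" unfolding disjnt_iff
  proof (intro allI notI)
    fix h assume "h \<in> ?A \<and> h \<in> ?B"
    then obtain c where c: "c \<in> C" "h - g \<in> V" "- (h - c) \<in> V" by blast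
    have "(h - g) + (- (h - c)) \<in> ?U" by (rule V(3)[OF c(2,3)])
    then show False using c(1) by simp
  qed
  ultimately show "\<exists>U V. openin (FT X) U \<and> openin (FT X) V \<and> g \<in> U \<and> C \<subseteq> V \<and> disjnt U V" by blast
qed

text \<open>A function that is 1 at \<open>x\<close> and vanishes off \<open>U\<close> extends to a
  continuous functional on AG(X); the set where this functional is positive cuts out a neighborhood
  of the generator that lies in the image of \<open>U\<close>.\<close>

lemma frag_of_embedding:
  assumes X: "Tychonoff_space X"
  shows "embedding_map X (FT X) frag_of"
  unfolding embedding_map_def
proof (rule bijective_open_imp_homeomorphic_map)
  let ?S = "frag_of ` topspace X"
  have SX: "topspace (subtopology (FT X) ?S) = ?S" by auto
  show "continuous_map X (subtopology (FT X) ?S) frag_of"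
    using frag_of_continuous[of X] by (simp add: continuous_map_in_subtopology)
  show "frag_of ` topspace X = topspace (subtopology (FT X) ?S)" using SX by simp
  show "inj_on frag_of (topspace X)" by (simp add: inj_on_def frag_of_eq)
  show "open_map X (subtopology (FT X) ?S) frag_of" unfolding open_map_def
  proof (intro allI impI, subst openin_subopen, intro ballI)
    fix U g assume U: "openin X U" "g \<in> frag_of ` U"
    then obtain x where x: "x \<in> U" "g = frag_of x" by blast
    then obtain f where f: "continuous_map X euclideanreal f" "f x = 1" "\<And>y. y \<in> topspace X - U \<Longrightarrow> f y = 0"
      using Tychonoff_separation[OF X U(1)] by metis
    have "openin (FT X) {h \<in> topspace (FT X). lin_ext f h \<in> {0<..}}"
      by (rule openin_continuous_map_preimage[OF continuous_map_lin_ext[OF f(1)]]) simp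
    then have "openin (subtopology (FT X) ?S) ({h \<in> topspace (FT X). lin_ext f h \<in> {0<..}} \<inter> ?S)"
      by (auto simp: openin_subtopology)
    moreover have "g \<in> {h \<in> topspace (FT X). lin_ext f h \<in> {0<..}} \<inter> ?S"
      using x f(2) U(1) openin_subset by fastforce
    moreover have "{h \<in> topspace (FT X). lin_ext f h \<in> {0<..}} \<inter> ?S \<subseteq> frag_of ` U"
    proof
      fix h assume "h \<in> {h \<in> topspace (FT X). lin_ext f h \<in> {0<..}} \<inter> ?S"
      then obtain y where "y \<in> topspace X" "h = frag_of y" "f y > 0" by auto
      then show "h \<in> frag_of ` U" using f(3)[of y] by force
    qed
    ultimately show "\<exists>T. openin (subtopology (FT X) ?S) T \<and> g \<in> T \<and> T \<subseteq> frag_of ` U" by blast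
  qed
qed

section \<open>Words of bounded length\<close>

definition letters :: "'a set \<Rightarrow> ('a \<Rightarrow>\<^sub>0 int) set" where
  "letters K = insert 0 (frag_of ` K \<union> (\<lambda>x. - frag_of x) ` K)"

primrec words :: "'a set \<Rightarrow> nat \<Rightarrow> ('a \<Rightarrow>\<^sub>0 int) set" where
  "words K 0 = {0}"
| "words K (Suc n) = (\<lambda>(a, e). a + e) ` (words K n \<times> letters K)"

lemma words_SucI: "a \<in> words K n \<Longrightarrow> e \<in> letters K \<Longrightarrow> a + e \<in> words K (Suc n)"
  by force

lemma words_SucE:
  assumes "g \<in> words K (Suc n)"
  obtains a e where "a \<in> words K n" "e \<in> letters K" "g = a + e"
  using assms by auto

text \<open>Monotone in the length because zero counts as a letter, so that \<open>words K n\<close>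
  contains all shorter words as well.\<close>

lemma words_mono:
  assumes "K \<subseteq> L" "m \<le> n"
  shows "words K m \<subseteq> words L n"
proof -
  have "letters K \<subseteq> letters L" using assms(1) by (auto simp: letters_def)
  then have 1: "words K k \<subseteq> words L k" for k by (induction k) auto
  have "words L m \<subseteq> words L n" using assms(2)
  proof (induction n rule: dec_induct)
    case (step n)
    moreover have "words L n \<subseteq> words L (Suc n)"
    proof
      fix g assume "g \<in> words L n"
      then have "g + 0 \<in> words L (Suc n)" by (rule words_SucI) (simp add: letters_def)
      then show "g \<in> words L (Suc n)" by (simp only: add_0_right)
    qed
    ultimately show ?case by blast
  qed simp
  then show ?thesis using 1[of m] by blast
qed

lemma words_add: "g \<in> words K m \<Longrightarrow> h \<in> words K n \<Longrightarrow> g + h \<in> words K (m + n)"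
proof (induction n arbitrary: h)
  case (Suc n)
  obtain a e where ae: "a \<in> words K n" "e \<in> letters K" "h = a + e" using Suc.prems(2) by (rule words_SucE)
  have "(g + a) + e \<in> words K (Suc (m + n))" by (rule words_SucI[OF Suc.IH[OF Suc.prems(1) ae(1)] ae(2)])
  then show ?case by (simp only: ae(3) add.assoc add_Suc_right)
qed simp

lemma words_minus: "g \<in> words K n \<Longrightarrow> - g \<in> words K n"
proof (induction n arbitrary: g)
  case (Suc n)
  obtain a e where ae: "a \<in> words K n" "e \<in> letters K" "g = a + e" using Suc.prems by (rule words_SucE)
  have "- e \<in> letters K" using ae(2) by (auto simp: letters_def)
  then have "- a + - e \<in> words K (Suc n)" by (rule words_SucI[OF Suc.IH[OF ae(1)]])
  then show ?case by (simp only: ae(3) minus_add_distrib)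
qed simp

lemma words_exhaust:
  assumes "Poly_Mapping.keys g \<subseteq> K"
  shows "\<exists>n. g \<in> words K n"
  using assms
proof (induction rule: frag_induction)
  case zero
  then show ?case by (intro exI[of _ 0]) simp
next
  case (one x)
  then have "0 + frag_of x \<in> words K (Suc 0)" by (intro words_SucI) (auto simp: letters_def)
  then show ?case by (intro exI[of _ "Suc 0"]) (simp only: add_0_left)
next
  case (diff a b)
  then obtain m n where "a \<in> words K m" "b \<in> words K n" by blast
  then have "a + - b \<in> words K (m + n)" by (intro words_add words_minus)
  then show ?case by (metis add_uminus_conv_diff)
qed

lemma words_keys: "g \<in> words K n \<Longrightarrow> Poly_Mapping.keys g \<subseteq> K"
proof (induction n arbitrary: g)
  case (Suc n)
  obtain a e where ae: "a \<in> words K n" "e \<in> letters K" "g = a + e" using Suc.prems by (rule words_SucE)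
  have "Poly_Mapping.keys e \<subseteq> K" using ae(2) by (auto simp: letters_def)
  then show ?case using keys_add[of a e] Suc.IH[OF ae(1)] ae(3) by blast
qed simp

lemma compactin_FT_plus:
  assumes "compactin (FT X) A" "compactin (FT X) B"
  shows "compactin (FT X) ((\<lambda>(a, b). a + b) ` (A \<times> B))"
proof (rule image_compactin)
  show "compactin (prod_topology (FT X) (FT X)) (A \<times> B)" using assms by (simp add: compactin_Times)
  have "continuous_map (prod_topology (FT X) (FT X)) (FT X) (\<lambda>p. fst p + snd p)"
    by (intro continuous_map_FT_add continuous_map_fst continuous_map_snd)
  then show "continuous_map (prod_topology (FT X) (FT X)) (FT X) (\<lambda>(a, b). a + b)" by (simp add: case_prod_unfold)
qed

lemma compactin_words:
  assumes "compactin X K"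
  shows "compactin (FT X) (words K n)"
proof -
  have "compactin (FT X) (frag_of ` K)" using frag_of_continuous assms by (rule image_compactin[rotated])
  moreover have "compactin (FT X) ((\<lambda>x. - frag_of x) ` K)"
    using continuous_map_FT_minus[OF frag_of_continuous] assms by (rule image_compactin[rotated])
  moreover have "compactin (FT X) {0}" by simp
  ultimately have "compactin (FT X) ({0} \<union> (frag_of ` K \<union> (\<lambda>x. - frag_of x) ` K))" by (intro compactin_Un)
  then have L: "compactin (FT X) (letters K)" by (simp add: letters_def)
  show ?thesis by (induction n) (use L compactin_FT_plus in simp_all)
qed

section \<open>The topology determined by a sequence of subspaces\<close>

definition chain_topology :: "'a topology \<Rightarrow> (nat \<Rightarrow> 'a set) \<Rightarrow> 'a topology" where
  "chain_topology Z D = topology (\<lambda>U. U \<subseteq> topspace Z \<and> (\<forall>n. openin (subtopology Z (D n)) (U \<inter> D n)))"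

lemma openin_chain_topology:
  "openin (chain_topology Z D) U \<longleftrightarrow> U \<subseteq> topspace Z \<and> (\<forall>n. openin (subtopology Z (D n)) (U \<inter> D n))"
proof -
  have "istopology (\<lambda>U. U \<subseteq> topspace Z \<and> (\<forall>n. openin (subtopology Z (D n)) (U \<inter> D n)))"
    unfolding istopology_def
  proof (rule conjI; intro allI impI conjI)
    fix S T n assume *: "S \<subseteq> topspace Z \<and> (\<forall>n. openin (subtopology Z (D n)) (S \<inter> D n))"
      "T \<subseteq> topspace Z \<and> (\<forall>n. openin (subtopology Z (D n)) (T \<inter> D n))"
    then show "S \<inter> T \<subseteq> topspace Z" by blast
    have "openin (subtopology Z (D n)) ((S \<inter> D n) \<inter> (T \<inter> D n))" using * by blast
    moreover have "(S \<inter> D n) \<inter> (T \<inter> D n) = S \<inter> T \<inter> D n" by blast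
    ultimately show "openin (subtopology Z (D n)) (S \<inter> T \<inter> D n)" by simp
  next
    fix \<K> n assume *: "\<forall>K\<in>\<K>. K \<subseteq> topspace Z \<and> (\<forall>n. openin (subtopology Z (D n)) (K \<inter> D n))"
    then show "\<Union>\<K> \<subseteq> topspace Z" by blast
    have "openin (subtopology Z (D n)) (\<Union>K\<in>\<K>. K \<inter> D n)" using * by blast
    moreover have "(\<Union>K\<in>\<K>. K \<inter> D n) = \<Union>\<K> \<inter> D n" by blast
    ultimately show "openin (subtopology Z (D n)) (\<Union>\<K> \<inter> D n)" by (simp only:)
  qed
  then show ?thesis by (simp add: chain_topology_def)
qed

lemma openin_chain_topology_finer: "openin Z U \<Longrightarrow> openin (chain_topology Z D) U"
  unfolding openin_chain_topology by (auto simp: openin_subtopology openin_subset)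

lemma topspace_chain_topology [simp]: "topspace (chain_topology Z D) = topspace Z"
  using openin_chain_topology[of Z D] openin_chain_topology_finer[OF openin_topspace, of Z D]
  by (metis openin_subset openin_topspace subset_antisym)

lemma subtopology_chain_topology: "subtopology (chain_topology Z D) (D n) = subtopology Z (D n)"
  unfolding topology_eq
proof
  fix S
  show "openin (subtopology (chain_topology Z D) (D n)) S = openin (subtopology Z (D n)) S"
  proof
    assume "openin (subtopology (chain_topology Z D) (D n)) S"
    then obtain U where "openin (chain_topology Z D) U" "S = U \<inter> D n" by (auto simp: openin_subtopology)
    then show "openin (subtopology Z (D n)) S" by (simp add: openin_chain_topology)
  next
    assume "openin (subtopology Z (D n)) S"
    then obtain U where "openin Z U" "S = U \<inter> D n" by (auto simp: openin_subtopology)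
    then show "openin (subtopology (chain_topology Z D) (D n)) S"
      using openin_chain_topology_finer by (metis openin_subtopology)
  qed
qed

lemma k_omega_chain_chain_topology:
  assumes "\<And>n. compactin Z (D n)" "incseq D" "(\<Union>n. D n) = topspace Z"
  shows "k_omega_chain (chain_topology Z D) D"
  unfolding k_omega_chain_def
proof (intro conjI allI impI)
  fix n
  show "compactin (chain_topology Z D) (D n)"
    using assms(1)[of n] unfolding compactin_subspace subtopology_chain_topology by simp
qed (use assms in \<open>auto simp: subtopology_chain_topology openin_chain_topology\<close>)

text \<open>The topology of AG(Y) is the finest group topology for which \<open>frag_of\<close> is
  continuous, so a finer one with both properties coincides with it. For the topology determined by
  the sets \<open>D n\<close>, everything reduces to inclusions between them: sums of
  \<open>D n\<close> lie in \<open>D (n + n)\<close>, negation preserves \<open>D n\<close>, and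
  generators from \<open>C n\<close> lie in \<open>D (Suc n)\<close>.\<close>

lemma FT_k_omega_chain:
  assumes Y: "Tychonoff_space Y" and C: "k_omega_chain Y C"
  shows "k_omega_chain (FT Y) (\<lambda>n. words (C n) n)"
proof -
  define D where "D n = words (C n) n" for n
  have D: "compactin (FT Y) (D n)" for n
    unfolding D_def by (rule compactin_words[OF k_omega_chainD(1)[OF C]])
  have Dinc: "incseq D" unfolding D_def by (rule monoI) (intro words_mono k_omega_chainD(2)[OF C])
  have DY: "D n \<subseteq> topspace (FT Y)" for n by (rule compactin_subset_topspace[OF D])
  have Dcov: "(\<Union>n. D n) = topspace (FT Y)"
  proof
    show "topspace (FT Y) \<subseteq> (\<Union>n. D n)"
    proof
      fix g assume "g \<in> topspace (FT Y)"
      then have gY: "Poly_Mapping.keys g \<subseteq> topspace Y" by simp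
      have "\<exists>m. F \<subseteq> C m" if "finite F" "F \<subseteq> topspace Y" for F
        using that
      proof induction
        case (insert x F)
        then obtain m where "F \<subseteq> C m" by blast
        moreover obtain k where "x \<in> C k" using insert.prems k_omega_chainD(3)[OF C] by blast
        ultimately have "insert x F \<subseteq> C (max m k)"
          using k_omega_chainD(2)[OF C, of m "max m k"] k_omega_chainD(2)[OF C, of k "max m k"] by auto
        then show ?case by blast
      qed simp
      then obtain m where m: "Poly_Mapping.keys g \<subseteq> C m" using gY by (meson finite_keys)
      then obtain k where "g \<in> words (C m) k" using words_exhaust by blast
      moreover have "words (C m) k \<subseteq> D (max m k)" unfolding D_def by (intro words_mono k_omega_chainD(2)[OF C]) auto
      ultimately show "g \<in> (\<Union>n. D n)" by blast
    qed
  qed (use DY in blast)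
  let ?\<tau> = "chain_topology (FT Y) D"
  have chain: "k_omega_chain ?\<tau> D" by (rule k_omega_chain_chain_topology[OF D Dinc Dcov])
  have H: "Hausdorff_space ?\<tau>"
    using FT_Hausdorff[OF Y] openin_chain_topology_finer unfolding Hausdorff_space_def topspace_chain_topology by metis
  have plus: "continuous_map (prod_topology ?\<tau> ?\<tau>) ?\<tau> (\<lambda>(x, y). x + y)" unfolding continuous_map_def
  proof (intro conjI allI impI)
    show "(\<lambda>(x, y). x + y) \<in> topspace (prod_topology ?\<tau> ?\<tau>) \<rightarrow> topspace ?\<tau>"
      using keys_add by fastforce
    fix U assume U: "openin ?\<tau> U"
    show "openin (prod_topology ?\<tau> ?\<tau>) {p \<in> topspace (prod_topology ?\<tau> ?\<tau>). (case p of (x, y) \<Rightarrow> x + y) \<in> U}" (is "openin _ ?S")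
    \<comment> \<open>Joint continuity need only be tested on the products
      \<open>D n \<times> D n\<close>, where the topology is the one inherited from AG(Y) and
      addition is known to be continuous.\<close>
    proof (rule k_omega_chain_prod_openI[OF chain H])
      show "?S \<subseteq> topspace ?\<tau> \<times> topspace ?\<tau>" by auto
      fix n
      let ?P = "subtopology (prod_topology (FT Y) (FT Y)) (D n \<times> D n)"
      have "continuous_map (prod_topology (FT Y) (FT Y)) (FT Y) (\<lambda>p. fst p + snd p)"
        by (intro continuous_map_FT_add continuous_map_fst continuous_map_snd)
      then have "continuous_map ?P (FT Y) (\<lambda>p. fst p + snd p)" by (rule continuous_map_from_subtopology)
      moreover have "(\<lambda>p. fst p + snd p) ` topspace ?P \<subseteq> D (n + n)"
      proof clarsimp
        fix a b assume "a \<in> D n" "b \<in> D n"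
        then have "a + b \<in> words (C n) (n + n)" unfolding D_def by (rule words_add)
        moreover have "words (C n) (n + n) \<subseteq> D (n + n)" unfolding D_def by (intro words_mono k_omega_chainD(2)[OF C]) auto
        ultimately show "a + b \<in> D (n + n)" by blast
      qed
      ultimately have "continuous_map ?P (subtopology (FT Y) (D (n + n))) (\<lambda>p. fst p + snd p)"
        by (auto simp: continuous_map_in_subtopology)
      moreover have "openin (subtopology (FT Y) (D (n + n))) (U \<inter> D (n + n))" using U by (simp add: openin_chain_topology)
      ultimately have "openin ?P {p \<in> topspace ?P. fst p + snd p \<in> U \<inter> D (n + n)}" by (rule openin_continuous_map_preimage)
      moreover have "{p \<in> topspace ?P. fst p + snd p \<in> U \<inter> D (n + n)} = ?S \<inter> D n \<times> D n"
        using \<open>(\<lambda>p. fst p + snd p) ` topspace ?P \<subseteq> D (n + n)\<close> by (auto simp: image_subset_iff)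
      moreover have "?P = subtopology (prod_topology ?\<tau> ?\<tau>) (D n \<times> D n)"
        by (simp add: subtopology_Times subtopology_chain_topology)
      ultimately show "openin (subtopology (prod_topology ?\<tau> ?\<tau>) (D n \<times> D n)) (?S \<inter> D n \<times> D n)" by simp
    qed
  qed
  have minus: "continuous_map ?\<tau> ?\<tau> (\<lambda>x. - x)" unfolding continuous_map_def
  proof (intro conjI allI impI)
    show "(\<lambda>x. - x) \<in> topspace ?\<tau> \<rightarrow> topspace ?\<tau>" by simp
    fix U assume U: "openin ?\<tau> U"
    show "openin ?\<tau> {x \<in> topspace ?\<tau>. - x \<in> U}" unfolding openin_chain_topology
    proof (intro conjI allI)
      fix n
      have "continuous_map (FT Y) (FT Y) (\<lambda>h. - h)" using continuous_map_FT_minus[of "FT Y" Y "\<lambda>h. h"] by simp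
      then have "continuous_map (subtopology (FT Y) (D n)) (FT Y) (\<lambda>h. - h)" by (rule continuous_map_from_subtopology)
      then have "continuous_map (subtopology (FT Y) (D n)) (subtopology (FT Y) (D n)) (\<lambda>h. - h)"
        unfolding continuous_map_in_subtopology D_def using words_minus by fastforce
      moreover have "openin (subtopology (FT Y) (D n)) (U \<inter> D n)" using U by (simp add: openin_chain_topology)
      ultimately have "openin (subtopology (FT Y) (D n)) {x \<in> topspace (subtopology (FT Y) (D n)). - x \<in> U \<inter> D n}"
        by (rule openin_continuous_map_preimage)
      moreover have "{x \<in> topspace (subtopology (FT Y) (D n)). - x \<in> U \<inter> D n} = {x \<in> topspace ?\<tau>. - x \<in> U} \<inter> D n"
        using words_minus[of _ "C n" n] by (auto simp: D_def)
      ultimately show "openin (subtopology (FT Y) (D n)) ({x \<in> topspace ?\<tau>. - x \<in> U} \<inter> D n)" by simp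
    qed auto
  qed
  have group: "topological_abelian_group (free_Abelian_group (topspace Y)) ?\<tau>"
    unfolding topological_abelian_group_def
  proof (intro conjI)
    show "topspace ?\<tau> = carrier (free_Abelian_group (topspace Y))"
      by (simp add: topspace_free_group_topology)
    show "continuous_map ?\<tau> ?\<tau> (\<lambda>x. inv\<^bsub>free_Abelian_group (topspace Y)\<^esub> x)"
      using minus by (rule continuous_map_eq) simp
    show "continuous_map (prod_topology ?\<tau> ?\<tau>) ?\<tau> (\<lambda>(x, y). x \<otimes>\<^bsub>free_Abelian_group (topspace Y)\<^esub> y)"
      using plus by simp
  qed (rule abelian_free_Abelian_group)
  have frag: "continuous_map Y ?\<tau> frag_of" unfolding continuous_map_def
  proof (intro conjI allI impI)
    fix U assume U: "openin ?\<tau> U"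
    show "openin Y {y \<in> topspace Y. frag_of y \<in> U}"
    proof (rule k_omega_chainD(5)[OF C])
      fix n
      have sub: "frag_of y \<in> D (Suc n)" if "y \<in> C n" for y
      proof -
        have "0 + frag_of y \<in> words (C n) (Suc 0)" using that by (intro words_SucI) (auto simp: letters_def)
        moreover have "words (C n) (Suc 0) \<subseteq> D (Suc n)" unfolding D_def by (intro words_mono k_omega_chainD(2)[OF C]) auto
        ultimately show ?thesis by (metis add_0_left subsetD)
      qed
      have "continuous_map (subtopology Y (C n)) (FT Y) frag_of" using frag_of_continuous by (rule continuous_map_from_subtopology)
      then have "continuous_map (subtopology Y (C n)) (subtopology (FT Y) (D (Suc n))) frag_of"
        unfolding continuous_map_in_subtopology using sub by auto
      moreover have "openin (subtopology (FT Y) (D (Suc n))) (U \<inter> D (Suc n))" using U by (simp add: openin_chain_topology)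
      ultimately have "openin (subtopology Y (C n)) {y \<in> topspace (subtopology Y (C n)). frag_of y \<in> U \<inter> D (Suc n)}"
        by (rule openin_continuous_map_preimage)
      moreover have "{y \<in> topspace (subtopology Y (C n)). frag_of y \<in> U \<inter> D (Suc n)} = {y \<in> topspace Y. frag_of y \<in> U} \<inter> C n"
        using sub by auto
      ultimately show "openin (subtopology Y (C n)) ({y \<in> topspace Y. frag_of y \<in> U} \<inter> C n)" by simp
    qed blast
  qed auto
  \<comment> \<open>Universality of AG(Y) gives the reverse comparison: the finer topology is also
    coarser.\<close>
  have id: "continuous_map (FT Y) ?\<tau> id" by (rule continuous_map_from_free_group_topology[OF group frag])
  have fin: "openin (FT Y) U" if U: "openin ?\<tau> U" for U
  proof -
    have "openin (FT Y) {x \<in> topspace (FT Y). id x \<in> U}" using id U by (rule openin_continuous_map_preimage)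
    moreover have "{x \<in> topspace (FT Y). id x \<in> U} = U" using openin_subset[OF U] by (auto simp del: in_topspace_FT)
    ultimately show ?thesis by simp
  qed
  have "k_omega_chain (FT Y) D" unfolding k_omega_chain_def
    using D Dinc Dcov fin by (auto simp: openin_chain_topology)
  then show ?thesis by (simp add: D_def[abs_def])
qed

text \<open>Addition is continuous, so the sums of a network for words of length \<open>n\<close>
  and a network for letters form a network for words of length \<open>Suc n\<close>. All these
  networks are countable.\<close>

lemma FT_cosmic:
  assumes Y: "Tychonoff_space Y" "cosmic_space Y"
  shows "cosmic_space (FT Y)"
proof -
  obtain \<N> where \<N>: "countable \<N>" "network_in Y \<N>" using Y(2) by (auto simp: cosmic_space_def)
  have NY: "N \<subseteq> topspace Y" if "N \<in> \<N>" for N using \<N>(2) that unfolding network_in_def by blast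
  define \<E> where "\<E> = insert {0} ((\<lambda>N. frag_of ` N) ` \<N> \<union> (\<lambda>N. (\<lambda>x. - frag_of x) ` N) ` \<N>)"
  \<comment> \<open>The recursion follows that of \<open>words\<close>, with the countable network
    \<open>\<E>\<close> for the letters in place of the set of letters.\<close>
  define \<W> where "\<W> = rec_nat {{0}} (\<lambda>_ \<W>. (\<lambda>(P, E). (\<lambda>(a, e). a + e) ` (P \<times> E)) ` (\<W> \<times> \<E>))"
  have W0: "\<W> 0 = {{0}}" and WS: "\<W> (Suc n) = (\<lambda>(P, E). (\<lambda>(a, e). a + e) ` (P \<times> E)) ` (\<W> n \<times> \<E>)" for n
    by (simp_all add: \<W>_def)
  have cE: "countable \<E>" using \<N>(1) by (simp add: \<E>_def)
  have cW: "countable (\<W> n)" for n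
    by (induction n) (use cE in \<open>simp_all add: W0 WS\<close>)
  have EY: "E \<subseteq> topspace (FT Y)" if "E \<in> \<E>" for E using that NY by (fastforce simp: \<E>_def)
  have WY: "P \<subseteq> topspace (FT Y)" if "P \<in> \<W> n" for P n
    using that
  proof (induction n arbitrary: P)
    case (Suc n)
    then obtain Q E where "Q \<in> \<W> n" "E \<in> \<E>" "P = (\<lambda>(a, e). a + e) ` (Q \<times> E)" by (auto simp: WS)
    then have "Q \<subseteq> topspace (FT Y)" "E \<subseteq> topspace (FT Y)" using Suc.IH EY by blast+
    then have "a + e \<in> topspace (FT Y)" if "a \<in> Q" "e \<in> E" for a e
      using that keys_add[of a e] in_topspace_FT by blast
    then show ?case using \<open>P = _\<close> by auto
  qed (simp add: W0)
  have netE: "\<exists>E\<in>\<E>. e \<in> E \<and> E \<subseteq> U" if e: "e \<in> letters (topspace Y)" and U: "openin (FT Y) U" "e \<in> U" for e U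
  proof -
    have cm: "continuous_map Y (FT Y) (\<lambda>x. - frag_of x)" by (rule continuous_map_FT_minus[OF frag_of_continuous])
    have o: "openin Y {y \<in> topspace Y. frag_of y \<in> U}" "openin Y {y \<in> topspace Y. - frag_of y \<in> U}"
      by (rule openin_continuous_map_preimage[OF frag_of_continuous U(1)], rule openin_continuous_map_preimage[OF cm U(1)])
    have net: "\<exists>N\<in>\<N>. y \<in> N \<and> N \<subseteq> V" if "openin Y V" "y \<in> V" for y V
      using \<N>(2) that unfolding network_in_def by blast
    consider "e = 0" | y where "y \<in> topspace Y" "e = frag_of y" | y where "y \<in> topspace Y" "e = - frag_of y"
      using e by (auto simp: letters_def)
    then show ?thesis
    proof cases
      case 1
      then show ?thesis using U(2) by (intro bexI[of _ "{0}"]) (auto simp: \<E>_def)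
    next
      case 2
      then obtain N where "N \<in> \<N>" "y \<in> N" "N \<subseteq> {y \<in> topspace Y. frag_of y \<in> U}" using net[OF o(1), of y] U(2) by auto
      then show ?thesis using 2 by (intro bexI[of _ "frag_of ` N"]) (auto simp: \<E>_def)
    next
      case 3
      then obtain N where "N \<in> \<N>" "y \<in> N" "N \<subseteq> {y \<in> topspace Y. - frag_of y \<in> U}" using net[OF o(2), of y] U(2) by auto
      then show ?thesis using 3 by (intro bexI[of _ "(\<lambda>x. - frag_of x) ` N"]) (auto simp: \<E>_def)
    qed
  qed
  have net: "\<exists>P\<in>\<W> n. g \<in> P \<and> P \<subseteq> U" if "g \<in> words (topspace Y) n" "openin (FT Y) U" "g \<in> U" for g n U
    using that
  proof (induction n arbitrary: g U)
    case (Suc n)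
    obtain a e where ae: "a \<in> words (topspace Y) n" "e \<in> letters (topspace Y)" "g = a + e" using Suc.prems(1) by (rule words_SucE)
    let ?P = "prod_topology (FT Y) (FT Y)"
    have eY: "e \<in> topspace (FT Y)" using ae(2) by (auto simp: letters_def)
    have aY: "a \<in> topspace (FT Y)" using words_keys[OF ae(1)] by simp
    have "continuous_map ?P (FT Y) (\<lambda>p. fst p + snd p)"
      by (intro continuous_map_FT_add continuous_map_fst continuous_map_snd)
    then have op: "openin ?P {p \<in> topspace ?P. fst p + snd p \<in> U}" (is "openin _ ?S")
      using Suc.prems(2) by (rule openin_continuous_map_preimage)
    have "(a, e) \<in> ?S" using aY eY Suc.prems(3) ae(3) by simp
    then have "\<exists>A B. openin (FT Y) A \<and> openin (FT Y) B \<and> a \<in> A \<and> e \<in> B \<and> A \<times> B \<subseteq> ?S"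
      using op[unfolded openin_prod_topology_alt] by simp
    then obtain A B where AB: "openin (FT Y) A" "openin (FT Y) B" "a \<in> A" "e \<in> B" "A \<times> B \<subseteq> ?S" by (elim exE conjE)
    obtain P where P: "P \<in> \<W> n" "a \<in> P" "P \<subseteq> A" using Suc.IH[OF ae(1) AB(1,3)] by blast
    obtain E where E: "E \<in> \<E>" "e \<in> E" "E \<subseteq> B" using netE[OF ae(2) AB(2,4)] by blast
    have "(\<lambda>(a, e). a + e) ` (P \<times> E) \<in> \<W> (Suc n)" using P(1) E(1) by (auto simp: WS)
    moreover have "g \<in> (\<lambda>(a, e). a + e) ` (P \<times> E)" using P(2) E(2) ae(3) by auto
    moreover have "a' + e' \<in> U" if "a' \<in> P" "e' \<in> E" for a' e'
    proof -
      have "(a', e') \<in> ?S" using AB(5) P(3) E(3) that by blast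
      then show ?thesis by simp
    qed
    ultimately show ?case by (intro bexI[of _ "(\<lambda>(a, e). a + e) ` (P \<times> E)"]) auto
  qed (simp add: W0)
  have "network_in (FT Y) (\<Union>n. \<W> n)" unfolding network_in_def
  proof (intro conjI allI impI)
    show "(\<Union>n. \<W> n) \<subseteq> Pow (topspace (FT Y))" using WY by blast
    fix g U assume U: "openin (FT Y) U \<and> g \<in> U"
    then have "g \<in> topspace (FT Y)" using openin_subset by blast
    then have "Poly_Mapping.keys g \<subseteq> topspace Y" by simp
    from words_exhaust[OF this] obtain n where "g \<in> words (topspace Y) n" ..
    then obtain P where "P \<in> \<W> n" "g \<in> P \<and> P \<subseteq> U" using net[of g n U] U by blast
    then show "\<exists>N\<in>\<Union>n. \<W> n. g \<in> N \<and> N \<subseteq> U" by (intro bexI[of _ P] UN_I[of n]) simp_all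
  qed
  moreover have "countable (\<Union>n. \<W> n)" using cW by blast
  moreover have "regular_t1_space (FT Y)"
    using FT_regular FT_Hausdorff[OF Y(1)] by (simp add: regular_t1_space_def Hausdorff_imp_t1_space)
  ultimately show ?thesis unfolding cosmic_space_def by (intro conjI exI[of _ "\<Union>n. \<W> n"])
qed

section \<open>The equivalence\<close>

text \<open>Identifies the homomorphism of the universal property with the explicit
  \<open>frag_extend f\<close>, whose continuity can then be used in computations.\<close>

lemma FT_universal:
  assumes T: "topological_abelian_group (free_Abelian_group S) T" and f: "continuous_map X T f"
  shows "continuous_map (FT X) T (frag_extend f)"
proof -
  let ?A = "free_Abelian_group (topspace X)" and ?H = "free_Abelian_group S"
  obtain h where h: "h \<in> hom ?A ?H" "continuous_map (FT X) T h" "\<And>x. x \<in> topspace X \<Longrightarrow> h (frag_of x) = f x"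
    by (rule universal_for_obtain[OF free_group_universal T f]) metis
  have TS: "topspace T = carrier ?H" using T by (simp add: topological_abelian_group_def)
  have fS: "Poly_Mapping.keys (f x) \<subseteq> S" if "x \<in> topspace X" for x
  proof -
    have "f x \<in> carrier ?H" using continuous_map_image_subset_topspace[OF f] that TS by blast
    then show ?thesis by simp
  qed
  have e: "frag_extend f \<in> hom ?A ?H"
  proof (rule homI)
    fix g assume "g \<in> carrier ?A"
    then have "Poly_Mapping.keys g \<subseteq> topspace X" by simp
    then have "Poly_Mapping.keys (frag_extend f g) \<subseteq> S" using keys_frag_extend[of f g] fS by blast
    then show "frag_extend f g \<in> carrier ?H" by simp
  qed (simp add: frag_extend_add)
  have "h g = frag_extend f g" if "Poly_Mapping.keys g \<subseteq> topspace X" for g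
    by (rule hom_free_Abelian_group_eqI[OF group_free_Abelian_group h(1) e _ that]) (simp add: h(3))
  then show ?thesis using h(2) by (auto intro: continuous_map_eq)
qed

lemma topological_abelian_group_discrete:
  assumes "comm_group G"
  shows "topological_abelian_group G (discrete_topology (carrier G))"
proof -
  interpret comm_group G by fact
  show ?thesis unfolding topological_abelian_group_def
    using assms by (auto simp: prod_topology_discrete_topology[symmetric])
qed

section \<open>Splitting off the discrete summand\<close>

definition restrict_frag :: "'a set \<Rightarrow> ('a \<Rightarrow>\<^sub>0 int) \<Rightarrow> ('a \<Rightarrow>\<^sub>0 int)" where
  "restrict_frag S = frag_extend (\<lambda>x. if x \<in> S then frag_of x else 0)"

lemma restrict_frag_add: "restrict_frag S (g + h) = restrict_frag S g + restrict_frag S h"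
  by (simp add: restrict_frag_def frag_extend_add)

lemma restrict_frag_ident: "Poly_Mapping.keys g \<subseteq> S \<Longrightarrow> restrict_frag S g = g"
proof -
  assume "Poly_Mapping.keys g \<subseteq> S"
  then have "restrict_frag S g = frag_extend frag_of g" unfolding restrict_frag_def by (intro frag_extend_eq) auto
  then show ?thesis using frag_expansion[of g] by simp
qed

lemma restrict_frag_disjoint: "Poly_Mapping.keys g \<inter> S = {} \<Longrightarrow> restrict_frag S g = 0"
  unfolding restrict_frag_def by (intro frag_extend_eq_0) auto

text \<open>Both projections extend maps of \<open>X\<close> that send one summand to generators and
  the other to zero; these are continuous because \<open>Y\<close> is clopen and its complement
  discrete. The inverse is addition, with the inclusion of the group of \<open>Y\<close> continuous
  by universality.\<close>

lemma FT_decomposition: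
  assumes Y: "openin X Y" and D: "\<And>A. A \<subseteq> topspace X - Y \<Longrightarrow> openin X A"
  shows "homeomorphic_maps (FT X)
    (prod_topology (discrete_topology (carrier (free_Abelian_group (topspace X - Y)))) (FT (subtopology X Y)))
    (\<lambda>g. (restrict_frag (topspace X - Y) g, restrict_frag Y g)) (\<lambda>(d, y). d + y)"
proof -
  let ?D = "topspace X - Y" and ?Y = "subtopology X Y"
  let ?AD = "free_Abelian_group ?D"
  have YX: "Y \<subseteq> topspace X" using Y by (rule openin_subset)
  have tY: "topspace ?Y = Y" using YX by auto
  have "continuous_map X (discrete_topology (carrier ?AD)) (\<lambda>x. if x \<in> ?D then frag_of x else 0)"
    unfolding continuous_map_def
  proof (intro conjI allI impI)
    show "(\<lambda>x. if x \<in> ?D then frag_of x else 0) \<in> topspace X \<rightarrow> topspace (discrete_topology (carrier ?AD))"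
      by (auto simp: Pi_iff)
    fix U :: "('a \<Rightarrow>\<^sub>0 int) set"
    have "{x \<in> topspace X. (if x \<in> ?D then frag_of x else 0) \<in> U} = {x \<in> ?D. frag_of x \<in> U} \<union> (if 0 \<in> U then Y else {})"
      using YX by auto
    moreover have "openin X ({x \<in> ?D. frag_of x \<in> U} \<union> (if 0 \<in> U then Y else {}))"
      using Y D[of "{x \<in> ?D. frag_of x \<in> U}"] by auto
    ultimately show "openin X {x \<in> topspace X. (if x \<in> ?D then frag_of x else 0) \<in> U}" by simp
  qed
  then have rD: "continuous_map (FT X) (discrete_topology (carrier ?AD)) (restrict_frag ?D)"
    unfolding restrict_frag_def
    by (rule FT_universal[OF topological_abelian_group_discrete[OF abelian_free_Abelian_group]])
  have "continuous_map X (FT ?Y) (\<lambda>x. if x \<in> Y then frag_of x else 0)"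
    unfolding continuous_map_def
  proof (intro conjI allI impI)
    show "(\<lambda>x. if x \<in> Y then frag_of x else 0) \<in> topspace X \<rightarrow> topspace (FT ?Y)"
      using YX by (auto simp: Pi_iff)
    fix U assume U: "openin (FT ?Y) U"
    have "openin ?Y {x \<in> topspace ?Y. frag_of x \<in> U}" using frag_of_continuous U by (rule openin_continuous_map_preimage)
    then have "openin ?Y {x \<in> Y. frag_of x \<in> U}" by (simp only: tY)
    then have "openin X {x \<in> Y. frag_of x \<in> U}" using Y by (simp add: openin_open_subtopology)
    then have "openin X ({x \<in> Y. frag_of x \<in> U} \<union> (if 0 \<in> U then ?D else {}))" using D[of ?D] by auto
    moreover have "{x \<in> topspace X. (if x \<in> Y then frag_of x else 0) \<in> U} = {x \<in> Y. frag_of x \<in> U} \<union> (if 0 \<in> U then ?D else {})"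
      using YX by auto
    ultimately show "openin X {x \<in> topspace X. (if x \<in> Y then frag_of x else 0) \<in> U}" by simp
  qed
  then have rY: "continuous_map (FT X) (FT ?Y) (restrict_frag Y)"
    unfolding restrict_frag_def by (rule FT_universal[OF free_group_topology_group])
  have "continuous_map ?Y (FT X) frag_of" using frag_of_continuous by (rule continuous_map_from_subtopology)
  then have "continuous_map (FT ?Y) (FT X) (frag_extend frag_of)" by (rule FT_universal[OF free_group_topology_group])
  then have iY: "continuous_map (FT ?Y) (FT X) (\<lambda>y. y)"
    by (rule continuous_map_eq) (rule frag_expansion[symmetric])
  have iD: "continuous_map (discrete_topology (carrier ?AD)) (FT X) (\<lambda>d. d)" by (auto simp: Pi_iff)
  let ?P = "prod_topology (discrete_topology (carrier ?AD)) (FT ?Y)"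
  have "continuous_map ?P (FT X) (\<lambda>p. fst p + snd p)"
    using continuous_map_compose[OF continuous_map_fst iD, of "FT ?Y"]
      continuous_map_compose[OF continuous_map_snd iY, of "discrete_topology (carrier ?AD)"]
    by (intro continuous_map_FT_add) (simp_all add: o_def)
  moreover have "restrict_frag ?D g + restrict_frag Y g = g" if "Poly_Mapping.keys g \<subseteq> topspace X" for g
  proof -
    have "Poly_Mapping.keys g \<subseteq> ?D \<union> Y" using that by blast
    then obtain d e where de: "Poly_Mapping.keys d \<subseteq> ?D" "Poly_Mapping.keys e \<subseteq> Y" "d + e = g" by (rule frag_split)
    then have "restrict_frag ?D g = d" "restrict_frag Y g = e"
      using restrict_frag_ident[OF de(1)] restrict_frag_ident[OF de(2)] restrict_frag_disjoint[of e ?D] restrict_frag_disjoint[of d Y]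
        restrict_frag_add[of ?D d e] restrict_frag_add[of Y d e] by auto
    then show ?thesis using de(3) by simp
  qed
  moreover have "restrict_frag ?D (d + e) = d" "restrict_frag Y (d + e) = e"
    if "Poly_Mapping.keys d \<subseteq> ?D" "Poly_Mapping.keys e \<subseteq> Y" for d e
    using restrict_frag_ident[OF that(1)] restrict_frag_ident[OF that(2)] restrict_frag_disjoint[of e ?D] restrict_frag_disjoint[of d Y]
        restrict_frag_add[of ?D d e] restrict_frag_add[of Y d e] that by auto
  ultimately show ?thesis unfolding homeomorphic_maps_def
    using continuous_map_pairedI[OF rD rY] by (auto simp: case_prod_unfold tY Int_absorb1[OF YX])
qed

section \<open>Homeomorphism invariance and the topological sum\<close>

lemma homeomorphic_cosmic_space:
  assumes "Z homeomorphic_space W" "cosmic_space Z"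
  shows "cosmic_space W"
proof -
  obtain f g where fg: "homeomorphic_maps Z W f g" using assms(1) unfolding homeomorphic_space_def by blast
  then have f: "continuous_map Z W f" "\<And>x. x \<in> topspace Z \<Longrightarrow> g (f x) = x" and g: "continuous_map W Z g" "\<And>y. y \<in> topspace W \<Longrightarrow> f (g y) = y"
    by (auto simp: homeomorphic_maps_def)
  obtain \<N> where \<N>: "countable \<N>" "network_in Z \<N>" using assms(2) by (auto simp: cosmic_space_def)
  have "network_in W ((`) f ` \<N>)" unfolding network_in_def
  proof (intro conjI allI impI)
    have "N \<subseteq> topspace Z" if "N \<in> \<N>" for N using \<N>(2) that unfolding network_in_def by blast
    then show "(`) f ` \<N> \<subseteq> Pow (topspace W)" using continuous_map_image_subset_topspace[OF f(1)] by blast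
    fix y U assume U: "openin W U \<and> y \<in> U"
    then have yW: "y \<in> topspace W" using openin_subset by blast
    have "openin Z {x \<in> topspace Z. f x \<in> U}" using f(1) U by (intro openin_continuous_map_preimage) auto
    moreover have "g y \<in> {x \<in> topspace Z. f x \<in> U}" using U g(2)[OF yW] continuous_map_image_subset_topspace[OF g(1)] yW by auto
    ultimately obtain N where "N \<in> \<N>" "g y \<in> N" "N \<subseteq> {x \<in> topspace Z. f x \<in> U}" using \<N>(2) unfolding network_in_def by meson
    then show "\<exists>M\<in>(`) f ` \<N>. y \<in> M \<and> M \<subseteq> U" using g(2)[OF yW] by (intro bexI[of _ "f ` N"]) force+
  qed
  moreover have "regular_t1_space W"
    using assms homeomorphic_regular_space homeomorphic_t1_space unfolding cosmic_space_def regular_t1_space_def by blast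
  ultimately show ?thesis using \<N>(1) unfolding cosmic_space_def by (intro conjI exI[of _ "(`) f ` \<N>"]) auto
qed

lemma homeomorphic_k_omega_space:
  assumes "Z homeomorphic_space W" "k_omega_space Z"
  shows "k_omega_space W"
proof -
  obtain f g where fg: "homeomorphic_maps Z W f g" using assms(1) unfolding homeomorphic_space_def by blast
  then have f: "continuous_map Z W f" "\<And>x. x \<in> topspace Z \<Longrightarrow> g (f x) = x" and g: "continuous_map W Z g" "\<And>y. y \<in> topspace W \<Longrightarrow> f (g y) = y"
    by (auto simp: homeomorphic_maps_def)
  note fim = continuous_map_image_subset_topspace[OF f(1)] and gim = continuous_map_image_subset_topspace[OF g(1)]
  obtain C where C: "k_omega_chain Z C" using k_omega_space_imp_chain[OF assms(2)] .
  note D = k_omega_chainD[OF C]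
  have "k_omega_chain W (\<lambda>n. f ` C n)" unfolding k_omega_chain_def
  proof (intro conjI allI impI)
    show "compactin W (f ` C n)" for n using f(1) D(1) by (rule image_compactin[rotated])
    show "incseq (\<lambda>n. f ` C n)" using D(2) by (intro monoI image_mono)
    have "f ` (\<Union>n. C n) = topspace W"
    proof -
      have "(\<Union>n. C n) = topspace Z" using C by (simp add: k_omega_chain_def)
      then show ?thesis using fim gim g(2) by force
    qed
    then show "(\<Union>n. f ` C n) = topspace W" by blast
    fix U assume U: "U \<subseteq> topspace W \<and> (\<forall>n. openin (subtopology W (f ` C n)) (U \<inter> f ` C n))"
    have "openin Z {x \<in> topspace Z. f x \<in> U}"
    proof (rule D(5))
      fix n
      obtain V where V: "openin W V" "U \<inter> f ` C n = V \<inter> f ` C n" using U by (metis openin_subtopology)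
      have "openin Z {x \<in> topspace Z. f x \<in> V}" using f(1) V(1) by (rule openin_continuous_map_preimage)
      moreover have "{x \<in> topspace Z. f x \<in> U} \<inter> C n = {x \<in> topspace Z. f x \<in> V} \<inter> C n" using V(2) by blast
      ultimately show "openin (subtopology Z (C n)) ({x \<in> topspace Z. f x \<in> U} \<inter> C n)" by (auto simp: openin_subtopology)
    qed blast
    then have "openin W {y \<in> topspace W. g y \<in> {x \<in> topspace Z. f x \<in> U}}" by (rule openin_continuous_map_preimage[OF g(1)])
    moreover have "{y \<in> topspace W. g y \<in> {x \<in> topspace Z. f x \<in> U}} = U"
      using U g(2) gim by auto
    ultimately show "openin W U" by simp
  qed
  then show ?thesis by (rule k_omega_chain_imp_space)
qed

text \<open>Both summands live on the point type of \<open>X\<close>, as condition (1) demands; a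
  point is tagged by whether it belongs to the discrete part.\<close>

lemma decomposition_imp_homeomorphic_sum:
  fixes X :: "'a topology"
  assumes "discrete_cosmic_decomposition X Y"
  shows "\<exists>(D :: 'a set) (K :: 'a topology). cosmic_space K \<and> k_omega_space K \<and>
       X homeomorphic_space sum_topology (\<lambda>b. if b then discrete_topology D else K) (UNIV :: bool set)"
proof -
  let ?D = "topspace X - Y" and ?K = "subtopology X Y"
  let ?S = "sum_topology (\<lambda>b. if b then discrete_topology ?D else ?K) (UNIV :: bool set)"
  have Y: "openin X Y" and D: "\<And>A. A \<subseteq> ?D \<Longrightarrow> openin X A" and K: "cosmic_space ?K" "k_omega_space ?K"
    using assms unfolding discrete_cosmic_decomposition_def by blast+
  have YX: "Y \<subseteq> topspace X" using Y by (rule openin_subset)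
  have "homeomorphic_maps X ?S (\<lambda>x. (x \<in> ?D, x)) snd" unfolding homeomorphic_maps_def
  proof (intro conjI)
    show "continuous_map X ?S (\<lambda>x. (x \<in> ?D, x))" unfolding continuous_map_def
    proof (intro conjI allI impI)
      show "(\<lambda>x. (x \<in> ?D, x)) \<in> topspace X \<rightarrow> topspace ?S" using YX by auto
      fix U assume SU: "openin ?S U"
      then have "openin (if b then discrete_topology ?D else ?K) {x. (b, x) \<in> U}" for b
        unfolding openin_sum_topology by blast
      from this[of True] this[of False] openin_subset[OF SU]
      have U: "U \<subseteq> topspace ?S" "openin (discrete_topology ?D) {x. (True, x) \<in> U}" "openin ?K {x. (False, x) \<in> U}"
        by simp_all
      have "openin X {x. (False, x) \<in> U}" using U(3) Y by (simp add: openin_open_subtopology)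
      moreover have "openin X {x. (True, x) \<in> U}" using U(2) D by simp
      moreover have "{x \<in> topspace X. (x \<in> ?D, x) \<in> U} = {x. (True, x) \<in> U} \<union> {x. (False, x) \<in> U}"
      proof -
        have "x \<in> ?D" if "(True, x) \<in> U" for x using subsetD[OF U(1) that] by auto
        moreover have "x \<in> Y" if "(False, x) \<in> U" for x using subsetD[OF U(1) that] by auto
        ultimately show ?thesis using YX by auto (metis DiffI)+
      qed
      ultimately show "openin X {x \<in> topspace X. (x \<in> ?D, x) \<in> U}" by auto
    qed
    show "continuous_map ?S X snd" unfolding continuous_map_def
    proof (intro conjI allI impI)
      show "snd \<in> topspace ?S \<rightarrow> topspace X" using YX by (auto split: if_splits)
      fix V assume V: "openin X V"
      have "openin ?K {x. (False, x) \<in> {p \<in> topspace ?S. snd p \<in> V}}"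
      proof -
        have "{x. (False, x) \<in> {p \<in> topspace ?S. snd p \<in> V}} = V \<inter> Y" using YX openin_subset[OF V] by auto
        then show ?thesis using V by (auto simp: openin_subtopology)
      qed
      moreover have "openin (discrete_topology ?D) {x. (True, x) \<in> {p \<in> topspace ?S. snd p \<in> V}}" by auto
      ultimately show "openin ?S {p \<in> topspace ?S. snd p \<in> V}"
        unfolding openin_sum_topology by (auto split: if_splits)
    qed
  qed auto
  then have hs: "X homeomorphic_space ?S" unfolding homeomorphic_space_def by blast
  show ?thesis by (rule exI[of _ ?D], rule exI[of _ ?K]) (intro conjI K hs)
qed

lemma homeomorphic_sum_imp_decomposition:
  assumes K: "cosmic_space K" "k_omega_space K"
    and h: "X homeomorphic_space sum_topology (\<lambda>b. if b then discrete_topology D else K) (UNIV :: bool set)"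
  shows "\<exists>Y. discrete_cosmic_decomposition X Y"
proof -
  let ?S = "sum_topology (\<lambda>b. if b then discrete_topology D else K) (UNIV :: bool set)"
  obtain f g where "homeomorphic_maps X ?S f g" using h unfolding homeomorphic_space_def by blast
  then have f: "continuous_map X ?S f" "\<And>x. x \<in> topspace X \<Longrightarrow> g (f x) = x"
    and g: "continuous_map ?S X g" "\<And>y. y \<in> topspace ?S \<Longrightarrow> f (g y) = y"
    by (auto simp: homeomorphic_maps_def)
  note fim = continuous_map_image_subset_topspace[OF f(1)] and gim = continuous_map_image_subset_topspace[OF g(1)]
  have tS: "p \<in> topspace ?S \<longleftrightarrow> (if fst p then snd p \<in> D else snd p \<in> topspace K)" for p
    by (cases p) auto
  have op: "openin ?S U" if "U \<subseteq> topspace ?S" "openin K {x. (False, x) \<in> U}" for U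
    unfolding openin_sum_topology using that tS by (auto split: if_splits)
  define Y where "Y = {x \<in> topspace X. f x \<in> {p \<in> topspace ?S. \<not> fst p}}"
  have "{x. (False, x) \<in> {p \<in> topspace ?S. \<not> fst p}} = topspace K" using tS by auto
  then have "openin ?S {p \<in> topspace ?S. \<not> fst p}" by (intro op) auto
  then have Yo: "openin X Y" unfolding Y_def by (rule openin_continuous_map_preimage[OF f(1)])
  have Do: "openin X A" if A: "A \<subseteq> topspace X - Y" for A
  proof -
    have fA: "fst (f x)" "f x \<in> topspace ?S" if "x \<in> A" for x using A that fim unfolding Y_def by blast+
    then have "{x. (False, x) \<in> f ` A} = {}" by force
    moreover have "f ` A \<subseteq> topspace ?S" using fA(2) by blast
    ultimately have "openin ?S (f ` A)" by (intro op) simp_all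
    then have "openin X {x \<in> topspace X. f x \<in> f ` A}" by (rule openin_continuous_map_preimage[OF f(1)])
    moreover have "{x \<in> topspace X. f x \<in> f ` A} = A" using A f(2) by (auto simp: image_iff) (metis DiffD1 subsetD)
    ultimately show ?thesis by simp
  qed
  have "closedin X Y" using Do[of "topspace X - Y"] Yo unfolding closedin_def using openin_subset by blast
  have gY: "g (False, k) \<in> Y" if "k \<in> topspace K" for k
  proof -
    have "(False, k) \<in> topspace ?S" using that tS by simp
    then show ?thesis using gim g(2)[of "(False, k)"] unfolding Y_def by auto
  qed
  have "homeomorphic_maps K (subtopology X Y) (\<lambda>k. g (False, k)) (snd \<circ> f)" unfolding homeomorphic_maps_def
  proof (intro conjI ballI)
    have "continuous_map K ?S (Pair False)"
      using continuous_map_component_injection[of False UNIV "\<lambda>b. if b then discrete_topology D else K"] by simp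
    from continuous_map_compose[OF this g(1)] have "continuous_map K X (\<lambda>k. g (False, k))" by (simp add: o_def)
    then show "continuous_map K (subtopology X Y) (\<lambda>k. g (False, k))" using gY by (auto simp: continuous_map_in_subtopology)
    show "continuous_map (subtopology X Y) K (snd \<circ> f)" unfolding continuous_map_def
    proof (intro conjI allI impI)
      show "snd \<circ> f \<in> topspace (subtopology X Y) \<rightarrow> topspace K" using tS unfolding Y_def by auto
      fix U assume U: "openin K U"
      have "{x. (False, x) \<in> {False} \<times> U} = U" by auto
      moreover have "{False} \<times> U \<subseteq> topspace ?S" using openin_subset[OF U] by auto
      ultimately have "openin ?S ({False} \<times> U)" using U by (intro op) auto
      then have "openin X {x \<in> topspace X. f x \<in> {False} \<times> U}" by (rule openin_continuous_map_preimage[OF f(1)])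
      moreover have "{x \<in> topspace (subtopology X Y). (snd \<circ> f) x \<in> U} = {x \<in> topspace X. f x \<in> {False} \<times> U} \<inter> Y"
        unfolding Y_def by (auto simp: mem_Times_iff)
      ultimately show "openin (subtopology X Y) {x \<in> topspace (subtopology X Y). (snd \<circ> f) x \<in> U}" by (auto simp: openin_subtopology)
    qed
    show "(snd \<circ> f) (g (False, k)) = k" if "k \<in> topspace K" for k using g(2)[of "(False, k)"] that tS by simp
    show "g (False, (snd \<circ> f) x) = x" if "x \<in> topspace (subtopology X Y)" for x
    proof -
      have "x \<in> topspace X" "\<not> fst (f x)" using that unfolding Y_def by auto
      then have "(False, snd (f x)) = f x" by (cases "f x") auto
      then show ?thesis using f(2) \<open>x \<in> topspace X\<close> by simp
    qed
  qed
  then have "K homeomorphic_space subtopology X Y" unfolding homeomorphic_space_def by blast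
  then have "cosmic_space (subtopology X Y)" "k_omega_space (subtopology X Y)"
    using K homeomorphic_cosmic_space homeomorphic_k_omega_space by blast+
  then show ?thesis using Yo Do \<open>closedin X Y\<close> unfolding discrete_cosmic_decomposition_def by blast
qed

section \<open>Consequences of a product decomposition of AG(X)\<close>

lemma cosmic_imp_Lindelof_space:
  assumes "cosmic_space K"
  shows "Lindelof_space K"
  unfolding Lindelof_space_def
proof (intro allI impI)
  fix \<U> assume \<U>: "(\<forall>U\<in>\<U>. openin K U) \<and> \<Union>\<U> = topspace K"
  obtain \<N> where \<N>: "countable \<N>" "network_in K \<N>" using assms by (auto simp: cosmic_space_def)
  let ?M = "{N\<in>\<N>. \<exists>U\<in>\<U>. N \<subseteq> U}"
  have "\<forall>N\<in>?M. \<exists>U. U \<in> \<U> \<and> N \<subseteq> U" by blast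
  from bchoice[OF this] obtain c where c: "\<forall>N\<in>?M. c N \<in> \<U> \<and> N \<subseteq> c N" ..
  have "topspace K \<subseteq> \<Union>(c ` ?M)"
  proof
    fix y assume "y \<in> topspace K"
    then obtain U where U: "U \<in> \<U>" "y \<in> U" using \<U> by blast
    then obtain N where "N \<in> \<N>" "y \<in> N" "N \<subseteq> U" using \<U> \<N>(2) unfolding network_in_def by meson
    then show "y \<in> \<Union>(c ` ?M)" using c U by blast
  qed
  moreover have "\<Union>(c ` ?M) \<subseteq> topspace K" using c \<U> by blast
  moreover have "countable (c ` ?M)" using \<N>(1) by simp
  ultimately show "\<exists>\<V>. countable \<V> \<and> \<V> \<subseteq> \<U> \<and> \<Union>\<V> = topspace K" using c by (intro exI[of _ "c ` ?M"]) blast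
qed

lemma cosmic_imp_Tychonoff_space:
  assumes "cosmic_space K"
  shows "Tychonoff_space K"
proof -
  have K: "regular_space K" "t1_space K" using assms by (auto simp: cosmic_space_def regular_t1_space_def)
  then have "normal_space K" using regular_Lindelof_imp_normal_space cosmic_imp_Lindelof_space[OF assms] by blast
  then show ?thesis unfolding Tychonoff_space_def
    using K regular_t1_imp_Hausdorff_space normal_imp_completely_regular_space by blast
qed

text \<open>A product of a \<open>k\<close>-space with a locally compact one, here discrete, is a
  \<open>k\<close>-space; cosmic spaces are regular and Lindelof, hence normal and
  Tychonoff.\<close>

lemma homeomorphic_prod_discrete_cosmic:
  assumes K: "cosmic_space K" "k_omega_space K" and h: "T homeomorphic_space prod_topology (discrete_topology D) K"
  shows "k_space T" "Tychonoff_space T" "closed_aleph_k_space T"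
proof -
  let ?P = "prod_topology (discrete_topology D) K"
  have "k_space ?P" using k_omega_imp_k_space[OF K(2)]
    by (intro k_space_prod_topology_left) (simp_all add: locally_compact_space_discrete_topology)
  then show "k_space T" using homeomorphic_k_space[OF h] by blast
  have "Tychonoff_space ?P" using cosmic_imp_Tychonoff_space[OF K(1)]
    by (simp add: Tychonoff_space_def completely_regular_space_prod_topology completely_regular_space_discrete_topology
        t1_space_prod_topology Hausdorff_imp_t1_space)
  then show T: "Tychonoff_space T" unfolding Tychonoff_space_def
    using homeomorphic_completely_regular_space[OF h] homeomorphic_t1_space[OF h] by blast
  obtain f where f: "homeomorphic_map T ?P f" using h unfolding homeomorphic_space by blast
  then have "embedding_map T ?P f"
    unfolding embedding_map_def by (metis homeomorphic_imp_surjective_map subtopology_topspace)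
  then show "closed_aleph_k_space T"
    using closed_aleph_k_space_embedding[OF closed_aleph_k_space_prod_discrete[OF K]] Tychonoff_imp_regular_t1[OF T] by blast
qed

text \<open>Condition (2) asks for factors on the element type of the group. Copies of both factors
  are found inside \<open>T\<close> itself, as the images of the slices through the point
  \<open>(a, y)\<close>.\<close>

lemma homeomorphic_prod_discrete_retype:
  fixes T :: "'g topology" and A :: "'b set" and K :: "'c topology"
  assumes h: "T homeomorphic_space prod_topology (discrete_topology A) K"
    and K: "cosmic_space K" "k_omega_space K" and pt: "a \<in> A" "y \<in> topspace K"
  shows "\<exists>(D :: 'g set) (K' :: 'g topology). cosmic_space K' \<and> k_omega_space K' \<and>
       T homeomorphic_space prod_topology (discrete_topology D) K'"
proof -
  let ?P = "prod_topology (discrete_topology A) K"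
  obtain k h' where "homeomorphic_maps T ?P k h'" using h unfolding homeomorphic_space_def by blast
  then have hk: "continuous_map T ?P k" "continuous_map ?P T h'"
    "\<And>p. p \<in> topspace ?P \<Longrightarrow> k (h' p) = p"
    by (auto simp: homeomorphic_maps_def)
  note him = continuous_map_image_subset_topspace[OF hk(2)]
  define D where "D = (\<lambda>b. h' (b, y)) ` A"
  define K' where "K' = subtopology T ((\<lambda>z. h' (a, z)) ` topspace K)"
  have "homeomorphic_maps (discrete_topology A) (discrete_topology D) (\<lambda>b. h' (b, y)) (fst \<circ> k)"
    unfolding homeomorphic_maps_def D_def using hk(3) pt by auto
  then have 1: "discrete_topology A homeomorphic_space discrete_topology D" unfolding homeomorphic_space_def by blast
  have "homeomorphic_maps K K' (\<lambda>z. h' (a, z)) (snd \<circ> k)" unfolding homeomorphic_maps_def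
  proof (intro conjI ballI)
    have "continuous_map K ?P (\<lambda>z. (a, z))" using pt(1) by (intro continuous_map_pairedI) auto
    from continuous_map_compose[OF this hk(2)] have "continuous_map K T (\<lambda>z. h' (a, z))" by (simp add: o_def)
    then show "continuous_map K K' (\<lambda>z. h' (a, z))" unfolding K'_def by (auto simp: continuous_map_in_subtopology)
    have "continuous_map T K (snd \<circ> k)" using continuous_map_compose[OF hk(1) continuous_map_snd] .
    then show "continuous_map K' K (snd \<circ> k)" unfolding K'_def by (rule continuous_map_from_subtopology)
    show "(snd \<circ> k) (h' (a, z)) = z" if "z \<in> topspace K" for z using hk(3) that pt(1) by simp
    show "h' (a, (snd \<circ> k) t) = t" if "t \<in> topspace K'" for t
      using that hk(3) pt(1) unfolding K'_def by auto
  qed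
  then have 2: "K homeomorphic_space K'" unfolding homeomorphic_space_def by blast
  have "T homeomorphic_space prod_topology (discrete_topology D) K'"
    using h homeomorphic_space_prod_topology[OF 1 2] homeomorphic_space_trans by blast
  then show ?thesis using homeomorphic_cosmic_space[OF 2 K(1)] homeomorphic_k_omega_space[OF 2 K(2)] by blast
qed

text \<open>The two extensions of the generators are mutually inverse: one composite is the identity
  by uniqueness in the universal property of \<open>T\<close>, the other because it fixes the
  generators. Hence the conditions on \<open>T\<close> may be studied on the concrete free
  group.\<close>

lemma free_topological_abelian_group_homeomorphic:
  assumes free: "free_topological_abelian_group X (G :: 'g monoid) T \<delta>"
  obtains \<phi> \<psi> where "homeomorphic_maps T (FT X) \<phi> \<psi>"
proof -
  let ?A = "free_Abelian_group (topspace X)"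
  have G: "topological_abelian_group G T" and d: "continuous_map X T \<delta>"
    and U1: "universal_for TYPE('a \<Rightarrow>\<^sub>0 int) X G T \<delta>" and U2: "universal_for TYPE('g) X G T \<delta>"
    using free by (simp_all add: free_topological_abelian_group_def)
  obtain \<phi> where \<phi>: "\<phi> \<in> hom G ?A" "continuous_map T (FT X) \<phi>" "\<And>x. x \<in> topspace X \<Longrightarrow> \<phi> (\<delta> x) = frag_of x"
    using universal_for_obtain[OF U1 free_group_topology_group frag_of_continuous] by blast
  obtain \<psi> where \<psi>: "\<psi> \<in> hom ?A G" "continuous_map (FT X) T \<psi>" "\<And>x. x \<in> topspace X \<Longrightarrow> \<psi> (frag_of x) = \<delta> x"
    using universal_for_obtain[OF free_group_universal G d] by blast
  have 1: "(\<psi> \<circ> \<phi>) z = id z" if "z \<in> carrier G" for z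
  proof (rule universal_for_unique[OF U2 G G d, where h = "\<psi> \<circ> \<phi>" and k = id and z = z])
    show "\<psi> \<circ> \<phi> \<in> hom G G" using \<phi>(1) \<psi>(1) by (rule hom_compose)
    show "continuous_map T T (\<psi> \<circ> \<phi>)" using \<phi>(2) \<psi>(2) by (rule continuous_map_compose)
    show "id \<in> hom G G" by (simp add: hom_def)
  qed (use that \<phi>(3) \<psi>(3) in auto)
  have 2: "(\<phi> \<circ> \<psi>) g = id g" if "Poly_Mapping.keys g \<subseteq> topspace X" for g
  proof (rule hom_free_Abelian_group_eqI[OF group_free_Abelian_group _ _ _ that])
    show "\<phi> \<circ> \<psi> \<in> hom ?A ?A" using \<psi>(1) \<phi>(1) by (rule hom_compose)
    show "id \<in> hom ?A ?A" by (simp add: hom_def)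
  qed (use \<phi>(3) \<psi>(3) in auto)
  have "topspace T = carrier G" using G by (simp add: topological_abelian_group_def)
  then have "homeomorphic_maps T (FT X) \<phi> \<psi>"
    using \<phi>(2) \<psi>(2) 1 2 by (auto simp: homeomorphic_maps_def)
  then show thesis by (rule that)
qed

section \<open>The scheme of implications and its assembly\<close>

lemma all_equivalent_sixI:
  assumes "P1 \<Longrightarrow> P2" "P2 \<Longrightarrow> P3" "P2 \<Longrightarrow> P4" "P3 \<Longrightarrow> P6" "P4 \<Longrightarrow> P5" "P5 \<Longrightarrow> P1" "P6 \<Longrightarrow> P1"
  shows "all_equivalent [P1, P2, P3, P4, P5, P6]"
proof -
  have "P2 \<longleftrightarrow> P1" "P3 \<longleftrightarrow> P1" "P4 \<longleftrightarrow> P1" "P5 \<longleftrightarrow> P1" "P6 \<longleftrightarrow> P1" using assms by blast+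
  then show ?thesis unfolding all_equivalent_def by simp
qed

theorem theorem1p16:
  fixes X :: "'a topology"
    and AG :: "'g monoid" and T :: "'g topology" and \<delta> :: "'a \<Rightarrow> 'g"
  assumes "Tychonoff_space X" and "mu_complete_space X" and "k_real_space X"
    and "free_topological_abelian_group X AG T \<delta>"
  shows "all_equivalent
    [\<exists>(D :: 'a set) (K :: 'a topology). cosmic_space K \<and> k_omega_space K \<and>
       X homeomorphic_space sum_topology (\<lambda>b. if b then discrete_topology D else K) (UNIV :: bool set),
     \<exists>(D :: 'g set) (K :: 'g topology). cosmic_space K \<and> k_omega_space K \<and>
       T homeomorphic_space prod_topology (discrete_topology D) K,
     aleph_k_space X \<and> k_space T,
     closed_aleph_k_space X \<and> Ascoli_space T,
     closed_aleph_k_space X \<and> \<not> (\<exists>F. strict_Fin_fan T omega_1 F),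
     aleph_k_space X \<and> \<not> (\<exists>F. strict_Fin_fan T omega F) \<and> \<not> (\<exists>F. Fin_fan T omega_1 F)]"
    (is "all_equivalent [?P1, ?P2, ?P3, ?P4, ?P5, ?P6]")
proof (rule all_equivalent_sixI)
  obtain \<phi> \<psi> where hm: "homeomorphic_maps T (FT X) \<phi> \<psi>"
    using free_topological_abelian_group_homeomorphic[OF assms(4)] .
  then have hs: "T homeomorphic_space FT X" unfolding homeomorphic_space_def by blast
  have mh: "homeomorphic_maps (FT X) T \<psi> \<phi>" by (rule homeomorphic_maps_sym[THEN iffD1, OF hm])
  \<comment> \<open>Topological properties of \<open>T\<close> come directly from the product, while
    the network on \<open>X\<close> is inherited through the embedding of \<open>X\<close> as
    generators.\<close>
  have P2: "k_space T \<and> Tychonoff_space T \<and> closed_aleph_k_space X" if P2: ?P2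
  proof -
    obtain D :: "'g set" and K :: "'g topology" where K: "cosmic_space K" "k_omega_space K"
      "T homeomorphic_space prod_topology (discrete_topology D) K" using P2 by blast
    have "FT X homeomorphic_space prod_topology (discrete_topology D) K"
      using hs K(3) homeomorphic_space_sym homeomorphic_space_trans by blast
    then have "closed_aleph_k_space (FT X)" by (rule homeomorphic_prod_discrete_cosmic(3)[OF K(1,2)])
    then have "closed_aleph_k_space X"
      by (rule closed_aleph_k_space_embedding[OF _ frag_of_embedding[OF assms(1)] Tychonoff_imp_regular_t1[OF assms(1)]])
    then show ?thesis using homeomorphic_prod_discrete_cosmic(1,2)[OF K] by blast
  qed
  show ?P2 if ?P1
  proof -
    obtain Y where Y: "discrete_cosmic_decomposition X Y" using \<open>?P1\<close> homeomorphic_sum_imp_decomposition by blast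
    let ?Y = "subtopology X Y" and ?A = "carrier (free_Abelian_group (topspace X - Y))"
    have dY: "openin X Y" "\<And>A. A \<subseteq> topspace X - Y \<Longrightarrow> openin X A" "cosmic_space ?Y" "k_omega_space ?Y"
      using Y unfolding discrete_cosmic_decomposition_def by blast+
    have tych: "Tychonoff_space ?Y" using assms(1)
      by (simp add: Tychonoff_space_def completely_regular_space_subtopology t1_space_subtopology)
    have "T homeomorphic_space prod_topology (discrete_topology ?A) (FT ?Y)"
      using hs FT_decomposition[OF dY(1,2)] homeomorphic_space_trans unfolding homeomorphic_space_def by blast
    moreover have "cosmic_space (FT ?Y)" by (rule FT_cosmic[OF tych dY(3)])
    moreover obtain C where "k_omega_chain ?Y C" using k_omega_space_imp_chain[OF dY(4)] .
    then have "k_omega_space (FT ?Y)" by (rule k_omega_chain_imp_space[OF FT_k_omega_chain[OF tych]])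
    \<comment> \<open>Both factors are groups of formal combinations, so zero serves as base point
      in each.\<close>
    ultimately show ?P2 by (rule homeomorphic_prod_discrete_retype[where a = 0 and y = 0]) simp_all
  qed
  show ?P3 if ?P2 using P2[OF that] closed_aleph_k_imp_aleph_k by blast
  show ?P4 if ?P2 using P2[OF that] k_space_imp_Ascoli by blast
  show ?P6 if ?P3
  proof -
    have "t1_space T" using FT_Hausdorff[OF assms(1)] homeomorphic_t1_space[OF hs] Hausdorff_imp_t1_space by blast
    then have "\<not> Fin_fan T omega F" "\<not> Fin_fan T omega_1 F'" for F F'
      using that by (simp_all add: k_space_no_Fin_fan)
    moreover from this have "\<not> strict_Fin_fan T omega F" for F by (simp add: strict_Fin_fan_def)
    ultimately show ?P6 using that by blast
  qed
  show ?P5 if ?P4 using that Ascoli_no_strict_Fin_fan by blast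
  show ?P1 if P5: ?P5
  proof -
    obtain \<N> where \<N>: "k_network_in X \<N>" "compact_countable_in X \<N>" "\<forall>N\<in>\<N>. closedin X N"
      using P5 unfolding closed_aleph_k_space_def by blast
    interpret k_network_space X \<N> using assms \<N> by unfold_locales
    have "\<not> (\<exists>F. strict_Fin_fan (FT X) omega_1 F)" using P5 strict_Fin_fan_homeomorphic_image[OF mh] by blast
    then have "\<exists>Y. discrete_cosmic_decomposition X Y" using no_strict_Fin_fan_imp_decomposition \<N>(3) by blast
    then show ?P1 using decomposition_imp_homeomorphic_sum by blast
  qed
  show ?P1 if P6: ?P6
  proof -
    obtain \<N> where \<N>: "k_network_in X \<N>" "compact_countable_in X \<N>"
      using P6 unfolding aleph_k_space_def by blast
    interpret k_network_space X \<N> using assms \<N> by unfold_locales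
    have "\<not> (\<exists>F. Fin_fan (FT X) omega_1 F)" using P6 Fin_fan_homeomorphic_image[OF mh] by blast
    then have "\<exists>Y. discrete_cosmic_decomposition X Y" by (rule no_Fin_fan_imp_decomposition)
    then show ?P1 using decomposition_imp_homeomorphic_sum by blast
  qed
qed

end
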